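(* Let $(T,A)$ be a measurable cocycle on $\Delta\times\mathbb{R}^p$. For $\mu$-almost every $x\in\Delta$ the following holds: if $G\subset\mathbb{R}^p$ is any affine subspace parallel to a linear subspace $G_0\subset\mathbb{R}^p$ transverse to the central stable space $E^{cs}(x)$ (i.e. $G_0\cap E^{cs}(x)=\{0\}$), then the Hausdorff dimension of $G\cap W^s(x)$ is equal to $0$.
   Context: A cocycle is a pair $(T,A)$, $T:\Delta\to\Delta$, $A:\Delta\to\mathrm{GL}(p,\mathbb{R})$, viewed as $(x,w)\mapsto(T(x),A(x)w)$, with $A_n(x)=A(T^{n-1}(x))\cdots A(x)$. It is a measurable cocycle if $(\Delta,\mu)$ is a probability space, $\mu$ is $T$-invariant and ergodic, $A$ is measurable and $\int_\Delta\ln\|A(x)\|\,d\mu(x)<\infty$. Central stable space: $E^{cs}(x)=\{w:\limsup_n\|A_n(x)w\|^{1/n}\le1\}$. Weak-stable space: $W^s(x)=\{w\in\mathbb{R}^p:\|A_n(x)w\|_{\mathbb{R}^p/\mathbb{Z}^p}\to0\}$, where $\|\cdot\|_{\mathbb{R}^p/\mathbb{Z}^p}$ is the Euclidean distance to $\mathbb{Z}^p$. *)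

theory Defs
  imports "HOL-Probability.Probability"
begin

definition ergodic_map :: "'a measure \<Rightarrow> ('a \<Rightarrow> 'a) \<Rightarrow> bool" where
  "ergodic_map M T \<longleftrightarrow>
     (\<forall>S\<in>sets M. T -` S \<inter> space M = S \<longrightarrow> measure M S = 0 \<or> measure M S = 1)"

definition mat_norm :: "real^'p^'p \<Rightarrow> real" where
  "mat_norm B = onorm (\<lambda>v. B *v v)"

text \<open>A measurable cocycle (T,A) on a probability space M, with values in GL(p,R).
  The integrability condition is the usual one: the positive part of ln of the norm
  has finite integral.\<close>
definition measurable_cocycle ::
  "'a measure \<Rightarrow> ('a \<Rightarrow> 'a) \<Rightarrow> ('a \<Rightarrow> real^'p^'p) \<Rightarrow> bool" where
  "measurable_cocycle M T A \<longleftrightarrow>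
     prob_space M \<and>
     T \<in> measurable M M \<and> distr M M T = M \<and> ergodic_map M T \<and>
     A \<in> borel_measurable M \<and>
     (\<forall>x\<in>space M. invertible (A x)) \<and>
     (\<integral>\<^sup>+ x. ennreal (ln (mat_norm (A x))) \<partial>M) < \<infinity>"

fun cocycle_iter :: "('a \<Rightarrow> 'a) \<Rightarrow> ('a \<Rightarrow> real^'p^'p) \<Rightarrow> nat \<Rightarrow> 'a \<Rightarrow> real^'p^'p" where
  "cocycle_iter T A 0 x = mat 1"
| "cocycle_iter T A (Suc n) x = A ((T ^^ n) x) ** cocycle_iter T A n x"

definition central_stable ::
  "('a \<Rightarrow> 'a) \<Rightarrow> ('a \<Rightarrow> real^'p^'p) \<Rightarrow> 'a \<Rightarrow> (real^'p) set" where
  "central_stable T A x =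
     {w. limsup (\<lambda>n. ereal (root n (norm (cocycle_iter T A n x *v w)))) \<le> 1}"

definition int_lattice :: "(real^'p) set" where
  "int_lattice = {v. \<forall>i. v $ i \<in> \<int>}"

definition weak_stable ::
  "('a \<Rightarrow> 'a) \<Rightarrow> ('a \<Rightarrow> real^'p^'p) \<Rightarrow> 'a \<Rightarrow> (real^'p) set" where
  "weak_stable T A x =
     {w. (\<lambda>n. infdist (cocycle_iter T A n x *v w) int_lattice) \<longlonglongrightarrow> 0}"

text \<open>Contribution diam(U)^s of a covering set, with the conventions
  diam(empty)^s = 0 and 0^0 = 1 (for nonempty sets).\<close>
definition diam_pow :: "real \<Rightarrow> 'b::metric_space set \<Rightarrow> ennreal" where
  "diam_pow s U =
     (if U = {} then 0
      else if s = 0 then 1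
      else ennreal (diameter U powr s))"

definition hausdorff_pre :: "real \<Rightarrow> real \<Rightarrow> 'b::metric_space set \<Rightarrow> ennreal" where
  "hausdorff_pre s \<delta> S =
     (INF U \<in> {U :: nat \<Rightarrow> 'b set. S \<subseteq> (\<Union>i. U i) \<and>
                  (\<forall>i. bounded (U i) \<and> diameter (U i) \<le> \<delta>)}.
        (\<Sum>i. diam_pow s (U i)))"

definition hausdorff_measure :: "real \<Rightarrow> 'b::metric_space set \<Rightarrow> ennreal" where
  "hausdorff_measure s S = (SUP \<delta> \<in> {0<..}. hausdorff_pre s \<delta> S)"

definition hausdorff_dim :: "'b::metric_space set \<Rightarrow> ereal" where
  "hausdorff_dim S = Inf {ereal s | s. 0 \<le> s \<and> hausdorff_measure s S = 0}"

end

theory Submission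
  imports Defs
begin

text \<open>
  A point of the weak-stable set is followed by a sequence of nearby integer vectors, and while
  \<open>\<parallel>A(T\<^sup>n x)\<parallel>\<close> is moderate each of them determines the next one. Since \<open>ln\<^sup>+ \<parallel>A\<parallel>\<close> is integrable, the ergodic
  theorem shows that for small errors at most \<open>e\<^bsup>\<epsilon>n\<^esup>\<close> integer vectors are reachable at time \<open>n\<close>.
  If \<open>A\<^sub>n(x)\<close> expands \<open>G0\<close> by \<open>e\<^bsup>rn\<^esup>\<close> for infinitely many \<open>n\<close>, this yields covers of the set by \<open>e\<^bsup>\<epsilon>n\<^esup>\<close> sets
  of diameter \<open>e\<^bsup>-rn\<^esup>\<close>, with \<open>\<epsilon>\<close> arbitrarily small.

  The uniform expansion replaces the multiplicative ergodic theorem. Let \<open>\<Lambda> j\<close> be the growth rate of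
  the maximal volume expansion in dimensions at most \<open>j\<close>, and let \<open>q\<close> be the least \<open>j\<close> at which \<open>\<Lambda>\<close> is
  maximal. The Karlsson--Margulis lemma provides times \<open>n\<close> at which
  \<open>A\<^sub>n(x) = A\<^bsub>n-k\<^esub>(T\<^sup>k x) A\<^sub>k(x)\<close> has almost multiplicative \<open>q\<close>-volume for all \<open>k \<le> n\<close>. The directions
  complementary to the \<open>q\<close> most expanded ones for such an \<open>n\<close> grow subexponentially up to time \<open>n\<close>;
  passing to a limit, the central stable space has codimension at most \<open>q\<close>. A transverse vector must
  therefore account for the jump from \<open>(q - 1)\<close>-volume to \<open>q\<close>-volume.
\<close>

section \<open>Row determinants\<close>

text \<open>Only the positive part of \<open>ln (mat_norm (A x))\<close> is integrable, so Lyapunov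
  exponents may equal \<open>-\<infinity>\<close>. Admitting frames of at most, rather than exactly,
  \<open>j\<close> vectors keeps every volume at least 1, so that its logarithm is nonnegative and
  integrable.

  The obstacle is uniformity: the covers require all of \<open>G0\<close> to be expanded at the same
  time \<open>n\<close>, whereas membership in the central stable space is a limsup condition on
  single vectors. Volumes compare all directions at once. On the other hand a null Hausdorff measure
  needs just one efficient cover at each scale, so expansion at arbitrarily large times is enough;
  upper ergodic bounds and a set of good points of positive measure provide it.

  Volumes are written as determinants with free test rows instead of norms on exterior powers. The
  linear algebra then consists of replacing one row by a vector known to lie in the span of the
  others, or to be orthogonal to a missing direction.\<close>

abbreviation row_det :: "('p::finite \<Rightarrow> real^'p) \<Rightarrow> real" where
  "row_det r \<equiv> det (vec_lambda r)"

lemma vec_lambda_fun_upd: "vec_lambda (r(i := x)) = (\<chi> k. if k = i then x else r k)"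
  by (simp add: fun_upd_def)

lemma row_det_add: "row_det (r(i := x + y)) = row_det (r(i := x)) + row_det (r(i := y))"
  using det_row_add[of i "\<lambda>_. x" "\<lambda>_. y" r] by (simp add: vec_lambda_fun_upd)

lemma row_det_scaleR: "row_det (r(i := c *\<^sub>R x)) = c * row_det (r(i := x))"
  using det_row_mul[of i c "\<lambda>_. x" r] unfolding scalar_mult_eq_scaleR
  by (simp add: vec_lambda_fun_upd)

lemma row_det_span:
  fixes r :: "'p::finite \<Rightarrow> real^'p"
  assumes "x \<in> span (r ` (UNIV - {i}))"
  shows "row_det (r(i := x)) = 0"
proof -
  let ?A = "vec_lambda (r(i := 0)) :: real^'p^'p"
  have "{row j ?A |j. j \<noteq> i} = r ` (UNIV - {i})"
    by (auto simp: row_def image_iff vec_eq_iff)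
  then have "x \<in> vec.span {row j ?A |j. j \<noteq> i}"
    using assms by (simp add: span_vec_eq)
  from det_row_span[OF this]
  have "det (\<chi> k. if k = i then row i ?A + x else row k ?A) = det ?A" .
  moreover have "(\<chi> k. if k = i then row i ?A + x else row k ?A) = vec_lambda (r(i := x))"
    by (auto simp: row_def vec_eq_iff)
  moreover have "det ?A = 0"
    using row_det_scaleR[of r i 0 0] by simp
  ultimately show ?thesis by simp
qed

lemma row_det_add_span:
  fixes r :: "'p::finite \<Rightarrow> real^'p"
  assumes "y \<in> span (r ` (UNIV - {i}))"
  shows "row_det (r(i := x + y)) = row_det (r(i := x))"
  using row_det_add[of r i x y] row_det_span[OF assms] by simp

lemma det_eq_0_of_orthogonal_rows:
  fixes M :: "real^'p^'p"
  assumes "\<And>i. M $ i \<bullet> z = 0" "z \<noteq> 0"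
  shows "det M = 0"
proof -
  have "M *v z = 0"
    using assms(1) by (simp add: vec_eq_iff matrix_vector_mul_component)
  then have "\<not> inj ((*v) M)"
    using assms(2) by (metis injD matrix_vector_mult_0_right)
  then show ?thesis
    by (metis det_identical_rows invertible_det_nz invertible_left_inverse matrix_left_invertible_injective)
qed

text \<open>A crude Leibniz bound; the factorial is harmless because only exponential growth rates
  matter later.\<close>

lemma abs_det_le:
  fixes M :: "real^'p^'p"
  shows "\<bar>det M\<bar> \<le> fact CARD('p) * (\<Prod>i\<in>UNIV. norm (M $ i))"
proof -
  let ?P = "{p. p permutes (UNIV::'p set)}"
  have "\<bar>det M\<bar> \<le> (\<Sum>p\<in>?P. \<bar>of_int (sign p) * (\<Prod>i\<in>UNIV. M $ i $ p i)\<bar>)"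
    unfolding det_def by (rule sum_abs)
  also have "\<dots> \<le> (\<Sum>p\<in>?P. \<Prod>i\<in>UNIV. norm (M $ i))"
  proof (rule sum_mono)
    fix p assume "p \<in> ?P"
    have "\<bar>of_int (sign p) * (\<Prod>i\<in>UNIV. M $ i $ p i)\<bar> = (\<Prod>i\<in>UNIV. \<bar>M $ i $ p i\<bar>)"
      by (simp add: abs_mult abs_prod sign_def)
    also have "\<dots> \<le> (\<Prod>i\<in>UNIV. norm (M $ i))"
      by (rule prod_mono) (auto simp: component_le_norm_cart)
    finally show "\<bar>of_int (sign p) * (\<Prod>i\<in>UNIV. M $ i $ p i)\<bar> \<le> (\<Prod>i\<in>UNIV. norm (M $ i))" .
  qed
  also have "\<dots> = fact CARD('p) * (\<Prod>i\<in>UNIV. norm (M $ i))"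
    by (simp add: card_permutations)
  finally show ?thesis .
qed

lemma orthogonal_matrix_expansion:
  fixes Z :: "real^'p^'p"
  assumes "orthogonal_matrix Z"
  shows "v = (\<Sum>l\<in>UNIV. (v \<bullet> Z $ l) *\<^sub>R Z $ l)"
proof -
  have "v = transpose Z *v (Z *v v)"
    using assms by (simp add: orthogonal_matrix_def matrix_vector_mul_assoc)
  also have "\<dots> = (\<Sum>l\<in>UNIV. (v \<bullet> Z $ l) *\<^sub>R Z $ l)"
    by (simp add: vec_eq_iff matrix_vector_mult_def[of "transpose Z"] transpose_def
        inner_vec_def[of "Z *v v"] matrix_vector_mul_component inner_commute mult.commute
        del: transpose_matrix_vector)
  finally show ?thesis .
qed

lemma orthogonal_matrix_norm_row:
  fixes Z :: "real^'p^'p"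
  assumes "orthogonal_matrix Z"
  shows "norm (Z $ i) = 1"
  using assms unfolding orthogonal_matrix_orthonormal_rows by (simp add: row_def vec_lambda_eta)

text \<open>Plays the role of a QR factorisation: an orthonormal basis of the span of
  \<open>y\<close> on \<open>J\<close> is completed to one of the whole space, and indices are
  distributed so that the first basis sits inside \<open>J\<close>. The family \<open>y\<close> may
  be linearly dependent.\<close>

lemma adapted_orthogonal_matrix:
  fixes y :: "'p::finite \<Rightarrow> real^'p" and J :: "'p set"
  obtains Z :: "real^'p^'p" where "orthogonal_matrix Z"
    "\<And>i m. i \<in> J \<Longrightarrow> m \<notin> J \<Longrightarrow> y i \<bullet> Z $ m = 0"
proof -
  obtain B where B: "B \<subseteq> span (y ` J)" "pairwise orthogonal B" "\<And>x. x \<in> B \<Longrightarrow> norm x = 1"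
    "independent B" "card B = dim (span (y ` J))" "span B = span (y ` J)"
    using orthonormal_basis_subspace[OF subspace_span] by metis
  obtain U where U: "U \<inter> insert 0 B = {}" "pairwise orthogonal (B \<union> U)"
    "span (B \<union> U) = span (B \<union> UNIV)"
    using orthogonal_extension_strong[OF B(2)] by metis
  define U' where "U' = (\<lambda>x. x /\<^sub>R norm x) ` U"
  define C where "C = B \<union> U'"
  have "0 \<notin> U" using U(1) by auto
  have "pairwise orthogonal C"
    unfolding pairwise_def C_def U'_def
  proof (intro ballI impI)
    have orth: "orthogonal a b" if "a \<in> B \<union> U" "b \<in> B \<union> U" "a \<noteq> b" for a b
      using U(2) that by (simp add: pairwise_def)
    fix x y assume xy: "x \<in> B \<union> (\<lambda>x. x /\<^sub>R norm x) ` U" "y \<in> B \<union> (\<lambda>x. x /\<^sub>R norm x) ` U" "x \<noteq> y"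
    obtain a s where a: "a \<in> B \<union> U" "x = s *\<^sub>R a" "a \<in> B \<Longrightarrow> s = 1" "a \<in> U \<Longrightarrow> s = inverse (norm a)"
      using xy(1) U(1) by (metis (no_types, lifting) Un_iff disjoint_iff image_iff insert_iff scaleR_one)
    obtain b t where b: "b \<in> B \<union> U" "y = t *\<^sub>R b" "b \<in> B \<Longrightarrow> t = 1" "b \<in> U \<Longrightarrow> t = inverse (norm b)"
      using xy(2) U(1) by (metis (no_types, lifting) Un_iff disjoint_iff image_iff insert_iff scaleR_one)
    have "a \<noteq> b" using a b xy(3) by auto
    then show "orthogonal x y" using orth[of a b] a b by (simp add: orthogonal_clauses)
  qed
  have normC: "norm x = 1" if "x \<in> C" for x
    using that B(3) \<open>0 \<notin> U\<close> by (auto simp: C_def U'_def) (metis left_inverse norm_eq_zero)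
  have indC: "independent C"
    using pairwise_orthogonal_independent[OF \<open>pairwise orthogonal C\<close>] normC by fastforce
  have finC: "finite C" using indC independent_imp_finite by blast
  have "B \<union> U \<subseteq> span C"
  proof
    fix x assume x: "x \<in> B \<union> U"
    show "x \<in> span C"
    proof (cases "x \<in> B")
      case True then show ?thesis by (simp add: C_def span_base)
    next
      case False
      then have "x \<in> U" using x by auto
      then have "x /\<^sub>R norm x \<in> span C" by (simp add: C_def U'_def span_base)
      then have "norm x *\<^sub>R (x /\<^sub>R norm x) \<in> span C" by (rule span_scale)
      moreover have "norm x \<noteq> 0" using \<open>0 \<notin> U\<close> \<open>x \<in> U\<close> by auto
      ultimately show ?thesis by (simp add: divide_inverse[symmetric])
    qed
  qed
  then have "span (B \<union> U) \<subseteq> span C" by (simp add: span_minimal)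
  then have spanC: "span C = UNIV" using U(3) by (simp add: span_UNIV top.extremum_unique)
  have cardC: "card C = CARD('p)"
    using indC spanC by (metis dim_UNIV dim_eq_card_independent dim_span DIM_cart DIM_real mult.right_neutral)
  have "card B \<le> card J"
    using B(5) dim_le_card'[of "y ` J"] card_image_le[of J y] by (simp add: dim_span)
  \<comment> \<open>For dependent \<open>y\<close> this is a proper subset of \<open>J\<close>. The
    other indices of \<open>J\<close> then receive vectors orthogonal to all \<open>y i\<close>,
    which does no harm: the claim concerns rows outside \<open>J\<close> only.\<close>
  then obtain J1 where J1: "J1 \<subseteq> J" "card J1 = card B"
    by (meson obtain_subset_with_card_n)
  have finB: "finite B" using finC by (simp add: C_def)
  obtain h1 where h1: "bij_betw h1 J1 B"
    using J1(2) finB by (metis finite bij_betw_iff_card)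
  have "card (UNIV - J1) = card (C - B)"
    using cardC J1(2) finB by (simp add: card_Diff_subset C_def)
  then obtain h2 where h2: "bij_betw h2 (UNIV - J1) (C - B)"
    using finC by (metis finite finite_Diff bij_betw_iff_card)
  define h where "h = (\<lambda>i. if i \<in> J1 then h1 i else h2 i)"
  have "bij_betw h J1 B" using h1 by (simp add: h_def cong: bij_betw_cong)
  moreover have "bij_betw h (UNIV - J1) (C - B)"
    using h2 by (subst bij_betw_cong[where g=h2]) (auto simp: h_def)
  ultimately have "bij_betw h (J1 \<union> (UNIV - J1)) (B \<union> (C - B))"
    by (rule bij_betw_combine) auto
  then have h: "bij_betw h UNIV C" by (simp add: C_def)
  define Z :: "real^'p^'p" where "Z = vec_lambda h"
  have rowZ: "row i Z = h i" for i by (simp add: row_def Z_def vec_lambda_eta)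
  have hC: "h i \<in> C" for i using h by (auto simp: bij_betw_def)
  have horth: "orthogonal (h i) (h j)" if "i \<noteq> j" for i j
    using \<open>pairwise orthogonal C\<close> hC h that by (metis bij_betw_imp_inj_on injD pairwiseD)
  have "orthogonal_matrix Z"
    unfolding orthogonal_matrix_orthonormal_rows rowZ using normC hC horth by auto
  moreover have "y i \<bullet> Z $ m = 0" if "i \<in> J" "m \<notin> J" for i m
  proof -
    have "h m \<notin> B"
    proof
      assume "h m \<in> B"
      then obtain l where "l \<in> J1" "h l = h m" using \<open>bij_betw h J1 B\<close> by (auto simp: bij_betw_def image_iff)
      then have "l = m" using h by (metis bij_betw_imp_inj_on injD)
      then show False using \<open>l \<in> J1\<close> J1 that by auto
    qed
    have "orthogonal (h m) x" if "x \<in> B" for x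
      using \<open>pairwise orthogonal C\<close> hC[of m] \<open>h m \<notin> B\<close> that unfolding C_def
      by (metis UnCI pairwiseD)
    then have "orthogonal (h m) x" if "x \<in> span B" for x
      using that orthogonal_to_span by blast
    moreover have "y i \<in> span B" using B(6) that by (simp add: span_base)
    ultimately show ?thesis by (metis Z_def orthogonal_def inner_commute vec_lambda_beta)
  qed
  ultimately show ?thesis using that by blast
qed

text \<open>Since \<open>y i\<close> with \<open>i\<close> in \<open>J\<close> is a combination of
  the rows of \<open>Z\<close> in \<open>J\<close> alone, passing from the rows
  \<open>X *v Z $ i\<close> to the rows \<open>X *v y i\<close> is left multiplication by a matrix
  that depends neither on \<open>X\<close> nor on \<open>w\<close>. Its determinant can be read off
  from one special choice of both.\<close>

lemma row_det_factor:
  fixes X Z :: "real^'p^'p" and y w :: "'p \<Rightarrow> real^'p"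
  assumes Z: "orthogonal_matrix Z"
    and y: "\<And>i m. i \<in> J \<Longrightarrow> m \<notin> J \<Longrightarrow> y i \<bullet> Z $ m = 0"
  shows "\<bar>row_det (override_on w (\<lambda>i. X *v y i) J)\<bar> =
    \<bar>row_det (override_on (($) Z) y J)\<bar> * \<bar>row_det (override_on w (\<lambda>i. X *v (Z $ i)) J)\<bar>"
proof -
  define L :: "real^'p^'p" where
    "L = (\<chi> i l. if i \<in> J then y i \<bullet> Z $ l else if i = l then 1 else 0)"
  have fact: "row_det (override_on w (\<lambda>i. X *v y i) J) = det L * row_det (override_on w (\<lambda>i. X *v (Z $ i)) J)"
    for X :: "real^'p^'p" and w :: "'p \<Rightarrow> real^'p"
  proof -
    define R where "R = override_on w (\<lambda>i. X *v (Z $ i)) J"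
    have "override_on w (\<lambda>i. X *v y i) J i = (\<Sum>l\<in>UNIV. (L $ i $ l) *\<^sub>R R l)" for i
    proof (cases "i \<in> J")
      case True
      have "X *v y i = X *v (\<Sum>l\<in>UNIV. (y i \<bullet> Z $ l) *\<^sub>R Z $ l)"
        using orthogonal_matrix_expansion[OF Z, of "y i"] by simp
      also have "\<dots> = (\<Sum>l\<in>UNIV. (y i \<bullet> Z $ l) *\<^sub>R (X *v (Z $ l)))"
        by (simp add: linear_sum linear_scale o_def)
      also have "\<dots> = (\<Sum>l\<in>UNIV. (L $ i $ l) *\<^sub>R R l)"
        using True y by (intro sum.cong) (auto simp: L_def R_def override_on_def)
      finally show ?thesis using True by simp
    next
      case False
      have "(\<Sum>l\<in>UNIV. (L $ i $ l) *\<^sub>R R l) = (\<Sum>l\<in>UNIV. if i = l then R l else 0)"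
        using False by (intro sum.cong) (auto simp: L_def)
      then show ?thesis using False by (simp add: R_def)
    qed
    then have "vec_lambda (override_on w (\<lambda>i. X *v y i) J) = L ** vec_lambda R"
      by (simp add: vec_eq_iff matrix_matrix_mult_def)
    then show ?thesis by (simp add: det_mul R_def)
  qed
  \<comment> \<open>The special choice: \<open>X\<close> the identity and the rows of
    \<open>Z\<close> as test rows, so that the second factor is \<open>det Z\<close>, of absolute
    value 1.\<close>
  have "override_on (($) Z) (($) Z) J = ($) Z" by (auto simp: override_on_def)
  then have "row_det (override_on (($) Z) y J) = det L * det Z"
    using fact[of "($) Z" "mat 1"] by (simp add: vec_lambda_eta)
  moreover have "\<bar>det Z\<bar> = 1" using det_orthogonal_matrix[OF Z] by auto
  ultimately show ?thesis using fact[of w X] by (simp add: abs_mult)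
qed

section \<open>Maximal volume growth\<close>

definition unit_frames :: "nat \<Rightarrow> ('p::finite set \<times> ('p \<Rightarrow> real^'p) \<times> ('p \<Rightarrow> real^'p)) set" where
  "unit_frames j = {(J, v, w). card J \<le> j \<and> (\<forall>i. norm (v i) \<le> 1) \<and> (\<forall>i. norm (w i) \<le> 1)}"

text \<open>This is the maximum of the norms of the exterior powers of \<open>B\<close> of degree at
  most \<open>j\<close>, that is, the product of \<open>max 1 \<sigma>\<close> over the
  \<open>j\<close> largest singular values \<open>\<sigma>\<close> (all of them if \<open>j\<close>
  exceeds the dimension): the best test vectors form an orthonormal basis of the complement of the
  image of the frame.\<close>

definition vol_growth :: "nat \<Rightarrow> real^'p^'p \<Rightarrow> real" where
  "vol_growth j B = (SUP (J, v, w) \<in> unit_frames j. \<bar>row_det (override_on w (\<lambda>i. B *v v i) J)\<bar>)"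

lemma mat_norm: "norm (B *v v) \<le> mat_norm B * norm v"
  unfolding mat_norm_def by (rule onorm) simp

lemma mat_norm_nonneg: "0 \<le> mat_norm B"
  unfolding mat_norm_def by (rule onorm_pos_le) simp

lemma unit_frame_det_le:
  fixes B :: "real^'p^'p"
  assumes "(J, v, w) \<in> unit_frames j"
  shows "\<bar>row_det (override_on w (\<lambda>i. B *v v i) J)\<bar> \<le> fact CARD('p) * max 1 (mat_norm B) ^ CARD('p)"
proof -
  have "norm (override_on w (\<lambda>i. B *v v i) J i) \<le> max 1 (mat_norm B)" for i
  proof (cases "i \<in> J")
    case True
    have "norm (B *v v i) \<le> mat_norm B * norm (v i)" by (rule mat_norm)
    also have "\<dots> \<le> mat_norm B * 1"
      using assms mat_norm_nonneg by (intro mult_left_mono) (auto simp: unit_frames_def)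
    finally show ?thesis using True by simp
  next
    case False
    then have "norm (override_on w (\<lambda>i. B *v v i) J i) \<le> 1"
      using assms by (auto simp: unit_frames_def)
    then show ?thesis by linarith
  qed
  then have "(\<Prod>i\<in>UNIV. norm (override_on w (\<lambda>i. B *v v i) J i)) \<le> (\<Prod>i\<in>(UNIV::'p set). max 1 (mat_norm B))"
    by (intro prod_mono) auto
  then show ?thesis
    using abs_det_le[of "vec_lambda (override_on w (\<lambda>i. B *v v i) J)"]
    by (simp add: order_trans[OF _ mult_left_mono])
qed

lemma vol_growth_bdd:
  fixes B :: "real^'p^'p"
  shows "bdd_above ((\<lambda>(J, v, w). \<bar>row_det (override_on w (\<lambda>i. B *v v i) J)\<bar>) ` unit_frames j)"
  by (rule bdd_aboveI[where M="fact CARD('p) * max 1 (mat_norm B) ^ CARD('p)"])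
    (auto intro: unit_frame_det_le)

lemma vol_growth_upper:
  fixes B :: "real^'p^'p"
  assumes "(J, v, w) \<in> unit_frames j"
  shows "\<bar>row_det (override_on w (\<lambda>i. B *v v i) J)\<bar> \<le> vol_growth j B"
  using cSUP_upper[OF assms vol_growth_bdd[of B j]] by (simp add: vol_growth_def)

lemma identity_frame: "({}, ($) (mat 1), ($) (mat 1 :: real^'p^'p)) \<in> unit_frames j"
proof -
  have "orthogonal_matrix (mat 1 :: real^'p^'p)" by (simp add: orthogonal_matrix_id)
  from orthogonal_matrix_norm_row[OF this] have "norm ((mat 1 :: real^'p^'p) $ i) \<le> 1" for i by simp
  then show ?thesis unfolding unit_frames_def by auto
qed

text \<open>The empty frame with the identity rows as test vectors has determinant 1. Logarithms of
  volumes are thus nonnegative, as \<open>subadditive_upper_bound\<close> requires.\<close>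

lemma vol_growth_ge_1:
  fixes B :: "real^'p^'p"
  shows "1 \<le> vol_growth j B"
  using vol_growth_upper[OF identity_frame, of B j] by (simp add: override_on_def vec_lambda_eta)

lemma less_vol_growth_iff:
  fixes B :: "real^'p^'p"
  shows "c < vol_growth j B \<longleftrightarrow>
    (\<exists>(J, v, w) \<in> unit_frames j. c < \<bar>row_det (override_on w (\<lambda>i. B *v v i) J)\<bar>)"
  unfolding vol_growth_def
  by (subst less_cSUP_iff) (use identity_frame vol_growth_bdd in \<open>auto simp: case_prod_beta\<close>)

lemma vol_growth_le:
  fixes B :: "real^'p^'p"
  assumes "\<And>J v w. (J, v, w) \<in> unit_frames j \<Longrightarrow> \<bar>row_det (override_on w (\<lambda>i. B *v v i) J)\<bar> \<le> c"
  shows "vol_growth j B \<le> c"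
  using assms less_vol_growth_iff[of c j B] by (force simp: not_less[symmetric])

lemma vol_growth_le_norm:
  fixes B :: "real^'p^'p"
  shows "vol_growth j B \<le> fact CARD('p) * max 1 (mat_norm B) ^ CARD('p)"
  by (rule vol_growth_le) (rule unit_frame_det_le)

lemma vol_growth_mono: "j \<le> k \<Longrightarrow> vol_growth j B \<le> vol_growth k B"
  by (rule vol_growth_le) (auto intro!: vol_growth_upper simp: unit_frames_def)

text \<open>Homogeneity in each row: the later row replacements put vectors of arbitrary norm into
  the frame or among the test vectors.\<close>

lemma vol_growth_upper_norms:
  fixes B :: "real^'p^'p"
  assumes "card J \<le> j"
  shows "\<bar>row_det (override_on w (\<lambda>i. B *v v i) J)\<bar> \<le>
    (\<Prod>i\<in>UNIV. if i \<in> J then norm (v i) else norm (w i)) * vol_growth j B"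
proof -
  define v' w' where "v' = (\<lambda>i. sgn (v i))" and "w' = (\<lambda>i. sgn (w i))"
  define c where "c = (\<lambda>i. if i \<in> J then norm (v i) else norm (w i))"
  have v: "v i = norm (v i) *\<^sub>R v' i" and w: "w i = norm (w i) *\<^sub>R w' i" for i
    by (cases "v i = 0", auto simp: v'_def sgn_div_norm) (cases "w i = 0", auto simp: w'_def sgn_div_norm)
  have "override_on w (\<lambda>i. B *v v i) J i = c i *s override_on w' (\<lambda>i. B *v v' i) J i" for i
  proof (cases "i \<in> J")
    case True
    then show ?thesis
      by (subst v) (simp add: scalar_mult_eq_scaleR c_def linear_scale)
  next
    case False
    then show ?thesis
      using w[of i] by (simp add: scalar_mult_eq_scaleR c_def)
  qed
  then have "row_det (override_on w (\<lambda>i. B *v v i) J) =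
      row_det (\<lambda>i. c i *s override_on w' (\<lambda>i. B *v v' i) J i)"
    by presburger
  also have "\<dots> = prod c UNIV * row_det (override_on w' (\<lambda>i. B *v v' i) J)"
    using det_rows_mul[of c "override_on w' (\<lambda>i. B *v v' i) J"] by (simp add: vec_lambda_eta)
  finally have eq: "row_det (override_on w (\<lambda>i. B *v v i) J) =
    prod c UNIV * row_det (override_on w' (\<lambda>i. B *v v' i) J)" .
  have "(J, v', w') \<in> unit_frames j"
    using assms by (auto simp: unit_frames_def v'_def w'_def norm_sgn)
  from vol_growth_upper[OF this, of B]
  show ?thesis
    unfolding eq abs_mult by (auto simp: c_def abs_prod intro!: mult_mono prod_nonneg)
qed

text \<open>With \<open>Z\<close> adapted to the vectors \<open>C *v v i\<close>,
  \<open>row_det_factor\<close> splits the determinant of the composite into a frame determinant of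
  \<open>C\<close> and one of \<open>B\<close> over the same index set, so both inherit the bound on
  its size.\<close>

lemma vol_growth_mult:
  fixes B C :: "real^'p^'p"
  shows "vol_growth j (B ** C) \<le> vol_growth j B * vol_growth j C"
proof (rule vol_growth_le)
  fix J v w assume *: "(J, v, w) \<in> (unit_frames j :: ('p set \<times> ('p \<Rightarrow> real^'p) \<times> _) set)"
  obtain Z :: "real^'p^'p" where Z: "orthogonal_matrix Z"
    "\<And>i m. i \<in> J \<Longrightarrow> m \<notin> J \<Longrightarrow> (C *v v i) \<bullet> Z $ m = 0"
    using adapted_orthogonal_matrix[of J "\<lambda>i. C *v v i"] by metis
  have "(J, v, ($) Z) \<in> unit_frames j" "(J, ($) Z, w) \<in> unit_frames j"
    using * orthogonal_matrix_norm_row[OF Z(1)] by (auto simp: unit_frames_def)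
  from this[THEN vol_growth_upper]
  have "\<bar>row_det (override_on (($) Z) (\<lambda>i. C *v v i) J)\<bar> \<le> vol_growth j C"
    "\<bar>row_det (override_on w (\<lambda>i. B *v (Z $ i)) J)\<bar> \<le> vol_growth j B" by auto
  moreover have "\<bar>row_det (override_on w (\<lambda>i. (B ** C) *v v i) J)\<bar> =
    \<bar>row_det (override_on (($) Z) (\<lambda>i. C *v v i) J)\<bar> * \<bar>row_det (override_on w (\<lambda>i. B *v (Z $ i)) J)\<bar>"
    using row_det_factor[of Z J "\<lambda>i. C *v v i" w B] Z by (simp add: matrix_vector_mul_assoc)
  ultimately show "\<bar>row_det (override_on w (\<lambda>i. (B ** C) *v v i) J)\<bar> \<le> vol_growth j B * vol_growth j C"
    by (simp add: mult.commute mult_mono')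
qed

text \<open>The supremum runs over an uncountable family, so measurability comes from lower
  semicontinuity: strict superlevel sets are unions of open sets.\<close>

lemma borel_measurable_vol_growth [measurable]:
  "(vol_growth j :: real^'p^'p \<Rightarrow> real) \<in> borel_measurable borel"
proof (rule borel_measurableI_greater)
  fix c :: real
  have "open {B :: real^'p^'p. c < \<bar>row_det (override_on w (\<lambda>i. B *v v i) J)\<bar>}" for J v w
  proof (rule open_Collect_less)
    have "continuous_on UNIV (\<lambda>B :: real^'p^'p. override_on w (\<lambda>i. B *v v i) J i $ k)" for i k
      by (cases "i \<in> J") (auto simp: matrix_vector_mult_def intro!: continuous_intros)
    then show "continuous_on UNIV (\<lambda>B :: real^'p^'p. \<bar>row_det (override_on w (\<lambda>i. B *v v i) J)\<bar>)"
      unfolding det_def vec_lambda_beta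
      by (intro continuous_on_rabs continuous_on_sum continuous_on_mult continuous_on_prod
          continuous_on_const)
  qed auto
  moreover have "{B :: real^'p^'p. c < vol_growth j B} =
      (\<Union>(J, v, w)\<in>unit_frames j. {B. c < \<bar>row_det (override_on w (\<lambda>i. B *v v i) J)\<bar>})"
    by (auto simp: less_vol_growth_iff)
  ultimately have "open {B :: real^'p^'p. c < vol_growth j B}"
    by (auto intro!: open_UN)
  then show "{B :: real^'p^'p \<in> space borel. c < vol_growth j B} \<in> sets borel"
    by (simp add: borel_open)
qed

section \<open>Ergodic theory\<close>

locale ergodic_system = prob_space M for M :: "'a measure" +
  fixes T :: "'a \<Rightarrow> 'a"
  assumes T_measurable [measurable]: "T \<in> measurable M M"
    and T_invariant: "distr M M T = M"
    and T_ergodic: "ergodic_map M T"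
begin

lemma funpow_measurable [measurable]: "T ^^ n \<in> measurable M M"
proof (induction n)
  case 0
  have "(\<lambda>x. x) \<in> measurable M M" by simp
  then show ?case by (simp add: id_def)
next
  case (Suc n)
  then show ?case by (auto intro: measurable_comp[OF _ T_measurable])
qed

lemma T_space: "x \<in> space M \<Longrightarrow> T x \<in> space M"
  using T_measurable by (rule measurable_space)

lemma funpow_space: "x \<in> space M \<Longrightarrow> (T ^^ n) x \<in> space M"
  using funpow_measurable by (rule measurable_space)

lemma funpow_invariant: "distr M M (T ^^ n) = M"
proof (induction n)
  case 0
  then show ?case by (simp add: id_def distr_id)
next
  case (Suc n)
  have "distr M M (T ^^ Suc n) = distr (distr M M (T ^^ n)) M T"
    by (simp add: distr_distr o_def)
  then show ?case using Suc T_invariant by (simp del: funpow.simps)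
qed

lemma AE_funpow:
  assumes "AE x in M. P x"
  shows "AE x in M. P ((T ^^ n) x)"
proof (rule AE_distrD[OF funpow_measurable])
  show "AE x in distr M M (T ^^ n). P x" using assms by (simp only: funpow_invariant)
qed

lemma integrable_T:
  fixes f :: "'a \<Rightarrow> real"
  shows "integrable M f \<Longrightarrow> integrable M (\<lambda>x. f (T x))"
  using integrable_distr[OF T_measurable, of f] by (simp add: T_invariant)

lemma integral_T:
  fixes f :: "'a \<Rightarrow> real"
  shows "integrable M f \<Longrightarrow> (\<integral>x. f (T x) \<partial>M) = (\<integral>x. f x \<partial>M)"
  using integral_distr[OF T_measurable, of f] by (simp add: T_invariant)

lemma integrable_funpow:
  fixes f :: "'a \<Rightarrow> real"
  shows "integrable M f \<Longrightarrow> integrable M (\<lambda>x. f ((T ^^ n) x))"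
  using integrable_distr[OF funpow_measurable[of n], of f] by (simp add: funpow_invariant)

lemma AE_of_invariant:
  assumes "S \<in> sets M" "T -` S \<inter> space M = S" "measure M S > 0"
  shows "AE x in M. x \<in> S"
proof -
  have "measure M S = 1" using assms T_ergodic by (auto simp: ergodic_map_def)
  then show ?thesis using assms(1) by (simp add: prob_eq_1)
qed

text \<open>The set of points that visit \<open>S\<close> need not have the strict invariance
  demanded by \<open>ergodic_map\<close>; the set of points that visit infinitely often has it. Its
  measure is at least that of \<open>S\<close>, because each \<open>Z k\<close> contains the
  preimage of \<open>S\<close> under \<open>T ^^ k\<close>.\<close>

lemma AE_visits:
  assumes S: "S \<in> sets M" "measure M S > 0"
  shows "AE x in M. \<exists>n. (T ^^ n) x \<in> S"
proof -
  define Z where "Z = (\<lambda>k. {x \<in> space M. \<exists>n\<ge>k. (T ^^ n) x \<in> S})"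
  have [measurable]: "S \<in> sets M" by fact
  have Z_sets [measurable]: "Z k \<in> sets M" for k unfolding Z_def by measurable
  have "decseq Z" by (auto simp: decseq_def Z_def intro: order_trans)
  have "measure M S \<le> measure M (Z k)" for k
  proof -
    have "measure M S = measure (distr M M (T ^^ k)) S" by (simp add: funpow_invariant)
    also have "\<dots> = measure M ((T ^^ k) -` S \<inter> space M)" by (rule measure_distr) auto
    also have "\<dots> \<le> measure M (Z k)" by (rule finite_measure_mono) (auto simp: Z_def)
    finally show ?thesis .
  qed
  moreover have "(\<lambda>k. measure M (Z k)) \<longlonglongrightarrow> measure M (\<Inter>k. Z k)"
    using \<open>decseq Z\<close> by (intro finite_Lim_measure_decseq) auto
  ultimately have "measure M S \<le> measure M (\<Inter>k. Z k)"
    by (meson LIMSEQ_le_const)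
  then have pos: "measure M (\<Inter>k. Z k) > 0" using S(2) by linarith
  have "T -` (\<Inter>k. Z k) \<inter> space M = (\<Inter>k. Z k)"
  proof -
    have "(\<forall>k. \<exists>n\<ge>k. (T ^^ n) (T x) \<in> S) \<longleftrightarrow> (\<forall>k. \<exists>n\<ge>k. (T ^^ n) x \<in> S)" for x
    proof
      assume "\<forall>k. \<exists>n\<ge>k. (T ^^ n) (T x) \<in> S"
      then show "\<forall>k. \<exists>n\<ge>k. (T ^^ n) x \<in> S"
        by (metis funpow_simps_right(2) o_apply le_SucI)
    next
      assume *: "\<forall>k. \<exists>n\<ge>k. (T ^^ n) x \<in> S"
      show "\<forall>k. \<exists>n\<ge>k. (T ^^ n) (T x) \<in> S"
      proof
        fix k
        obtain n where "n \<ge> Suc k" "(T ^^ n) x \<in> S" using * by blast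
        then show "\<exists>n\<ge>k. (T ^^ n) (T x) \<in> S"
          by (cases n) (auto simp: funpow_Suc_right simp del: funpow.simps)
      qed
    qed
    then show ?thesis using T_space by (auto simp: Z_def)
  qed
  moreover have "(\<Inter>k. Z k) \<in> sets M" by measurable
  ultimately have "AE x in M. x \<in> (\<Inter>k. Z k)" using pos by (intro AE_of_invariant)
  then show ?thesis by eventually_elim (auto simp: Z_def)
qed

section \<open>Birkhoff sums and upper ergodic bounds\<close>

definition birkhoff :: "('a \<Rightarrow> real) \<Rightarrow> nat \<Rightarrow> 'a \<Rightarrow> real" where
  "birkhoff f n x = (\<Sum>i<n. f ((T ^^ i) x))"

lemma birkhoff_0 [simp]: "birkhoff f 0 x = 0"
  by (simp add: birkhoff_def)

lemma birkhoff_Suc: "birkhoff f (Suc n) x = f x + birkhoff f n (T x)"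
  unfolding birkhoff_def
  by (subst sum.lessThan_Suc_shift) (simp add: funpow_Suc_right del: funpow.simps)

lemma birkhoff_measurable [measurable]:
  assumes [measurable]: "f \<in> borel_measurable M"
  shows "birkhoff f n \<in> borel_measurable M"
  unfolding birkhoff_def[abs_def] by measurable

text \<open>The functions \<open>h n\<close> below are the maxima of \<open>0\<close> and the first \<open>n\<close> Birkhoff sums (Garsia).\<close>

lemma maximal_ergodic:
  assumes g: "integrable M g" and pos: "AE x in M. \<exists>n. birkhoff g n x > 0"
  shows "(\<integral>x. g x \<partial>M) \<ge> 0"
proof -
  define h where "h = rec_nat (\<lambda>x. 0) (\<lambda>n u x. max 0 (g x + u (T x)))"
  have h0: "h 0 x = 0" and hS: "h (Suc n) x = max 0 (g x + h n (T x))" for n x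
    by (auto simp: h_def)
  have [measurable]: "g \<in> borel_measurable M" using g by auto
  have h_int: "integrable M (h n)" for n
  proof (induction n)
    case (Suc n)
    have "integrable M (\<lambda>x. max 0 (g x + h n (T x)))"
      by (intro integrable_max Bochner_Integration.integrable_add g integrable_T[OF Suc]) simp
    then show ?case by (simp add: hS[abs_def])
  qed (simp add: h0[abs_def])
  have [measurable]: "h n \<in> borel_measurable M" for n using h_int by auto
  have h_nonneg: "h n x \<ge> 0" for n x by (cases n) (auto simp: h0 hS)
  have h_mono: "h n x \<le> h (Suc n) x" for n x
  proof (induction n arbitrary: x)
    case (Suc n)
    have "h (Suc n) x = max 0 (g x + h n (T x))" by (rule hS)
    also have "\<dots> \<le> max 0 (g x + h (Suc n) (T x))" using Suc[of "T x"] by auto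
    also have "\<dots> = h (Suc (Suc n)) x" by (rule hS[symmetric])
    finally show ?case .
  qed (simp add: h0 h_nonneg)
  then have h_incseq: "m \<le> n \<Longrightarrow> h m x \<le> h n x" for m n x
    by (rule lift_Suc_mono_le[of "\<lambda>n. h n x"]) auto
  have bh: "birkhoff g n x \<le> h n x" for n x
  proof (induction n arbitrary: x)
    case (Suc n)
    show ?case using Suc[of "T x"] by (auto simp: birkhoff_Suc hS)
  qed (simp add: h0)
  \<comment> \<open>The restriction of \<open>g\<close> to the set where \<open>h n\<close> is
    positive; by hypothesis these sets exhaust almost all of the space.\<close>
  define F where "F = (\<lambda>n x. if h n x > 0 then g x else 0)"
  have [measurable]: "F n \<in> borel_measurable M" for n unfolding F_def by measurable
  have F_int: "integrable M (F n)" for n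
    by (rule Bochner_Integration.integrable_bound[OF g]) (auto simp: F_def)
  have F_nonneg: "(\<integral>x. F n x \<partial>M) \<ge> 0" for n
  proof (cases n)
    case 0
    then show ?thesis by (simp add: F_def h0)
  next
    case (Suc k)
    \<comment> \<open>Where \<open>h n\<close> is positive it equals \<open>g x + h k (T x)\<close>,
      and \<open>h k\<close> is at most \<open>h n\<close>; elsewhere the left side is 0. After
      integration the two copies of \<open>h n\<close> cancel by invariance.\<close>
    have "h n x \<le> F n x + h n (T x)" for x
      using h_mono[of k "T x"] h_nonneg[of n "T x"] by (auto simp: F_def Suc hS max_def split: if_splits)
    then have "(\<integral>x. h n x \<partial>M) \<le> (\<integral>x. F n x + h n (T x) \<partial>M)"
      by (intro integral_mono h_int Bochner_Integration.integrable_add F_int integrable_T)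
    also have "\<dots> = (\<integral>x. F n x \<partial>M) + (\<integral>x. h n x \<partial>M)"
      by (simp add: F_int h_int integrable_T integral_T)
    finally show ?thesis by simp
  qed
  have "(\<lambda>n. \<integral>x. F n x \<partial>M) \<longlonglongrightarrow> (\<integral>x. g x \<partial>M)"
  proof (rule integral_dominated_convergence[where w="\<lambda>x. \<bar>g x\<bar>"])
    show "AE x in M. (\<lambda>n. F n x) \<longlonglongrightarrow> g x"
      using pos
    proof (rule AE_mp, intro AE_I2 impI)
      fix x assume "\<exists>n. birkhoff g n x > 0"
      then obtain n where "h n x > 0" using bh[of _ x] by (meson less_le_trans)
      then have "F m x = g x" if "m \<ge> n" for m
        using h_incseq[OF that, of x] by (auto simp: F_def)
      then show "(\<lambda>n. F n x) \<longlonglongrightarrow> g x"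
        by (intro tendsto_eventually) (auto simp: eventually_sequentially)
    qed
  qed (use g in \<open>auto simp: F_def\<close>)
  then show ?thesis using F_nonneg by (meson LIMSEQ_le_const)
qed

text \<open>The upper half of Birkhoff's theorem. The points at which the sums of
  \<open>f - c\<close> are unbounded above form a strictly invariant set. If it had positive measure
  it would have full measure, and the maximal ergodic theorem would make the integral of
  \<open>f - c\<close> nonnegative.\<close>

lemma birkhoff_upper_bound:
  assumes f: "integrable M f" and c: "(\<integral>x. f x \<partial>M) < c"
  shows "AE x in M. \<exists>K. \<forall>n. birkhoff f n x \<le> c * real n + K"
proof -
  define g where "g = (\<lambda>x. f x - c)"
  have g: "integrable M g" using f by (simp add: g_def)
  have g_birk: "birkhoff g n x = birkhoff f n x - c * real n" for n x
    by (simp add: birkhoff_def g_def sum_subtractf)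
  have [measurable]: "g \<in> borel_measurable M" using g by auto
  define Y where "Y = {x \<in> space M. \<forall>k::nat. \<exists>n. birkhoff g n x > real k}"
  have [measurable]: "Y \<in> sets M" unfolding Y_def by measurable
  have unb: "(\<forall>k::nat. \<exists>n. birkhoff g n (T x) > real k) \<longleftrightarrow> (\<forall>k::nat. \<exists>n. birkhoff g n x > real k)" for x
  proof
    assume *: "\<forall>k::nat. \<exists>n. birkhoff g n (T x) > real k"
    show "\<forall>k::nat. \<exists>n. birkhoff g n x > real k"
    proof
      fix k :: nat
      obtain k' :: nat where "real k' \<ge> real k - g x" using real_arch_simple by blast
      moreover obtain n where "birkhoff g n (T x) > real k'" using * by blast
      ultimately have "birkhoff g (Suc n) x > real k" by (simp add: birkhoff_Suc)
      then show "\<exists>n. birkhoff g n x > real k" by blast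
    qed
  next
    assume *: "\<forall>k::nat. \<exists>n. birkhoff g n x > real k"
    show "\<forall>k::nat. \<exists>n. birkhoff g n (T x) > real k"
    proof
      fix k :: nat
      obtain k' :: nat where k': "real k' \<ge> real k + g x" using real_arch_simple by blast
      obtain n where n: "birkhoff g n x > real k'" using * by blast
      show "\<exists>n. birkhoff g n (T x) > real k"
      proof (cases n)
        case 0
        then show ?thesis using n by simp
      next
        case (Suc m)
        then have "birkhoff g m (T x) > real k" using n k' by (simp add: birkhoff_Suc)
        then show ?thesis by blast
      qed
    qed
  qed
  have "measure M Y = 0"
  proof (rule ccontr)
    assume "measure M Y \<noteq> 0"
    then have "measure M Y > 0" by (simp add: zero_less_measure_iff)
    moreover have "T -` Y \<inter> space M = Y" using unb T_space by (auto simp: Y_def)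
    ultimately have "AE x in M. x \<in> Y" by (intro AE_of_invariant) auto
    then have "AE x in M. \<exists>n. birkhoff g n x > 0"
    proof (rule AE_mp, intro AE_I2 impI)
      fix x assume "x \<in> Y"
      then have "\<exists>n. birkhoff g n x > real 0" unfolding Y_def by blast
      then show "\<exists>n. birkhoff g n x > 0" by simp
    qed
    from maximal_ergodic[OF g this] show False
      using c f by (simp add: g_def prob_space)
  qed
  then have "AE x in M. x \<notin> Y"
    by (simp add: prob_eq_0)
  then show ?thesis
  proof (rule AE_mp, intro AE_I2 impI)
    fix x assume "x \<in> space M" "x \<notin> Y"
    then obtain k :: nat where "\<And>n. birkhoff g n x \<le> real k" by (auto simp: Y_def not_less)
    then have "\<forall>n. birkhoff f n x \<le> c * real n + real k" by (simp add: g_birk algebra_simps)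
    then show "\<exists>K. \<forall>n. birkhoff f n x \<le> c * real n + K" by blast
  qed
qed

section \<open>Subadditive sequences\<close>

lemma tail_integral_small:
  assumes f: "integrable M f" and e: "e > 0"
  obtains R :: nat where "(\<integral>x. max 0 (f x - real R) \<partial>M) < e"
proof -
  have [measurable]: "f \<in> borel_measurable M" using f by auto
  have "(\<lambda>R::nat. \<integral>x. max 0 (f x - real R) \<partial>M) \<longlonglongrightarrow> (\<integral>x. 0 \<partial>M)"
  proof (rule integral_dominated_convergence[where w="\<lambda>x. \<bar>f x\<bar>"])
    show "AE x in M. (\<lambda>R. max 0 (f x - real R)) \<longlonglongrightarrow> 0"
    proof (intro AE_I2 tendsto_eventually)
      fix x
      obtain k :: nat where "f x \<le> real k" using real_arch_simple by blast
      then show "\<forall>\<^sub>F R in sequentially. max 0 (f x - real R) = 0"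
        unfolding eventually_sequentially by (intro exI[of _ k]) auto
    qed
  qed (use f in auto)
  then have "\<forall>\<^sub>F R::nat in sequentially. (\<integral>x. max 0 (f x - real R) \<partial>M) < e"
    using e by (auto dest: order_tendstoD)
  then show ?thesis using that by (auto simp: eventually_sequentially)
qed

text \<open>The upper half of Kingman's theorem, derived from one good \<open>m\<close>. Sampling at
  multiples of \<open>m\<close> would call for ergodicity of \<open>T ^^ m\<close>, which may fail;
  windows of \<open>m\<close> consecutive values lead to a Birkhoff sum of \<open>a m\<close> along
  \<open>T\<close> itself.\<close>

lemma subadditive_upper_bound:
  assumes a: "\<And>n. integrable M (a n)" and nonneg: "\<And>n x. a n x \<ge> 0"
    and sub: "\<And>n m x. x \<in> space M \<Longrightarrow> a (n + m) x \<le> a n ((T ^^ m) x) + a m x"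
    and m: "m \<ge> 1" and c: "(\<integral>x. a m x \<partial>M) < c * real m"
  shows "AE x in M. \<exists>K. \<forall>n. a n x \<le> c * real n + K"
proof -
  \<comment> \<open>The rate \<open>c'\<close> is spent on the sums of \<open>a m\<close>. The
    remaining slack \<open>c - c'\<close> pays for the last few steps, where single values of
    \<open>a 1\<close> are unbounded.\<close>
  define c' where "c' = ((\<integral>x. a m x \<partial>M) / real m + c) / 2"
  have c': "(\<integral>x. a m x \<partial>M) < c' * real m" "c' < c"
    using m c by (auto simp: c'_def field_simps)
  have "c' \<ge> 0"
  proof -
    have "(\<integral>x. a m x \<partial>M) \<ge> 0" using nonneg by simp
    then show ?thesis using c' m by (smt (verit) mult_neg_pos of_nat_0_less_iff less_le_trans zero_less_one)
  qed
  obtain R :: nat where R: "(\<integral>x. max 0 (a 1 x - real R) \<partial>M) < c - c'"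
    using tail_integral_small[OF a[of 1], of "c - c'"] c' by auto
  have 1: "AE x in M. \<exists>K. \<forall>n. birkhoff (a m) n x \<le> (c' * real m) * real n + K"
    by (rule birkhoff_upper_bound[OF a c'(1)])
  have 2: "AE x in M. \<exists>K. \<forall>n. birkhoff (\<lambda>x. max 0 (a 1 x - real R)) n x \<le> (c - c') * real n + K"
    by (rule birkhoff_upper_bound[OF _ R]) (use a in auto)
  from 1 2 AE_space show ?thesis
  proof eventually_elim
    case (elim x)
    then obtain K1 K2 where K1: "\<And>n. birkhoff (a m) n x \<le> (c' * real m) * real n + K1"
      and K2: "\<And>n. birkhoff (\<lambda>x. max 0 (a 1 x - real R)) n x \<le> (c - c') * real n + K2" by blast
    have x: "x \<in> space M" by fact
    text \<open>Telescoping: moving a window of \<open>m\<close> consecutive values of \<open>a\<close> one step forward adds at most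
      one value of \<open>a m\<close>, so that the value of some \<open>a (n + i)\<close> with \<open>i < m\<close> is controlled.\<close>
    have window: "(\<Sum>i<m. a (n + i) x) \<le> (\<Sum>i<m. a i x) + birkhoff (a m) n x" for n
    proof (induction n)
      case (Suc n)
      have "(\<Sum>i<m. a (Suc n + i) x) + a n x = (\<Sum>i<Suc m. a (n + i) x)"
        by (subst sum.lessThan_Suc_shift) simp
      also have "\<dots> = (\<Sum>i<m. a (n + i) x) + a (m + n) x" by (simp add: add.commute)
      also have "\<dots> \<le> (\<Sum>i<m. a (n + i) x) + a m ((T ^^ n) x) + a n x"
        using sub[OF x, of m n] by simp
      finally have "(\<Sum>i<m. a (Suc n + i) x) \<le> (\<Sum>i<m. a (n + i) x) + a m ((T ^^ n) x)" by simp
      then show ?case using Suc by (simp add: birkhoff_def)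
    qed simp
    \<comment> \<open>At most \<open>m\<close> steps lead from a controlled index to
      \<open>n\<close>. The part of \<open>a 1\<close> below \<open>R\<close> costs a bounded
      amount; the excess over \<open>R\<close> is estimated by its whole Birkhoff sum, whose mean
      was made smaller than \<open>c - c'\<close>.\<close>
    have steps: "a (n + l) x \<le> a n x + real l * real R + birkhoff (\<lambda>x. max 0 (a 1 x - real R)) (n + l) x" for n l
    proof -
      have "a (n + l) x \<le> a n x + (\<Sum>i\<in>{n..<n+l}. a 1 ((T ^^ i) x))"
      proof (induction l)
        case (Suc l)
        have "a (n + Suc l) x \<le> a 1 ((T ^^ (n + l)) x) + a (n + l) x"
          using sub[OF x, of 1 "n + l"] by simp
        then show ?case using Suc by simp
      qed simp
      also have "(\<Sum>i\<in>{n..<n+l}. a 1 ((T ^^ i) x)) \<le> (\<Sum>i\<in>{n..<n+l}. real R + max 0 (a 1 ((T ^^ i) x) - real R))"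
        by (intro sum_mono) auto
      also have "\<dots> = real l * real R + (\<Sum>i\<in>{n..<n+l}. max 0 (a 1 ((T ^^ i) x) - real R))"
        by (simp add: sum.distrib)
      also have "\<dots> \<le> real l * real R + birkhoff (\<lambda>x. max 0 (a 1 x - real R)) (n + l) x"
        unfolding birkhoff_def by (intro add_left_mono sum_mono2) auto
      finally show ?thesis by simp
    qed
    define K where "K = (\<Sum>i<m. a i x) / real m + \<bar>K1\<bar> / real m + real m * real R + \<bar>K2\<bar>"
    have bound: "a n x \<le> c * real n + K" if "n \<ge> m" for n
    proof -
      obtain i where i: "i < m" "real m * a (n - m + i) x \<le> (\<Sum>i<m. a (n - m + i) x)"
      proof (rule ccontr)
        assume "\<not> thesis"
        then have "\<And>i. i < m \<Longrightarrow> (\<Sum>i<m. a (n - m + i) x) < real m * a (n - m + i) x"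
          using that by (meson not_le)
        then have "(\<Sum>j<m. (\<Sum>i<m. a (n - m + i) x)) < (\<Sum>j<m. real m * a (n - m + j) x)"
          using m by (intro sum_strict_mono) (auto simp: lessThan_empty_iff)
        then show False by (simp add: sum_distrib_left[symmetric])
      qed
      have "real m * a (n - m + i) x \<le> (\<Sum>i<m. a i x) + (c' * real m) * real (n - m) + K1"
        using i(2) window[of "n - m"] K1[of "n - m"] by simp
      then have "a (n - m + i) x \<le> ((\<Sum>i<m. a i x) + (c' * real m) * real (n - m) + K1) / real m"
        using m by (simp add: field_simps)
      also have "\<dots> = (\<Sum>i<m. a i x) / real m + c' * real (n - m) + K1 / real m"
        using m by (simp add: add_divide_distrib)
      finally have 1: "a (n - m + i) x \<le> (\<Sum>i<m. a i x) / real m + c' * real (n - m) + K1 / real m" .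
      have "a (n - m + i + (m - i)) x \<le> a (n - m + i) x + real (m - i) * real R +
          birkhoff (\<lambda>x. max 0 (a 1 x - real R)) (n - m + i + (m - i)) x"
        by (rule steps)
      moreover have "n - m + i + (m - i) = n" using i(1) that by simp
      ultimately have "a n x \<le> a (n - m + i) x + real (m - i) * real R + (c - c') * real n + K2"
        using K2[of n] by simp
      moreover have "real (m - i) * real R \<le> real m * real R" by (intro mult_right_mono) auto
      moreover have "c' * real (n - m) \<le> c' * real n" using \<open>c' \<ge> 0\<close> by (intro mult_left_mono) auto
      moreover have "K1 / real m \<le> \<bar>K1\<bar> / real m" by (intro divide_right_mono) auto
      ultimately show ?thesis using 1 by (simp add: K_def algebra_simps)
    qed
    define K' where "K' = K + (\<Sum>n<m. a n x)"
    have "K \<ge> 0" using nonneg by (auto simp: K_def intro!: add_nonneg_nonneg divide_nonneg_nonneg sum_nonneg)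
    have "a n x \<le> c * real n + K'" for n
    proof (cases "n < m")
      case True
      then have "a n x \<le> (\<Sum>n<m. a n x)" using nonneg by (intro member_le_sum) auto
      moreover have "c * real n \<ge> 0" using \<open>c' \<ge> 0\<close> c' by simp
      ultimately show ?thesis using \<open>K \<ge> 0\<close> unfolding K'_def by linarith
    next
      case False
      moreover have "(\<Sum>n<m. a n x) \<ge> 0" using nonneg by (simp add: sum_nonneg)
      ultimately show ?thesis using bound[of n] unfolding K'_def by auto
    qed
    then show ?case by blast
  qed
qed

text \<open>A form of the Karlsson--Margulis lemma: if \<open>h n x\<close> is the maximum of \<open>a (n - k) (T^k x)\<close> over \<open>k \<le> n\<close>,
  then \<open>h (n + 1) - h n \<circ> T\<close> is supported on the set of \<open>x\<close> for which \<open>n + 1\<close> is a good time, and there it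
  is at most \<open>b\<close>.\<close>

lemma karlsson_margulis:
  assumes a: "\<And>n. integrable M (a n)" and b: "integrable M b" "\<And>x. b x \<ge> 0"
    and sub: "\<And>n x. x \<in> space M \<Longrightarrow> a (Suc n) x \<le> a n (T x) + b x"
    and e: "e > 0" and growth: "\<And>n. n \<ge> 1 \<Longrightarrow> (\<integral>x. a n x \<partial>M) \<ge> e * real n"
  defines "S \<equiv> {x \<in> space M. \<forall>m. \<exists>n\<ge>m. \<forall>k\<in>{1..n}. a (n - k) ((T ^^ k) x) < a n x}"
  shows "S \<in> sets M" "measure M S > 0"
proof -
  have [measurable]: "a n \<in> borel_measurable M" "b \<in> borel_measurable M" for n using a b by auto
  show S_sets [measurable]: "S \<in> sets M"
    unfolding S_def by measurable
  define h where "h = rec_nat (a 0) (\<lambda>n u x. max (a (Suc n) x) (u (T x)))"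
  have h0: "h 0 x = a 0 x" and hS: "h (Suc n) x = max (a (Suc n) x) (h n (T x))" for n x
    by (auto simp: h_def)
  have h_int: "integrable M (h n)" for n
  proof (induction n)
    case (Suc n)
    have "integrable M (\<lambda>x. max (a (Suc n) x) (h n (T x)))"
      by (intro integrable_max a integrable_T[OF Suc])
    then show ?case by (simp add: hS[abs_def])
  qed (use a h0 in \<open>simp add: h0[abs_def]\<close>)
  have h_ge: "k \<le> n \<Longrightarrow> a (n - k) ((T ^^ k) x) \<le> h n x" for n k x
  proof (induction n arbitrary: k x)
    case (Suc n)
    show ?case
    proof (cases k)
      case 0
      then show ?thesis by (simp add: hS)
    next
      case (Suc l)
      then have "a (n - l) ((T ^^ l) (T x)) \<le> h n (T x)" using Suc.IH[of l "T x"] Suc.prems by simp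
      then show ?thesis using Suc by (simp add: hS funpow_Suc_right del: funpow.simps)
    qed
  qed (simp add: h0)
  have [measurable]: "h n \<in> borel_measurable M" for n using h_int by auto
  define G where "G = (\<lambda>n x. if a (Suc n) x > h n (T x) then b x else 0)"
  have G_int: "integrable M (G n)" for n
    unfolding G_def by (rule Bochner_Integration.integrable_bound[OF b(1)]) auto
  have h_step: "h (Suc n) x \<le> h n (T x) + G n x" if "x \<in> space M" for n x
    using sub[OF that, of n] h_ge[of 0 n "T x"] b(2)[of x] by (auto simp: hS G_def)
  have h_bound: "(\<integral>x. h n x \<partial>M) \<le> (\<integral>x. a 0 x \<partial>M) + (\<Sum>i<n. \<integral>x. G i x \<partial>M)" for n
  proof (induction n)
    case (Suc n)
    have "(\<integral>x. h (Suc n) x \<partial>M) \<le> (\<integral>x. h n (T x) + G n x \<partial>M)"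
      by (intro integral_mono h_int Bochner_Integration.integrable_add integrable_T G_int h_step)
    also have "\<dots> = (\<integral>x. h n x \<partial>M) + (\<integral>x. G n x \<partial>M)"
      by (simp add: h_int G_int integrable_T integral_T)
    finally show ?case using Suc by simp
  qed (simp add: h0)
  show "measure M S > 0"
  proof (rule ccontr)
    assume "\<not> measure M S > 0"
    then have "measure M S = 0" by (simp add: zero_less_measure_iff)
    then have notS: "AE x in M. x \<notin> S" by (simp add: prob_eq_0)
    \<comment> \<open>If \<open>S\<close> were null, almost every point would have only finitely
      many good times, and \<open>G n\<close> would tend to 0 under the bound \<open>b\<close>. The
      integral of \<open>h n\<close> would then eventually grow at a rate of at most
      \<open>e / 2\<close>, although \<open>h n\<close> dominates \<open>a n\<close>, whose integral
      is at least \<open>e * real n\<close>.\<close>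
    have "(\<lambda>n. \<integral>x. G n x \<partial>M) \<longlonglongrightarrow> (\<integral>x. 0 \<partial>M)"
    proof (rule integral_dominated_convergence[where w=b])
      show "AE x in M. (\<lambda>n. G n x) \<longlonglongrightarrow> 0"
        using notS
      proof (rule AE_mp, intro AE_I2 impI)
        fix x assume x: "x \<in> space M" "x \<notin> S"
        then obtain m where m: "\<And>n. n \<ge> m \<Longrightarrow> \<exists>k\<in>{1..n}. a n x \<le> a (n - k) ((T ^^ k) x)"
          by (auto simp: S_def not_less)
        have "G n x = 0" if "n \<ge> m" for n
        proof -
          \<comment> \<open>The orbit point with index \<open>k = Suc l\<close> over
            \<open>x\<close> has index \<open>l\<close> over \<open>T x\<close>, so the failure of
            \<open>Suc n\<close> to be a good time is a comparison already contained in
            \<open>h n (T x)\<close>.\<close>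
          obtain k where k: "k \<in> {1..Suc n}" "a (Suc n) x \<le> a (Suc n - k) ((T ^^ k) x)"
            using m[OF le_SucI[OF \<open>n \<ge> m\<close>]] by blast
          then obtain l where l: "k = Suc l" by (cases k) auto
          have "a (Suc n) x \<le> h n (T x)"
            using k h_ge[of l n "T x"] by (simp add: l funpow_Suc_right del: funpow.simps)
          then show ?thesis by (simp add: G_def)
        qed
        then show "(\<lambda>n. G n x) \<longlonglongrightarrow> 0"
          by (intro tendsto_eventually) (auto simp: eventually_sequentially)
      qed
    qed (use b in \<open>auto simp: G_def\<close>)
    then have "(\<lambda>n. \<integral>x. G n x \<partial>M) \<longlonglongrightarrow> 0" by simp
    then have "\<forall>\<^sub>F n in sequentially. (\<integral>x. G n x \<partial>M) < e / 2"
      by (rule order_tendstoD(2)) (use e in simp)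
    then obtain n0 where n0: "\<And>n. n \<ge> n0 \<Longrightarrow> (\<integral>x. G n x \<partial>M) < e / 2"
      by (auto simp: eventually_sequentially)
    define C where "C = (\<integral>x. a 0 x \<partial>M) + (\<Sum>i<n0. \<integral>x. G i x \<partial>M)"
    have up: "(\<integral>x. a 0 x \<partial>M) + (\<Sum>i<n0 + l. \<integral>x. G i x \<partial>M) \<le> C + real l * (e / 2)" for l
    proof (induction l)
      case (Suc l)
      then show ?case using n0[of "n0 + l"] by (simp add: field_simps)
    qed (simp add: C_def)
    have "e * real (n0 + l) \<le> C + real l * (e / 2)" if "l \<ge> 1" for l
    proof -
      have "e * real (n0 + l) \<le> (\<integral>x. a (n0 + l) x \<partial>M)" using growth[of "n0 + l"] that by simp
      also have "\<dots> \<le> (\<integral>x. h (n0 + l) x \<partial>M)"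
        using h_ge[of 0 "n0 + l"] by (intro integral_mono a h_int) simp
      finally show ?thesis using h_bound[of "n0 + l"] up[of l] by linarith
    qed
    then have le: "real l * (e / 2) \<le> C" if "l \<ge> 1" for l
      using that e by (smt (verit) of_nat_add distrib_left mult.commute field_sum_of_halves mult_nonneg_nonneg of_nat_0_le_iff)
    obtain l :: nat where "real l > C / (e / 2)" using reals_Archimedean2 by blast
    then have "real (Suc l) * (e / 2) > C" using e by (simp add: field_simps)
    then show False using le[of "Suc l"] by simp
  qed
qed

end

section \<open>Slow vectors and uniform expansion\<close>

lemma row_det_nonzero_notin_span:
  fixes r :: "'p::finite \<Rightarrow> real^'p"
  assumes "row_det r \<noteq> 0"
  shows "r i \<notin> span (r ` (UNIV - {i}))"
  using row_det_span[of "r i" r i] assms by auto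

lemma row_det_nonzero_inj:
  fixes r :: "'p::finite \<Rightarrow> real^'p"
  assumes "row_det r \<noteq> 0"
  shows "inj r"
proof (rule injI, rule ccontr)
  fix i j assume "r i = r j" "i \<noteq> j"
  then have "r i \<in> r ` (UNIV - {i})" by auto
  from span_base[OF this] show False using row_det_nonzero_notin_span[OF assms, of i] by simp
qed

lemma row_det_nonzero_independent:
  fixes r :: "'p::finite \<Rightarrow> real^'p"
  assumes "row_det r \<noteq> 0"
  shows "independent (range r)"
proof
  assume "dependent (range r)"
  then obtain i where "r i \<in> span (range r - {r i})" by (auto simp: dependent_def)
  moreover have "range r - {r i} \<subseteq> r ` (UNIV - {i})" by auto
  ultimately have "r i \<in> span (r ` (UNIV - {i}))" using span_mono by blast
  then show False using row_det_nonzero_notin_span[OF assms] by blast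
qed

lemma row_det_nonzero_dim:
  fixes r :: "'p::finite \<Rightarrow> real^'p"
  assumes "row_det r \<noteq> 0"
  shows "dim (r ` I) = card I"
proof -
  have "independent (r ` I)"
    using row_det_nonzero_independent[OF assms] by (rule independent_mono) auto
  moreover have "inj_on r I" using row_det_nonzero_inj[OF assms] by (rule inj_on_subset) auto
  ultimately show ?thesis by (simp add: dim_eq_card_independent card_image)
qed

lemma invertible_inj: "invertible (B :: real^'p^'p) \<Longrightarrow> inj ((*v) B)"
  using invertible_left_inverse[of B] matrix_left_invertible_injective[of B] by simp

lemma dim_preimage_invertible:
  fixes B :: "real^'p^'p"
  assumes "invertible B"
  shows "dim {u. B *v u \<in> W} = dim W"
proof -
  obtain B' where B': "B ** B' = mat 1" "B' ** B = mat 1"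
    using assms by (auto simp: invertible_def)
  have "(*v) B ` {u. B *v u \<in> W} = W"
  proof
    show "W \<subseteq> (*v) B ` {u. B *v u \<in> W}"
    proof
      fix v assume "v \<in> W"
      moreover have "B *v (B' *v v) = v" using B' by (simp add: matrix_vector_mul_assoc)
      ultimately show "v \<in> (*v) B ` {u. B *v u \<in> W}" by (intro image_eqI[where x="B' *v v"]) auto
    qed
  qed auto
  moreover have "dim ((*v) B ` {u. B *v u \<in> W}) = dim {u. B *v u \<in> W}"
    by (rule dim_image_eq[OF matrix_vector_mul_linear])
      (rule inj_on_subset[OF invertible_inj[OF assms]], simp)
  ultimately show ?thesis by simp
qed

lemma cocycle_iter_add:
  "cocycle_iter T A (n + k) x = cocycle_iter T A n ((T ^^ k) x) ** cocycle_iter T A k x"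
proof (induction n)
  case (Suc n)
  have "cocycle_iter T A (Suc n + k) x = A ((T ^^ (n + k)) x) ** cocycle_iter T A (n + k) x" by simp
  also have "\<dots> = A ((T ^^ n) ((T ^^ k) x)) ** (cocycle_iter T A n ((T ^^ k) x) ** cocycle_iter T A k x)"
    by (simp only: Suc funpow_add o_apply)
  also have "\<dots> = cocycle_iter T A (Suc n) ((T ^^ k) x) ** cocycle_iter T A k x"
    by (simp only: cocycle_iter.simps matrix_mul_assoc)
  finally show ?case .
qed simp

lemma invertible_cocycle_iter:
  fixes A :: "'a \<Rightarrow> real^'p^'p"
  assumes "\<And>n. invertible (A ((T ^^ n) x))"
  shows "invertible (cocycle_iter T A n x)"
proof (induction n)
  case 0
  show ?case by (auto simp: invertible_def intro!: exI[of _ "mat 1"])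
next
  case (Suc n)
  then show ?case using assms by (simp add: invertible_mult)
qed

text \<open>Here \<open>w\<close> spans, up to a bounded factor, the directions of the image complementary to the \<open>q\<close> most
  expanded ones. The coordinates of \<open>C *v u\<close> outside \<open>J\<close> are ratios of a \<open>(q + 1)\<close>-volume and a
  \<open>q\<close>-volume; the coordinates in \<open>J\<close> are bounded by Cramer's rule.\<close>

lemma slow_vector_bound:
  fixes B C :: "real^'p^'p"
  assumes frame: "(J, f, w) \<in> unit_frames q" and card: "card J = q"
    and near: "vol_growth q (B ** C) < 2 * \<bar>row_det (override_on w (\<lambda>i. (B ** C) *v f i) J)\<bar>"
    and u: "(B ** C) *v u \<in> span (w ` (- J))" "norm u \<le> 1"
    and s: "s > 0" "s * vol_growth q B \<le> vol_growth q (B ** C)"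
    and t: "vol_growth (Suc q) C \<le> t"
  defines "\<kappa> \<equiv> 2 * t / s"
  shows "norm (C *v u) \<le> real CARD('p) * (\<kappa> + real CARD('p) * \<kappa>\<^sup>2)"
proof -
  let ?p = "real CARD('p)"
  obtain Z :: "real^'p^'p" where Z: "orthogonal_matrix Z"
    "\<And>i m. i \<in> J \<Longrightarrow> m \<notin> J \<Longrightarrow> (C *v f i) \<bullet> Z $ m = 0"
    using adapted_orthogonal_matrix[of J "\<lambda>i. C *v f i"] by metis
  have normZ: "norm (Z $ i) = 1" for i by (rule orthogonal_matrix_norm_row[OF Z(1)])
  have Zorth: "Z $ i \<bullet> Z $ j = 0" if "i \<noteq> j" for i j
    using Z(1) that unfolding orthogonal_matrix_orthonormal_rows
    by (simp add: row_def vec_lambda_eta orthogonal_def)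
  define l where "l = row_det (override_on (($) Z) (\<lambda>i. C *v f i) J)"
  define \<rho> where "\<rho> = override_on w (\<lambda>i. B *v (Z $ i)) J"
  define E where "E = row_det \<rho>"
  have frames: "(J, f, ($) Z) \<in> unit_frames q" "(J, ($) Z, w) \<in> unit_frames q"
    using frame normZ by (auto simp: unit_frames_def)
  have fac: "\<bar>row_det (override_on w (\<lambda>i. (B ** C) *v f i) J)\<bar> = \<bar>l\<bar> * \<bar>E\<bar>"
    using row_det_factor[of Z J "\<lambda>i. C *v f i" w B] Z by (simp add: matrix_vector_mul_assoc l_def E_def \<rho>_def)
  have vB: "vol_growth q B \<ge> 1" by (rule vol_growth_ge_1)
  have EB: "\<bar>E\<bar> \<le> vol_growth q B" using vol_growth_upper[OF frames(2)] by (simp add: E_def \<rho>_def)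
  have t1: "vol_growth q C \<le> t" using vol_growth_mono[of q "Suc q" C] t by simp
  have lC: "\<bar>l\<bar> \<le> t" using vol_growth_upper[OF frames(1), of C] t1 by (simp add: l_def)
  have t_pos: "t \<ge> 1" using t1 vol_growth_ge_1[of q C] by linarith
  have \<kappa>_pos: "\<kappa> \<ge> 0" using t_pos s by (simp add: \<kappa>_def)
  \<comment> \<open>The product of \<open>l\<close> and \<open>E\<close> is nearly maximal while
    each factor is bounded by its own maximal volume, so neither can be small: both
    \<open>t / \<bar>l\<bar>\<close> and \<open>vol_growth q B / \<bar>E\<bar>\<close> are at most
    \<open>\<kappa>\<close>.\<close>
  have "s * vol_growth q B < 2 * (\<bar>l\<bar> * \<bar>E\<bar>)" using near fac s by linarith
  also have "\<dots> \<le> 2 * (\<bar>l\<bar> * vol_growth q B)" using EB by (intro mult_left_mono) auto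
  finally have l_low: "s < 2 * \<bar>l\<bar>" using vB by simp
  have "s * vol_growth q B < 2 * (\<bar>l\<bar> * \<bar>E\<bar>)" using near fac s by linarith
  also have "\<dots> \<le> 2 * (t * \<bar>E\<bar>)" using lC by (intro mult_left_mono mult_right_mono) auto
  finally have E_low: "s * vol_growth q B < 2 * t * \<bar>E\<bar>" by simp
  define c where "c = (\<lambda>i. (C *v u) \<bullet> Z $ i)"
  have Cu: "C *v u = (\<Sum>i\<in>UNIV. c i *\<^sub>R Z $ i)"
    unfolding c_def by (rule orthogonal_matrix_expansion[OF Z(1)])
  have out: "\<bar>c m\<bar> \<le> \<kappa>" if m: "m \<notin> J" for m
  proof -
    define r where "r = override_on (($) Z) (\<lambda>i. C *v f i) J"
    \<comment> \<open>All rows of this matrix are orthogonal to \<open>Z $ m\<close>. Hence only the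
      component of \<open>C *v u\<close> along \<open>Z $ m\<close> counts when it replaces row
      \<open>m\<close>, and the new determinant belongs to a frame of \<open>Suc q\<close>
      vectors.\<close>
    have "row_det (r(m := C *v u - c m *\<^sub>R Z $ m)) = 0"
    proof (rule det_eq_0_of_orthogonal_rows)
      show "vec_lambda (r(m := C *v u - c m *\<^sub>R Z $ m)) $ i \<bullet> Z $ m = 0" for i
      proof (cases "i = m")
        case True
        have "Z $ m \<bullet> Z $ m = 1" using normZ[of m] by (simp add: norm_eq_1)
        then show ?thesis using True by (simp add: c_def inner_diff_left)
      next
        case False
        then show ?thesis using Z(2) Zorth m by (simp add: r_def override_on_def)
      qed
      show "Z $ m \<noteq> 0" using normZ[of m] by auto
    qed
    moreover have "r(m := Z $ m) = r" using m by (auto simp: r_def override_on_def)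
    ultimately have "row_det (r(m := C *v u)) = c m * l"
      using row_det_add[of r m "c m *\<^sub>R Z $ m" "C *v u - c m *\<^sub>R Z $ m"] row_det_scaleR[of r m "c m" "Z $ m"]
      by (simp add: l_def r_def)
    moreover have "r(m := C *v u) = override_on (($) Z) (\<lambda>i. C *v (f(m := u)) i) (insert m J)"
      by (auto simp: r_def override_on_def)
    moreover have "(insert m J, f(m := u), ($) Z) \<in> unit_frames (Suc q)"
      using frame normZ u(2) card by (auto simp: unit_frames_def card_insert_if)
    ultimately have "\<bar>c m * l\<bar> \<le> t" using vol_growth_upper[of "insert m J" "f(m := u)" "($) Z" "Suc q" C] t
      by simp
    then have "\<bar>c m\<bar> * \<bar>l\<bar> \<le> t" by (simp add: abs_mult)
    moreover have "\<bar>c m\<bar> * (s / 2) \<le> \<bar>c m\<bar> * \<bar>l\<bar>" using l_low by (intro mult_left_mono) auto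
    ultimately have "\<bar>c m\<bar> * (s / 2) \<le> t" by linarith
    then show ?thesis using s by (simp add: \<kappa>_def field_simps)
  qed
  define sv where "sv = (\<Sum>i\<in>- J. c i *\<^sub>R Z $ i)"
  have "norm sv \<le> (\<Sum>i\<in>- J. \<bar>c i\<bar>)"
    unfolding sv_def by (rule order_trans[OF norm_sum]) (simp add: normZ)
  also have "\<dots> \<le> (\<Sum>i\<in>- J. \<kappa>)" using out by (intro sum_mono) auto
  also have "\<dots> \<le> ?p * \<kappa>" using \<kappa>_pos by (simp add: card_mono mult_right_mono)
  finally have sv: "norm sv \<le> ?p * \<kappa>" .
  have inn: "\<bar>c i\<bar> \<le> ?p * \<kappa>\<^sup>2" if i: "i \<in> J" for i
  proof -
    have w_sub: "w ` (- J) \<subseteq> \<rho> ` (UNIV - {i})"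
    proof
      fix y assume "y \<in> w ` (- J)"
      then obtain j where j: "j \<notin> J" "y = w j" by auto
      then have "y = \<rho> j" "j \<noteq> i" using i by (auto simp: \<rho>_def override_on_def)
      then show "y \<in> \<rho> ` (UNIV - {i})" by blast
    qed
    \<comment> \<open>Cramer's rule: the image of \<open>u\<close> lies in the span of the test
      rows, so putting it into row \<open>i\<close> gives determinant 0. Expanding that row
      expresses \<open>c i * E\<close> through the part \<open>sv\<close> outside \<open>J\<close>,
      which is already bounded.\<close>
    have "B *v (C *v u) \<in> span (\<rho> ` (UNIV - {i}))"
      using u(1) span_mono[OF w_sub] by (auto simp: matrix_vector_mul_assoc)
    then have 0: "row_det (\<rho>(i := B *v (C *v u))) = 0" by (rule row_det_span)
    have split: "C *v u = c i *\<^sub>R Z $ i + sv + (\<Sum>j\<in>J - {i}. c j *\<^sub>R Z $ j)"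
    proof -
      have "C *v u = (\<Sum>i\<in>J. c i *\<^sub>R Z $ i) + sv"
        unfolding Cu sv_def by (subst sum.union_disjoint[symmetric]) (auto intro!: sum.cong)
      then show ?thesis using i by (simp add: sum.remove)
    qed
    have "B *v (C *v u) = (c i *\<^sub>R (B *v (Z $ i)) + B *v sv) + (\<Sum>j\<in>J - {i}. c j *\<^sub>R (B *v (Z $ j)))"
      unfolding split by (simp add: linear_add linear_scale linear_sum o_def)
    moreover have in_span: "(\<Sum>j\<in>J - {i}. c j *\<^sub>R (B *v (Z $ j))) \<in> span (\<rho> ` (UNIV - {i}))"
    proof (intro span_sum span_scale span_base)
      fix j assume "j \<in> J - {i}"
      then have "B *v (Z $ j) = \<rho> j" "j \<noteq> i" by (auto simp: \<rho>_def override_on_def)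
      then show "B *v (Z $ j) \<in> \<rho> ` (UNIV - {i})" by blast
    qed
    ultimately have "row_det (\<rho>(i := c i *\<^sub>R (B *v (Z $ i)) + B *v sv)) = 0"
      using 0 row_det_add_span[OF in_span] by simp
    moreover have "\<rho>(i := B *v (Z $ i)) = \<rho>" using i by (auto simp: \<rho>_def override_on_def)
    ultimately have eq: "c i * E = - row_det (\<rho>(i := B *v sv))"
      using row_det_add[of \<rho> i "c i *\<^sub>R (B *v (Z $ i))" "B *v sv"] row_det_scaleR[of \<rho> i "c i" "B *v (Z $ i)"]
      by (simp add: E_def)
    have "\<rho>(i := B *v sv) = override_on w (\<lambda>j. B *v ((($) Z)(i := sv)) j) J"
      using i by (auto simp: \<rho>_def override_on_def)
    then have "\<bar>c i * E\<bar> \<le> (\<Prod>j\<in>UNIV. if j \<in> J then norm (((($) Z)(i := sv)) j) else norm (w j)) * vol_growth q B"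
      using vol_growth_upper_norms[of J q w B "(($) Z)(i := sv)"] card eq by simp
    also have "(\<Prod>j\<in>UNIV. if j \<in> J then norm (((($) Z)(i := sv)) j) else norm (w j)) \<le>
        (\<Prod>j\<in>UNIV. if j = i then norm sv else 1)"
      using frame i by (intro prod_mono) (auto simp: normZ unit_frames_def)
    also have "\<dots> = norm sv" by simp
    finally have "\<bar>c i\<bar> * \<bar>E\<bar> \<le> norm sv * vol_growth q B" using vB by (simp add: abs_mult)
    moreover have "\<bar>c i\<bar> * (s * vol_growth q B) \<le> \<bar>c i\<bar> * (2 * t * \<bar>E\<bar>)"
      using E_low by (intro mult_left_mono) auto
    moreover have "2 * t * (\<bar>c i\<bar> * \<bar>E\<bar>) \<le> 2 * t * (norm sv * vol_growth q B)"
      using calculation(1) t_pos by (intro mult_left_mono) auto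
    ultimately have "(\<bar>c i\<bar> * s) * vol_growth q B \<le> (2 * t * norm sv) * vol_growth q B"
      by (simp add: algebra_simps)
    then have "\<bar>c i\<bar> * s \<le> 2 * t * norm sv" using vB by simp
    then have "\<bar>c i\<bar> \<le> \<kappa> * norm sv" using s by (simp add: \<kappa>_def field_simps)
    also have "\<dots> \<le> \<kappa> * (?p * \<kappa>)" using sv \<kappa>_pos by (intro mult_left_mono)
    finally show ?thesis by (simp add: power2_eq_square algebra_simps)
  qed
  have "norm (C *v u) \<le> (\<Sum>i\<in>UNIV. \<bar>c i\<bar>)"
    unfolding Cu by (rule order_trans[OF norm_sum]) (simp add: normZ)
  also have "\<dots> \<le> (\<Sum>i\<in>(UNIV::'p set). \<kappa> + ?p * \<kappa>\<^sup>2)"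
  proof (rule sum_mono)
    fix i
    show "\<bar>c i\<bar> \<le> \<kappa> + ?p * \<kappa>\<^sup>2"
    proof (cases "i \<in> J")
      case True
      then show ?thesis using inn[of i] \<kappa>_pos by linarith
    next
      case False
      moreover have "0 \<le> ?p * \<kappa>\<^sup>2" by simp
      ultimately show ?thesis using out[of i] by linarith
    qed
  qed
  also have "\<dots> = ?p * (\<kappa> + ?p * \<kappa>\<^sup>2)" by simp
  finally show ?thesis .
qed

text \<open>A frame with fewer than \<open>q\<close> vectors reaches at most
  \<open>vol_growth (q - 1) B\<close>, half of the supremum or less; so a frame that beats one half
  has exactly \<open>q\<close> vectors.\<close>

lemma near_maximal_frame:
  fixes B :: "real^'p^'p"
  assumes "q = 0 \<or> 2 * vol_growth (q - 1) B \<le> vol_growth q B"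
  obtains J f w where "(J, f, w) \<in> unit_frames q" "card J = q"
    "vol_growth q B < 2 * \<bar>row_det (override_on w (\<lambda>i. B *v f i) J)\<bar>"
proof -
  have "vol_growth q B / 2 < vol_growth q B" using vol_growth_ge_1[of q B] by linarith
  then obtain J f w where *: "(J, f, w) \<in> unit_frames q"
    "vol_growth q B / 2 < \<bar>row_det (override_on w (\<lambda>i. B *v f i) J)\<bar>"
    unfolding less_vol_growth_iff by auto
  have "card J = q"
  proof (rule ccontr)
    assume "card J \<noteq> q"
    then have "card J < q" using *(1) by (simp add: unit_frames_def)
    then have "(J, f, w) \<in> unit_frames (q - 1)" "q \<noteq> 0" using *(1) by (auto simp: unit_frames_def)
    then have "\<bar>row_det (override_on w (\<lambda>i. B *v f i) J)\<bar> \<le> vol_growth q B / 2"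
      using vol_growth_upper[of J f w "q - 1" B] assms by auto
    then show False using *(2) by linarith
  qed
  then show ?thesis using that * by auto
qed

text \<open>A quantitative stand-in for the central stable space: with a fixed rate and a free
  constant it is visibly linear and monotone in \<open>e\<close>, and vectors slow at every positive
  rate are central stable.\<close>

definition slow_space :: "('a \<Rightarrow> 'a) \<Rightarrow> ('a \<Rightarrow> real^'p^'p) \<Rightarrow> real \<Rightarrow> 'a \<Rightarrow> (real^'p) set" where
  "slow_space T A e x = {v. \<exists>c. \<forall>k. norm (cocycle_iter T A k x *v v) \<le> c * exp (e * real k)}"

lemma subspace_slow_space: "subspace (slow_space T A e x)"
proof (rule subspaceI)
  show "0 \<in> slow_space T A e x" by (auto simp: slow_space_def intro!: exI[of _ 0])
next
  fix v w assume "v \<in> slow_space T A e x" "w \<in> slow_space T A e x"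
  then obtain c d where "\<And>k. norm (cocycle_iter T A k x *v v) \<le> c * exp (e * real k)"
    "\<And>k. norm (cocycle_iter T A k x *v w) \<le> d * exp (e * real k)"
    by (auto simp: slow_space_def)
  then have "norm (cocycle_iter T A k x *v (v + w)) \<le> (c + d) * exp (e * real k)" for k
    unfolding matrix_vector_right_distrib distrib_right
    by (intro order_trans[OF norm_triangle_ineq] add_mono)
  then show "v + w \<in> slow_space T A e x" by (auto simp: slow_space_def)
next
  fix a v assume "v \<in> slow_space T A e x"
  then obtain c where c: "\<And>k. norm (cocycle_iter T A k x *v v) \<le> c * exp (e * real k)"
    by (auto simp: slow_space_def)
  have "norm (cocycle_iter T A k x *v (a *\<^sub>R v)) \<le> (\<bar>a\<bar> * c) * exp (e * real k)" for k
    using mult_left_mono[OF c[of k], of "\<bar>a\<bar>"]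
    by (simp add: linear_scale[OF matrix_vector_mul_linear] mult.assoc)
  then show "a *\<^sub>R v \<in> slow_space T A e x" by (auto simp: slow_space_def)
qed

lemma slow_space_mono:
  assumes "d \<le> e"
  shows "slow_space T A d x \<subseteq> slow_space T A e x"
proof
  fix v assume "v \<in> slow_space T A d x"
  then obtain c where c: "\<And>k. norm (cocycle_iter T A k x *v v) \<le> c * exp (d * real k)"
    by (auto simp: slow_space_def)
  have "norm (cocycle_iter T A k x *v v) \<le> \<bar>c\<bar> * exp (e * real k)" for k
  proof -
    have "c * exp (d * real k) \<le> \<bar>c\<bar> * exp (e * real k)"
      using assms by (intro mult_mono) (auto intro: mult_right_mono)
    then show ?thesis using c[of k] by linarith
  qed
  then show "v \<in> slow_space T A e x" by (auto simp: slow_space_def)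
qed

text \<open>Good times are found only at some point of the orbit, so dimension bounds must be
  carried back to \<open>x\<close>. The preimage under an invertible iterate keeps its dimension,
  and the finitely many times before \<open>n\<close> go into the constant.\<close>

lemma slow_space_pullback:
  fixes A :: "'a \<Rightarrow> real^'p^'p"
  assumes inv: "\<And>n. invertible (A ((T ^^ n) x))" and e: "e \<ge> 0"
  shows "dim (slow_space T A e ((T ^^ n) x)) \<le> dim (slow_space T A e x)"
proof -
  let ?W = "slow_space T A e ((T ^^ n) x)" and ?C = "cocycle_iter T A n x"
  have "{u. ?C *v u \<in> ?W} \<subseteq> slow_space T A e x"
  proof
    fix u assume "u \<in> {u. ?C *v u \<in> ?W}"
    then obtain c where c: "\<And>k. norm (cocycle_iter T A k ((T ^^ n) x) *v (?C *v u)) \<le> c * exp (e * real k)"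
      by (auto simp: slow_space_def)
    define d where "d = \<bar>c\<bar> + (\<Sum>k<n. norm (cocycle_iter T A k x *v u))"
    have d: "d \<ge> \<bar>c\<bar>" by (simp add: d_def sum_nonneg)
    have "norm (cocycle_iter T A k x *v u) \<le> d * exp (e * real k)" for k
    proof (cases "k < n")
      case True
      have "norm (cocycle_iter T A k x *v u) \<le> (\<Sum>k<n. norm (cocycle_iter T A k x *v u))"
        using True by (intro member_le_sum) auto
      also have "\<dots> \<le> d * 1" by (simp add: d_def)
      also have "\<dots> \<le> d * exp (e * real k)" using e d by (intro mult_left_mono) auto
      finally show ?thesis .
    next
      case False
      then obtain l where l: "k = l + n" by (metis add.commute le_Suc_ex not_less)
      have "norm (cocycle_iter T A k x *v u) \<le> c * exp (e * real l)"
        using c[of l] unfolding l cocycle_iter_add by (simp add: matrix_vector_mul_assoc)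
      also have "\<dots> \<le> d * exp (e * real k)"
        using d e by (intro mult_mono) (auto simp: l mult_left_mono)
      finally show ?thesis .
    qed
    then show "u \<in> slow_space T A e x" by (auto simp: slow_space_def)
  qed
  then have "dim {u. ?C *v u \<in> ?W} \<le> dim (slow_space T A e x)" by (rule dim_subset)
  then show ?thesis using dim_preimage_invertible[OF invertible_cocycle_iter[of A T x n, OF inv]] by simp
qed

text \<open>A limit of orthonormal frames is orthonormal, so no dimension is lost. Frame number
  \<open>m\<close> satisfies only the conditions \<open>S k\<close> with \<open>k \<le> m\<close>,
  which suffices because each \<open>S k\<close> is closed. Storing the frames as rows of matrices
  lets one compactness argument serve all their vectors.\<close>

lemma orthonormal_limit_dim:
  fixes R :: "nat \<Rightarrow> real^'p^'p"
  assumes orth: "\<And>m i j. i \<in> I \<Longrightarrow> j \<in> I \<Longrightarrow> R m $ i \<bullet> R m $ j = (if i = j then 1 else 0)"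
    and norm: "\<And>m i. norm (R m $ i) \<le> 1"
    and closed: "\<And>k. closed (S k)" and S: "\<And>m k i. k \<le> m \<Longrightarrow> i \<in> I \<Longrightarrow> R m $ i \<in> S k"
    and V: "subspace V" "(\<Inter>k::nat. S k) \<subseteq> V"
  shows "card I \<le> dim V"
proof -
  have "norm (R m) \<le> real CARD('p)" for m
  proof -
    have "norm (R m) \<le> (\<Sum>i\<in>UNIV. norm (R m $ i))" unfolding norm_vec_def by (rule L2_set_le_sum) simp
    also have "\<dots> \<le> (\<Sum>i\<in>(UNIV::'p set). 1)" using norm by (intro sum_mono)
    finally show ?thesis by simp
  qed
  then have "bounded (range R)" by (auto simp: bounded_iff)
  then obtain L r where r: "strict_mono (r :: nat \<Rightarrow> nat)" and L: "(R \<circ> r) \<longlonglongrightarrow> L"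
    using bounded_imp_convergent_subsequence by blast
  have Li: "(\<lambda>m. R (r m) $ i) \<longlonglongrightarrow> L $ i" for i
    using tendsto_vec_nth[OF L] by (simp add: o_def)
  have orthL: "L $ i \<bullet> L $ j = (if i = j then 1 else 0)" if "i \<in> I" "j \<in> I" for i j
    using LIMSEQ_unique[OF tendsto_inner[OF Li Li, of i j]] orth[OF that] by simp
  have "L $ i \<in> V" if "i \<in> I" for i
  proof -
    have "L $ i \<in> S k" for k
    proof (rule Lim_in_closed_set[OF closed _ _ Li])
      have "R (r m) $ i \<in> S k" if "m \<ge> k" for m
        using S[of k "r m" i] \<open>i \<in> I\<close> seq_suble[OF r, of m] that by linarith
      then show "\<forall>\<^sub>F m in sequentially. R (r m) $ i \<in> S k" by (auto simp: eventually_sequentially)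
    qed simp
    then show ?thesis using V(2) by auto
  qed
  then have sub: "($) L ` I \<subseteq> V" by auto
  have inj: "inj_on (($) L) I"
  proof (rule inj_onI)
    fix i j assume "i \<in> I" "j \<in> I" "L $ i = L $ j"
    then show "i = j" using orthL[of i i] orthL[of i j] by (auto split: if_splits)
  qed
  have "independent (($) L ` I)"
  proof (rule pairwise_orthogonal_independent)
    show "pairwise orthogonal (($) L ` I)"
      unfolding pairwise_def orthogonal_def using orthL by auto
    show "0 \<notin> ($) L ` I"
    proof
      assume "0 \<in> ($) L ` I"
      then obtain i where "i \<in> I" "L $ i = 0" by auto
      then show False using orthL[of i i] by simp
    qed
  qed
  then have "card (($) L ` I) \<le> dim V" using sub by (intro independent_card_le_dim)
  then show ?thesis using inj by (simp add: card_image)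
qed

text \<open>For a good time \<open>n\<close>, the vectors mapped into the span of the test vectors
  form a space of dimension \<open>CARD('p) - q\<close>. By \<open>slow_vector_bound\<close> they
  grow slowly at every \<open>k \<le> n\<close> with a constant independent of \<open>n\<close>, so
  a limit over good times gives vectors that are slow forever.\<close>

lemma slow_space_dim:
  fixes A :: "'a \<Rightarrow> real^'p^'p"
  assumes inv: "\<And>n. invertible (A ((T ^^ n) y))" and q: "q \<le> CARD('p)" and e: "e > 0"
    and good: "\<And>m. \<exists>n\<ge>m. \<forall>k\<in>{1..n}. (\<Lambda> - e) * real k + ln (vol_growth q (cocycle_iter T A (n - k) ((T ^^ k) y)))
        < ln (vol_growth q (cocycle_iter T A n y))"
    and up: "\<And>n. ln (vol_growth (Suc q) (cocycle_iter T A n y)) \<le> (\<Lambda> + e) * real n + K"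
    and gap: "q = 0 \<or> (\<forall>n. ln (vol_growth (q - 1) (cocycle_iter T A n y)) \<le> (\<Lambda> - 2 * e) * real n + K)"
  shows "CARD('p) - q \<le> dim (slow_space T A (4 * e) y)"
proof -
  let ?p = "real CARD('p)"
  let ?it = "\<lambda>n. cocycle_iter T A n y"
  have vpos: "vol_growth j B > 0" for j and B :: "real^'p^'p" using vol_growth_ge_1[of j B] by linarith
  have ln_nonneg: "ln (vol_growth j B) \<ge> 0" for j and B :: "real^'p^'p"
    using vol_growth_ge_1[of j B] by simp
  have K: "K \<ge> 0" using up[of 0] ln_nonneg[of "Suc q" "?it 0"] by simp
  \<comment> \<open>This is \<open>?p * (\<kappa> + ?p * \<kappa>\<^sup>2)\<close> for
    \<open>\<kappa> = 2 * exp K * exp (2 * e * real k)\<close>, stripped of its exponential factor.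
    The square is the origin of the rate \<open>4 * e\<close>.\<close>
  define c where "c = ?p * (2 * exp K + 4 * ?p * exp (2 * K))"
  have p1: "?p \<ge> 1" by (metis One_nat_def Suc_leI finite_UNIV_card_ge_0 finite of_nat_1 of_nat_le_iff)
  have c1: "c \<ge> 1"
  proof -
    have "exp K \<ge> 1" using K by simp
    moreover have "0 \<le> 4 * ?p * exp (2 * K)" by simp
    ultimately have "1 \<le> 2 * exp K + 4 * ?p * exp (2 * K)" by linarith
    then have "1 * 1 \<le> ?p * (2 * exp K + 4 * ?p * exp (2 * K))"
      using p1 by (intro mult_mono) auto
    then show ?thesis by (simp add: c_def)
  qed
  define S where "S = (\<lambda>k. {v. norm (?it k *v v) \<le> c * exp (4 * e * real k)})"
  obtain I :: "'p set" where I: "card I = CARD('p) - q"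
    using obtain_subset_with_card_n[of "CARD('p) - q" "UNIV :: 'p set"] by auto
  have "\<exists>R :: real^'p^'p. (\<forall>i\<in>I. \<forall>j\<in>I. R $ i \<bullet> R $ j = (if i = j then 1 else 0)) \<and>
      (\<forall>i. norm (R $ i) \<le> 1) \<and> (\<forall>k\<le>m. \<forall>i\<in>I. R $ i \<in> S k)" for m
  proof -
    \<comment> \<open>Beyond \<open>m'\<close> the rates of the \<open>q\<close>-volume and the
      \<open>(q - 1)\<close>-volume differ by enough to absorb \<open>K\<close> and the factor 2 in
      \<open>near_maximal_frame\<close>.\<close>
    obtain m' :: nat where m': "real m' \<ge> (K + ln 2) / e" using real_arch_simple by blast
    obtain n where n: "n \<ge> max 1 (max m m')" and good_n: "\<And>k. k \<in> {1..n} \<Longrightarrow>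
        (\<Lambda> - e) * real k + ln (vol_growth q (cocycle_iter T A (n - k) ((T ^^ k) y))) < ln (vol_growth q (?it n))"
      using good by blast
    have big: "e * real n \<ge> K + ln 2"
    proof -
      have "real n \<ge> (K + ln 2) / e" using m' n by (meson max.bounded_iff of_nat_le_iff order_trans)
      then show ?thesis using e by (simp add: field_simps)
    qed
    have "q = 0 \<or> 2 * vol_growth (q - 1) (?it n) \<le> vol_growth q (?it n)"
    proof (cases "q = 0")
      case False
      have "ln (2 * vol_growth (q - 1) (?it n)) = ln 2 + ln (vol_growth (q - 1) (?it n))"
        using vpos[of "q - 1" "?it n"] by (simp add: ln_mult)
      also have "\<dots> \<le> ln 2 + ((\<Lambda> - 2 * e) * real n + K)" using gap False by simp
      also have "\<dots> \<le> (\<Lambda> - e) * real n" using big by (simp add: algebra_simps)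
      \<comment> \<open>Goodness at \<open>k = n\<close>: the remaining iterate is the identity,
        whose logarithmic volume is nonnegative.\<close>
      also have "\<dots> \<le> ln (vol_growth q (?it n))"
        using good_n[of n] n ln_nonneg[of q "cocycle_iter T A 0 ((T ^^ n) y)"] by simp
      finally show ?thesis using vpos[of "q - 1" "?it n"] vpos[of q "?it n"] by simp
    qed simp
    then obtain J f w where frame: "(J, f, w) \<in> unit_frames q" "card J = q"
      and near: "vol_growth q (?it n) < 2 * \<bar>row_det (override_on w (\<lambda>i. ?it n *v f i) J)\<bar>"
      by (rule near_maximal_frame)
    define U where "U = {u. ?it n *v u \<in> span (w ` (- J))}"
    have nz: "row_det (override_on w (\<lambda>i. ?it n *v f i) J) \<noteq> 0" using near vpos[of q "?it n"] by auto
    have "dim U = dim (span (w ` (- J)))"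
      unfolding U_def by (rule dim_preimage_invertible[OF invertible_cocycle_iter[of A T y, OF inv]])
    also have "w ` (- J) = override_on w (\<lambda>i. ?it n *v f i) J ` (- J)"
      by (rule image_cong) (auto simp: override_on_def)
    also have "dim (span \<dots>) = card (- J)" unfolding dim_span by (rule row_det_nonzero_dim[OF nz])
    finally have dimU: "dim U = card I" using frame(2) I by (simp add: Compl_eq_Diff_UNIV card_Diff_subset)
    have "subspace U"
      unfolding U_def by (intro subspaceI)
        (auto simp: matrix_vector_right_distrib linear_scale[OF matrix_vector_mul_linear]
          intro: span_zero span_add span_scale)
    then obtain B where B: "B \<subseteq> U" "pairwise orthogonal B" "\<And>x. x \<in> B \<Longrightarrow> norm x = 1"
      "independent B" "card B = dim U"
      using orthonormal_basis_subspace by metis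
    have "finite B" using B(4) independent_imp_finite by blast
    then obtain g where g: "bij_betw g I B"
      using B(5) dimU by (metis finite bij_betw_iff_card)
    define R :: "real^'p^'p" where "R = (\<chi> i. if i \<in> I then g i else 0)"
    have gB: "i \<in> I \<Longrightarrow> g i \<in> B" for i using g by (auto simp: bij_betw_def)
    have "R $ i \<bullet> R $ j = (if i = j then 1 else 0)" if "i \<in> I" "j \<in> I" for i j
    proof (cases "i = j")
      case True
      then show ?thesis using B(3)[OF gB[of i]] that by (simp add: R_def norm_eq_1)
    next
      case False
      then have "g i \<noteq> g j" using g that by (auto simp: bij_betw_def inj_on_def)
      then have "orthogonal (g i) (g j)" using B(2) gB that by (meson pairwiseD)
      then show ?thesis using that False by (simp add: R_def orthogonal_def)
    qed
    moreover have "norm (R $ i) \<le> 1" for i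
      using B(3)[OF gB[of i]] by (auto simp: R_def)
    moreover have "R $ i \<in> S k" if "k \<le> m" "i \<in> I" for k i
    proof -
      have Ri: "R $ i \<in> U" "norm (R $ i) = 1" using that gB B by (auto simp: R_def)
      show ?thesis
      proof (cases "k = 0")
        case True
        then show ?thesis using Ri c1 by (simp add: S_def)
      next
        case False
        have kn: "k \<le> n" using that n by simp
        define Bk where "Bk = cocycle_iter T A (n - k) ((T ^^ k) y)"
        have split: "?it n = Bk ** ?it k"
          using cocycle_iter_add[of T A "n - k" k y] kn by (simp add: Bk_def)
        \<comment> \<open>Goodness of \<open>n\<close> at \<open>k\<close> supplies
          \<open>s\<close>, the bound on \<open>Suc q\<close>-volumes supplies \<open>t\<close>.
          Both rates are close to the same \<open>\<Lambda>\<close>, so that \<open>t / s\<close>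
          grows at rate \<open>2 * e\<close> only.\<close>
        define s where "s = exp ((\<Lambda> - e) * real k)"
        define t where "t = exp ((\<Lambda> + e) * real k + K)"
        have st: "s * vol_growth q Bk \<le> vol_growth q (Bk ** ?it k)"
        proof -
          have "ln (s * vol_growth q Bk) \<le> ln (vol_growth q (?it n))"
            using good_n[of k] kn False vpos[of q Bk] by (simp add: ln_mult s_def Bk_def)
          then show ?thesis
            using vpos[of q Bk] vpos[of q "?it n"] by (simp add: split s_def zero_less_mult_iff)
        qed
        have tt: "vol_growth (Suc q) (?it k) \<le> t"
          unfolding t_def using up[of k] vpos[of "Suc q" "?it k"] by (metis exp_le_cancel_iff exp_ln)
        have "t / s = exp (2 * e * real k + K)"
          by (simp add: t_def s_def exp_diff[symmetric] algebra_simps)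
        then have ts: "2 * t / s = 2 * exp K * exp (2 * e * real k)"
          by (metis exp_add mult.assoc mult.commute times_divide_eq_right)
        have "norm (?it k *v R $ i) \<le> ?p * (2 * t / s + ?p * (2 * t / s)\<^sup>2)"
          by (rule slow_vector_bound[OF frame, of Bk "?it k"])
            (use near Ri st tt in \<open>auto simp: split[symmetric] U_def s_def\<close>)
        also have "\<dots> = ?p * (2 * exp K * exp (2 * e * real k) + ?p * (2 * exp K * exp (2 * e * real k))\<^sup>2)"
          by (simp only: ts)
        also have "\<dots>
            \<le> ?p * (2 * exp K * exp (4 * e * real k) + ?p * (4 * exp (2 * K) * exp (4 * e * real k)))"
        proof -
          have "(2 * exp K * exp (2 * e * real k))\<^sup>2 = 4 * exp (2 * K) * exp (4 * e * real k)"
            by (simp add: power_mult_distrib exp_double[symmetric] flip: exp_of_nat_mult)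
          moreover have "exp (2 * e * real k) \<le> exp (4 * e * real k)" using e by simp
          ultimately show ?thesis by (intro mult_left_mono add_mono) auto
        qed
        also have "\<dots> = c * exp (4 * e * real k)" by (simp add: c_def algebra_simps)
        finally show ?thesis by (simp add: S_def)
      qed
    qed
    ultimately show ?thesis by blast
  qed
  then obtain R where "\<And>m. (\<forall>i\<in>I. \<forall>j\<in>I. R m $ i \<bullet> R m $ j = (if i = j then 1 else 0)) \<and>
      (\<forall>i. norm (R m $ i) \<le> 1) \<and> (\<forall>k\<le>m. \<forall>i\<in>I. R m $ i \<in> S k)" by metis
  then have "card I \<le> dim (slow_space T A (4 * e) y)"
  proof (intro orthonormal_limit_dim[of I R S])
    show "closed (S k)" for k
      unfolding S_def by (intro closed_Collect_le continuous_intros)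
    show "(\<Inter>k. S k) \<subseteq> slow_space T A (4 * e) y" by (auto simp: S_def slow_space_def)
  qed (auto simp: subspace_slow_space)
  then show ?thesis by (simp add: I)
qed

text \<open>The constant in \<open>slow_space\<close> depends on the vector; adding up the constants
  of an orthonormal basis of \<open>L\<close> makes it uniform.\<close>

lemma slow_space_uniform:
  fixes A :: "'a \<Rightarrow> real^'p^'p"
  assumes "subspace L" "L \<subseteq> slow_space T A e x"
  obtains c where "c > 0" "\<And>k v. v \<in> L \<Longrightarrow> norm (cocycle_iter T A k x *v v) \<le> c * exp (e * real k) * norm v"
proof -
  obtain B where B: "B \<subseteq> L" "pairwise orthogonal B" "\<And>x. x \<in> B \<Longrightarrow> norm x = 1"
    "independent B" "span B = L"
    using orthonormal_basis_subspace[OF assms(1)] by metis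
  have fin: "finite B" using B(4) independent_imp_finite by blast
  have "\<forall>b\<in>B. \<exists>c. \<forall>k. norm (cocycle_iter T A k x *v b) \<le> c * exp (e * real k)"
    using B(1) assms(2) by (auto simp: slow_space_def)
  then obtain d where d: "\<And>b k. b \<in> B \<Longrightarrow> norm (cocycle_iter T A k x *v b) \<le> d b * exp (e * real k)"
    by metis
  define c where "c = 1 + (\<Sum>b\<in>B. \<bar>d b\<bar>)"
  have "norm (cocycle_iter T A k x *v v) \<le> c * exp (e * real k) * norm v" if "v \<in> L" for k v
  proof -
    have v: "v = (\<Sum>b\<in>B. (v \<bullet> b) *\<^sub>R b)"
      using orthonormal_basis_expand[OF B(2) B(3) _ fin] that B(5) by metis
    have "cocycle_iter T A k x *v v = (\<Sum>b\<in>B. (v \<bullet> b) *\<^sub>R (cocycle_iter T A k x *v b))"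
      by (subst v) (simp add: linear_sum linear_scale o_def)
    then have "norm (cocycle_iter T A k x *v v) \<le> (\<Sum>b\<in>B. norm ((v \<bullet> b) *\<^sub>R (cocycle_iter T A k x *v b)))"
      using norm_sum by metis
    also have "\<dots> \<le> (\<Sum>b\<in>B. norm v * (\<bar>d b\<bar> * exp (e * real k)))"
    proof (rule sum_mono)
      fix b assume b: "b \<in> B"
      have "\<bar>v \<bullet> b\<bar> \<le> norm v" using Cauchy_Schwarz_ineq2[of v b] B(3)[OF b] by simp
      moreover have "norm (cocycle_iter T A k x *v b) \<le> \<bar>d b\<bar> * exp (e * real k)"
        using d[OF b, of k] by (rule order_trans) (simp add: mult_right_mono)
      ultimately show "norm ((v \<bullet> b) *\<^sub>R (cocycle_iter T A k x *v b)) \<le> norm v * (\<bar>d b\<bar> * exp (e * real k))"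
        unfolding norm_scaleR by (intro mult_mono) auto
    qed
    also have "\<dots> = (\<Sum>b\<in>B. \<bar>d b\<bar>) * exp (e * real k) * norm v"
      by (simp add: sum_distrib_right sum_distrib_left mult_ac)
    also have "\<dots> \<le> c * exp (e * real k) * norm v"
      by (intro mult_right_mono) (auto simp: c_def)
    finally show ?thesis .
  qed
  moreover have "c > 0" by (simp add: c_def add_pos_nonneg sum_nonneg)
  ultimately show ?thesis using that by blast
qed

text \<open>Compactness of the set of normalised pairs: \<open>norm (l + g)\<close> has a positive
  minimum there, since \<open>l + g = 0\<close> would put \<open>g\<close> into both
  subspaces.\<close>

lemma transverse_subspaces_bound:
  fixes L G :: "'v::euclidean_space set"
  assumes "subspace L" "subspace G" "G \<inter> L = {0}"
  obtains C where "C > 0" "\<And>l g. l \<in> L \<Longrightarrow> g \<in> G \<Longrightarrow> norm l + norm g \<le> C * norm (l + g)"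
proof -
  define S where "S = (L \<times> G) \<inter> {z. norm (fst z) + norm (snd z) = 1}"
  have "closed S" unfolding S_def
    by (intro closed_Int closed_Times closed_subspace assms closed_Collect_eq continuous_intros)
  moreover have "bounded S"
  proof (rule bounded_subset)
    show "S \<subseteq> cball 0 1 \<times> cball 0 1" by (auto simp: S_def) (smt (verit) norm_ge_zero)+
  qed (intro bounded_Times bounded_cball)
  ultimately have "compact S" by (simp add: compact_eq_bounded_closed)
  have nz: "norm (fst z + snd z) > 0" if "z \<in> S" for z
  proof (rule ccontr)
    assume "\<not> norm (fst z + snd z) > 0"
    then have "snd z = - fst z" by (simp add: add_eq_0_iff)
    then have "snd z \<in> G \<inter> L" using that subspace_neg[OF assms(1)] by (auto simp: S_def)
    then have "snd z = 0" using assms(3) by auto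
    then show False using that \<open>snd z = - fst z\<close> by (auto simp: S_def)
  qed
  obtain \<delta> where \<delta>: "\<delta> > 0" "\<And>z. z \<in> S \<Longrightarrow> \<delta> \<le> norm (fst z + snd z)"
  proof (cases "S = {}")
    case True
    then show ?thesis using that[of 1] by auto
  next
    case False
    have "\<exists>x\<in>S. \<forall>y\<in>S. norm (fst x + snd x) \<le> norm (fst y + snd y)"
      by (rule continuous_attains_inf[OF \<open>compact S\<close> False]) (intro continuous_intros)
    then show ?thesis using that nz by blast
  qed
  have "norm l + norm g \<le> (1 / \<delta>) * norm (l + g)" if lg: "l \<in> L" "g \<in> G" for l g
  proof (cases "norm l + norm g = 0")
    case False
    define r where "r = norm l + norm g"
    have r: "r > 0" using False unfolding r_def by (smt (verit) norm_ge_zero)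
    have "norm l / r + norm g / r = 1" using r by (simp add: r_def add_divide_distrib[symmetric])
    then have "(l /\<^sub>R r, g /\<^sub>R r) \<in> S"
      using lg r assms(1,2) by (simp add: S_def subspace_scale divide_inverse mult.commute)
    from \<delta>(2)[OF this] have "\<delta> \<le> norm (l /\<^sub>R r + g /\<^sub>R r)" by simp
    also have "l /\<^sub>R r + g /\<^sub>R r = (l + g) /\<^sub>R r" by (rule scaleR_add_right[symmetric])
    also have "norm \<dots> = norm (l + g) / r" using r by (simp add: divide_inverse mult.commute)
    finally have "\<delta> * r \<le> norm (l + g)" using r by (simp add: pos_le_divide_eq)
    then have "r \<le> norm (l + g) / \<delta>" using \<delta>(1) by (simp add: pos_le_divide_eq mult.commute)
    then show ?thesis by (simp add: r_def)
  qed (use \<delta>(1) in simp)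
  then show ?thesis using that[of "1 / \<delta>"] \<delta>(1) by simp
qed

text \<open>A \<open>q\<close>-dimensional frame meets the span of \<open>L\<close> and \<open>v\<close>; replacing one of its vectors by a vector in the
  intersection shows that \<open>B *v v\<close> carries the ratio of the \<open>q\<close>-volume and the \<open>(q - 1)\<close>-volume.\<close>

lemma expansion_from_volume:
  fixes B :: "real^'p^'p"
  assumes q: "q \<ge> 1" and L: "subspace L" "CARD('p) - q \<le> dim L" and v: "v \<notin> L"
    and vol: "2 * vol_growth (q - 1) B \<le> vol_growth q B"
    and C: "C > 0" "\<And>l t. l \<in> L \<Longrightarrow> norm l + norm (t *\<^sub>R v) \<le> C * norm (l + t *\<^sub>R v)"
    and b: "b \<ge> 0" "\<And>l. l \<in> L \<Longrightarrow> norm (B *v l) \<le> b * norm l"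
  shows "vol_growth q B * norm v \<le> 2 * C * real q * (b * norm v + norm (B *v v)) * vol_growth (q - 1) B"
proof -
  obtain J f w where frame: "(J, f, w) \<in> unit_frames q" "card J = q"
    and near: "vol_growth q B < 2 * \<bar>row_det (override_on w (\<lambda>i. B *v f i) J)\<bar>"
    using near_maximal_frame[of q B] vol by metis
  have vpos: "vol_growth j B \<ge> 1" for j by (rule vol_growth_ge_1)
  define \<rho> where "\<rho> = override_on w (\<lambda>i. B *v f i) J"
  have nz: "row_det \<rho> \<noteq> 0" using near vpos[of q] by (auto simp: \<rho>_def)
  have "\<rho> ` J = (*v) B ` f ` J" by (auto simp: \<rho>_def override_on_def image_iff)
  then have "q = dim ((*v) B ` f ` J)" using row_det_nonzero_dim[OF nz, of J] frame(2) by simp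
  also have "\<dots> \<le> dim (f ` J)" by (rule dim_image_le) simp
  finally have dimF: "q \<le> dim (span (f ` J))" by simp
  have inj: "inj_on f J"
  proof (rule inj_onI)
    fix i j assume "i \<in> J" "j \<in> J" "f i = f j"
    then have "\<rho> i = \<rho> j" by (simp add: \<rho>_def)
    then show "i = j" using row_det_nonzero_inj[OF nz] by (simp add: inj_def)
  qed
  have spanL: "span L = L" using L(1) by (simp add: span_eq_iff)
  have dimH: "dim (span (insert v L)) = dim L + 1"
  proof -
    have "v \<notin> span L" unfolding spanL by (rule v)
    then show ?thesis by (simp add: dim_insert)
  qed
  have "dim {x + y |x y. x \<in> span (f ` J) \<and> y \<in> span (insert v L)} + dim (span (f ` J) \<inter> span (insert v L))
      = dim (span (f ` J)) + dim (span (insert v L))"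
    by (rule dim_sums_Int) auto
  moreover have "dim {x + y |x y. x \<in> span (f ` J) \<and> y \<in> span (insert v L)} \<le> CARD('p)"
    by (rule order_trans[OF dim_subset_UNIV]) simp
  \<comment> \<open>The dimensions are at least \<open>q\<close> and
    \<open>CARD('p) - q + 1\<close>; the vector \<open>v\<close> outside \<open>L\<close> supplies
    the one dimension that forces an intersection.\<close>
  ultimately have "dim (span (f ` J) \<inter> span (insert v L)) \<noteq> 0"
    using dimF dimH L(2) by linarith
  then obtain z0 where z0: "z0 \<in> span (f ` J)" "z0 \<in> span (insert v L)" "z0 \<noteq> 0"
    by (auto simp: dim_eq_0)
  obtain a0 where a0: "z0 = (\<Sum>i\<in>J. a0 i *\<^sub>R f i)"
  proof -
    obtain u where "z0 = (\<Sum>b\<in>f ` J. u b *\<^sub>R b)"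
      using z0(1) by (auto simp: span_finite)
    then show ?thesis using that[of "\<lambda>i. u (f i)"] inj by (simp add: sum.reindex)
  qed
  have "J \<noteq> {}" using frame(2) q by auto
  \<comment> \<open>Dividing by the largest coefficient turns the coefficient at \<open>i0\<close>
    into 1 and bounds the others by 1. So \<open>z\<close> has norm at most \<open>q\<close> and can
    replace \<open>f i0\<close> without changing the determinant.\<close>
  then obtain i0 where i0: "i0 \<in> J" "\<And>i. i \<in> J \<Longrightarrow> \<bar>a0 i\<bar> \<le> \<bar>a0 i0\<bar>"
    using obtains_MAX[of J "\<lambda>i. \<bar>a0 i\<bar>"] by (metis finite Max_ge finite_imageI imageI)
  have a0nz: "a0 i0 \<noteq> 0"
  proof
    assume "a0 i0 = 0"
    then have "a0 i = 0" if "i \<in> J" for i using i0(2)[OF that] by simp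
    then show False using a0 z0(3) by simp
  qed
  define a where "a = (\<lambda>i. a0 i / a0 i0)"
  define z where "z = (\<Sum>i\<in>J. a i *\<^sub>R f i)"
  have z_scale: "z = (1 / a0 i0) *\<^sub>R z0"
    by (simp add: z_def a0 a_def scaleR_sum_right)
  have a_le: "\<bar>a i\<bar> \<le> 1" if "i \<in> J" for i
    using i0(2)[OF that] a0nz by (simp add: a_def)
  have "z \<in> span (insert v L)" unfolding z_scale using z0(2) by (rule span_scale)
  then obtain t where t: "z - t *\<^sub>R v \<in> L" using spanL by (auto simp: span_breakdown_eq)
  define l where "l = z - t *\<^sub>R v"
  have lL: "l \<in> L" using t by (simp add: l_def)
  have z_eq: "z = l + t *\<^sub>R v" by (simp add: l_def)
  have "norm z \<le> (\<Sum>i\<in>J. 1)"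
    unfolding z_def
  proof (rule order_trans[OF norm_sum], rule sum_mono)
    fix i assume "i \<in> J"
    then have "\<bar>a i\<bar> * norm (f i) \<le> 1 * 1"
      using a_le frame(1) by (intro mult_mono) (auto simp: unit_frames_def)
    then show "norm (a i *\<^sub>R f i) \<le> 1" by simp
  qed
  then have "norm z \<le> real q" using frame(2) by simp
  then have "C * norm z \<le> C * real q" using C(1) by simp
  then have lt: "norm l + norm (t *\<^sub>R v) \<le> C * real q"
    using C(2)[OF lL, of t] unfolding z_eq[symmetric] by linarith
  have "norm (B *v z) \<le> norm (B *v l) + \<bar>t\<bar> * norm (B *v v)"
    unfolding z_eq matrix_vector_right_distrib linear_scale[OF matrix_vector_mul_linear]
    by (rule order_trans[OF norm_triangle_ineq]) simp
  also have "norm (B *v l) \<le> b * (C * real q)"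
  proof -
    have "norm l \<le> C * real q" using lt norm_ge_zero[of "t *\<^sub>R v"] by linarith
    then show ?thesis using b(2)[OF lL] b(1) by (meson mult_left_mono order_trans)
  qed
  finally have Bz: "norm (B *v z) \<le> b * (C * real q) + \<bar>t\<bar> * norm (B *v v)" by simp
  have tv: "\<bar>t\<bar> * norm v \<le> C * real q" using lt norm_ge_zero[of l] unfolding norm_scaleR by linarith
  have "B *v z = B *v f i0 + (\<Sum>i\<in>J - {i0}. a i *\<^sub>R (B *v f i))"
    unfolding z_def using i0(1) a0nz
    by (simp add: sum.remove linear_sum linear_scale linear_add o_def a_def matrix_vector_right_distrib)
  moreover have in_span: "(\<Sum>i\<in>J - {i0}. a i *\<^sub>R (B *v f i)) \<in> span (\<rho> ` (UNIV - {i0}))"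
  proof (intro span_sum span_scale span_base)
    fix j assume "j \<in> J - {i0}"
    then have "B *v f j = \<rho> j" "j \<noteq> i0" by (auto simp: \<rho>_def override_on_def)
    then show "B *v f j \<in> \<rho> ` (UNIV - {i0})" by blast
  qed
  ultimately have "row_det (\<rho>(i0 := B *v z)) = row_det (\<rho>(i0 := B *v f i0))"
    using row_det_add_span[OF in_span] by simp
  also have "\<rho>(i0 := B *v f i0) = \<rho>" using i0(1) by (auto simp: \<rho>_def override_on_def)
  finally have eq: "row_det (\<rho>(i0 := B *v z)) = row_det \<rho>" .
  \<comment> \<open>After the replacement row \<open>i0\<close> is regarded as a test row. Only
    \<open>q - 1\<close> images of frame vectors remain, so a \<open>(q - 1)\<close>-volume times
    \<open>norm (B *v z)\<close> bounds the determinant.\<close>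
  have upd: "\<rho>(i0 := B *v z) = override_on (w(i0 := B *v z)) (\<lambda>i. B *v f i) (J - {i0})"
    by (auto simp: \<rho>_def override_on_def)
  have "\<bar>row_det \<rho>\<bar> \<le> (\<Prod>i\<in>UNIV. if i \<in> J - {i0} then norm (f i) else norm ((w(i0 := B *v z)) i)) * vol_growth (q - 1) B"
    unfolding eq[symmetric] upd
    by (rule vol_growth_upper_norms) (use frame(2) i0(1) in \<open>simp add: card_Diff_singleton\<close>)
  also have "\<dots> \<le> (\<Prod>i\<in>UNIV. if i = i0 then norm (B *v z) else 1) * vol_growth (q - 1) B"
    using vpos[of "q - 1"] frame(1) by (intro mult_right_mono prod_mono) (auto simp: unit_frames_def)
  also have "\<dots> = norm (B *v z) * vol_growth (q - 1) B" by simp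
  finally have "vol_growth q B \<le> 2 * (norm (B *v z) * vol_growth (q - 1) B)"
    using near by (simp add: \<rho>_def)
  then have "vol_growth q B * norm v \<le> 2 * (norm (B *v z) * vol_growth (q - 1) B) * norm v"
    by (rule mult_right_mono) simp
  also have "\<dots> = 2 * (norm (B *v z) * norm v) * vol_growth (q - 1) B" by simp
  also have "\<dots> \<le> 2 * (C * real q * (b * norm v + norm (B *v v))) * vol_growth (q - 1) B"
  proof -
    have "norm (B *v z) * norm v \<le> (b * (C * real q) + \<bar>t\<bar> * norm (B *v v)) * norm v"
      using Bz by (rule mult_right_mono) simp
    also have "\<dots> = b * (C * real q) * norm v + (\<bar>t\<bar> * norm v) * norm (B *v v)"
      by (simp add: algebra_simps)
    also have "\<dots> \<le> b * (C * real q) * norm v + (C * real q) * norm (B *v v)"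
      using tv by (intro add_left_mono mult_right_mono) auto
    also have "\<dots> = C * real q * (b * norm v + norm (B *v v))" by (simp add: algebra_simps)
    finally show ?thesis using vpos[of "q - 1"] by (intro mult_right_mono mult_left_mono) auto
  qed
  finally show ?thesis by (simp add: mult.assoc)
qed

lemma slow_vectors_central_stable:
  assumes "\<And>e. e > 0 \<Longrightarrow> v \<in> slow_space T A e x"
  shows "v \<in> central_stable T A x"
proof -
  let ?f = "\<lambda>n. ereal (root n (norm (cocycle_iter T A n x *v v)))"
  have le: "limsup ?f \<le> ereal (exp (2 * e))" if e: "e > 0" for e
  proof (rule Limsup_bounded)
    obtain c where c: "\<And>k. norm (cocycle_iter T A k x *v v) \<le> c * exp (e * real k)"
      using assms[OF e] by (auto simp: slow_space_def)
    \<comment> \<open>Beyond \<open>n0\<close> one has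
      \<open>c \<le> e * real n \<le> exp (e * real n)\<close>, so doubling the rate absorbs the
      constant.\<close>
    obtain n0 :: nat where n0: "c / e \<le> real n0" using real_arch_simple by blast
    have "?f n \<le> ereal (exp (2 * e))" if n: "n \<ge> Suc n0" for n
    proof -
      have "c \<le> e * real n" using n0 n e by (simp add: field_simps) (smt (verit) mult_left_mono of_nat_le_iff Suc_leD)
      also have "\<dots> \<le> exp (e * real n)" using exp_ge_add_one_self[of "e * real n"] by linarith
      finally have "c * exp (e * real n) \<le> exp (e * real n) * exp (e * real n)" by simp
      also have "\<dots> = exp (2 * e) ^ n" by (simp flip: exp_add exp_of_nat_mult add: algebra_simps)
      finally have "norm (cocycle_iter T A n x *v v) \<le> exp (2 * e) ^ n" using c[of n] by linarith
      then have "root n (norm (cocycle_iter T A n x *v v)) \<le> root n (exp (2 * e) ^ n)"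
        using n by simp
      also have "\<dots> = exp (2 * e)" using n by (simp add: real_root_power_cancel)
      finally show ?thesis by simp
    qed
    then show "\<forall>\<^sub>F n in sequentially. ?f n \<le> ereal (exp (2 * e))"
      unfolding eventually_sequentially by blast
  qed
  have "limsup ?f \<le> 1"
  proof (rule ccontr)
    assume "\<not> limsup ?f \<le> 1"
    then have "ereal 1 < limsup ?f" by (simp add: not_le one_ereal_def)
    then obtain r where r: "ereal 1 < ereal r" "ereal r < limsup ?f" using ereal_dense2 by blast
    then have "limsup ?f \<le> ereal (exp (2 * (ln r / 2)))" by (intro le) simp
    then show False using r by simp
  qed
  then show ?thesis by (simp add: central_stable_def)
qed

text \<open>By \<open>expansion_from_volume\<close> the jump from \<open>(q - 1)\<close>-volume to
  \<open>q\<close>-volume, of rate \<open>3 * \<gamma> / 4\<close>, is carried by the growth on a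
  slow space \<open>L\<close>, of rate \<open>\<gamma> / 4\<close>, or by the vector of
  \<open>G\<close>. Neither the constants nor the times depend on that vector.\<close>

lemma uniform_expansion:
  fixes A :: "'a \<Rightarrow> real^'p^'p"
  assumes q: "q \<le> CARD('p)" and \<gamma>: "\<gamma> > 0"
    and slow: "\<And>e. e > 0 \<Longrightarrow> CARD('p) - q \<le> dim (slow_space T A e x)"
    and gap: "q = 0 \<or> (\<forall>n. ln (vol_growth (q - 1) (cocycle_iter T A n x)) \<le> (\<Lambda> - \<gamma>) * real n + K)"
    and growth: "\<And>m. \<exists>n\<ge>m. (\<Lambda> - \<gamma> / 4) * real n - K \<le> ln (vol_growth q (cocycle_iter T A n x))"
    and G: "subspace G" "G \<inter> central_stable T A x = {0}"
  shows "\<exists>r>0. \<forall>m. \<exists>n\<ge>m. \<forall>v\<in>G. exp (r * real n) * norm v \<le> norm (cocycle_iter T A n x *v v)"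
proof -
  let ?it = "\<lambda>n. cocycle_iter T A n x"
  \<comment> \<open>Dimensions are natural numbers, so the least one is attained. Slow spaces are
    nested, hence they agree for all rates below \<open>e0\<close>, and \<open>L\<close> is slow at
    every positive rate.\<close>
  have "\<exists>e0>0. \<forall>e>0. dim (slow_space T A e0 x) \<le> dim (slow_space T A e x)"
    using ex_has_least_nat[of "\<lambda>e. e > (0::real)" 1 "\<lambda>e. dim (slow_space T A e x)"] by auto
  then obtain e0 where e0: "e0 > 0" "\<And>e. e > 0 \<Longrightarrow> dim (slow_space T A e0 x) \<le> dim (slow_space T A e x)"
    by blast
  define L where "L = slow_space T A e0 x"
  have L: "subspace L" by (simp add: L_def subspace_slow_space)
  have L_slow: "L \<subseteq> slow_space T A e x" if "e > 0" for e
  proof (cases "e \<ge> e0")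
    case True
    then show ?thesis unfolding L_def by (rule slow_space_mono)
  next
    case False
    then have "slow_space T A e x = slow_space T A e0 x"
      using e0(2)[OF that] slow_space_mono[of e e0 T A x]
      by (intro subspace_dim_equal subspace_slow_space) auto
    then show ?thesis by (simp add: L_def)
  qed
  have "L \<subseteq> central_stable T A x" using L_slow by (auto intro: slow_vectors_central_stable)
  moreover have "0 \<in> L" using L by (simp add: subspace_0)
  moreover have "0 \<in> G" using G(1) by (simp add: subspace_0)
  ultimately have GL: "G \<inter> L = {0}" using G(2) by auto
  have dimL: "CARD('p) - q \<le> dim L" unfolding L_def using slow[OF e0(1)] .
  show ?thesis
  proof (cases "q = 0")
    case True
    then have "dim L = dim (UNIV :: (real^'p) set)" using dimL dim_subset_UNIV[of L] by simp
    then have "L = UNIV" using L by (intro subspace_dim_equal) auto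
    then have "G = {0}" using GL by simp
    then show ?thesis by (intro exI[of _ 1]) auto
  next
    case False
    obtain C where C: "C > 0" "\<And>l g. l \<in> L \<Longrightarrow> g \<in> G \<Longrightarrow> norm l + norm g \<le> C * norm (l + g)"
      using transverse_subspaces_bound[OF L G(1) GL] by blast
    obtain c where c: "c > 0" "\<And>k v. v \<in> L \<Longrightarrow> norm (?it k *v v) \<le> c * exp (\<gamma> / 4 * real k) * norm v"
      using slow_space_uniform[OF L L_slow[of "\<gamma> / 4"]] \<gamma> by auto
    define D where "D = 2 * C * real q"
    have D: "D > 0" using C(1) False by (simp add: D_def)
    have vpos: "vol_growth j B > 0" for j and B :: "real^'p^'p" using vol_growth_ge_1[of j B] by linarith
    have "\<exists>n\<ge>m. \<forall>v\<in>G. exp (\<gamma> / 2 * real n) * norm v \<le> norm (?it n *v v)" for m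
    proof -
      \<comment> \<open>Of the three shares \<open>\<gamma> / 4 * real n\<close> in the volume
        ratio, one swallows \<open>D * (c + 1)\<close> and \<open>2 * K\<close>; the two that remain
        give the rate \<open>\<gamma> / 2\<close>. The term \<open>ln 2\<close> serves the factor 2
        in \<open>expansion_from_volume\<close>.\<close>
      obtain m1 :: nat where m1: "4 * (2 * \<bar>K\<bar> + \<bar>ln (D * (c + 1))\<bar> + ln 2) / \<gamma> \<le> real m1"
        using real_arch_simple by blast
      obtain n where n: "n \<ge> max m m1" and gr: "(\<Lambda> - \<gamma> / 4) * real n - K \<le> ln (vol_growth q (?it n))"
        using growth by blast
      have "4 * (2 * \<bar>K\<bar> + \<bar>ln (D * (c + 1))\<bar> + ln 2) / \<gamma> \<le> real n"
        using m1 n by (meson max.bounded_iff of_nat_le_iff order_trans)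
      then have big: "2 * \<bar>K\<bar> + \<bar>ln (D * (c + 1))\<bar> + ln 2 \<le> \<gamma> / 4 * real n"
        using \<gamma> by (simp add: field_simps)
      have ln2: "ln 2 > (0::real)" by simp
      have gap_n: "ln (vol_growth (q - 1) (?it n)) \<le> (\<Lambda> - \<gamma>) * real n + K" using gap False by simp
      have gn: "\<gamma> * real n \<ge> 0" using \<gamma> by simp
      have diff: "(\<Lambda> - \<gamma> / 4) * real n - K - ((\<Lambda> - \<gamma>) * real n + K) = 3 * (\<gamma> / 4 * real n) - 2 * K"
        by (simp add: algebra_simps)
      have vol: "2 * vol_growth (q - 1) (?it n) \<le> vol_growth q (?it n)"
      proof -
        have "ln (2 * vol_growth (q - 1) (?it n)) = ln 2 + ln (vol_growth (q - 1) (?it n))"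
          using vpos[of "q - 1" "?it n"] by (simp add: ln_mult)
        also have "\<dots> \<le> ln (vol_growth q (?it n))" using gap_n gr diff big gn by (simp add: abs_if split: if_splits)
        finally show ?thesis using vpos[of "q - 1" "?it n"] vpos[of q "?it n"] by simp
      qed
      have "exp (\<gamma> / 2 * real n) * norm v \<le> norm (?it n *v v)" if v: "v \<in> G" for v
      proof (cases "v = 0")
        case False
        then have "v \<notin> L" using v GL by auto
        have "vol_growth q (?it n) * norm v \<le>
            2 * C * real q * (c * exp (\<gamma> / 4 * real n) * norm v + norm (?it n *v v)) * vol_growth (q - 1) (?it n)"
        proof (rule expansion_from_volume)
          show "q \<ge> 1" using \<open>q \<noteq> 0\<close> by simp
          show "norm l + norm (t *\<^sub>R v) \<le> C * norm (l + t *\<^sub>R v)" if "l \<in> L" for l t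
            using C(2)[OF that subspace_scale[OF G(1) v]] .
        qed (use L dimL \<open>v \<notin> L\<close> vol C(1) c in auto)
        also have "\<dots> = D * (c * exp (\<gamma> / 4 * real n) * norm v + norm (?it n *v v)) * vol_growth (q - 1) (?it n)"
          by (simp add: D_def)
        also have "\<dots> \<le> D * (c * exp (\<gamma> / 4 * real n) * norm v + norm (?it n *v v)) * exp ((\<Lambda> - \<gamma>) * real n + K)"
        proof (rule mult_left_mono)
          show "vol_growth (q - 1) (?it n) \<le> exp ((\<Lambda> - \<gamma>) * real n + K)"
            using gap_n vpos[of "q - 1" "?it n"] by (metis exp_le_cancel_iff exp_ln)
        qed (use D c in auto)
        finally have 1: "vol_growth q (?it n) * norm v \<le>
          D * (c * exp (\<gamma> / 4 * real n) * norm v + norm (?it n *v v)) * exp ((\<Lambda> - \<gamma>) * real n + K)" .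
        have "exp ((\<Lambda> - \<gamma> / 4) * real n - K) \<le> vol_growth q (?it n)"
          using gr vpos[of q "?it n"] by (metis exp_le_cancel_iff exp_ln)
        then have "exp ((\<Lambda> - \<gamma> / 4) * real n - K) * norm v \<le> vol_growth q (?it n) * norm v"
          by (rule mult_right_mono) simp
        also note 1
        also have "exp ((\<Lambda> - \<gamma> / 4) * real n - K) = exp (3 * (\<gamma> / 4 * real n) - 2 * K) * exp ((\<Lambda> - \<gamma>) * real n + K)"
          unfolding diff[symmetric] by (simp flip: exp_add)
        finally have 2: "exp (3 * (\<gamma> / 4 * real n) - 2 * K) * norm v \<le>
            D * (c * exp (\<gamma> / 4 * real n) * norm v + norm (?it n *v v))"
          by (simp add: mult.commute mult.left_commute)
        \<comment> \<open>The weight \<open>c + 1\<close> leaves one full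
          \<open>exp (\<gamma> / 2 * real n)\<close> after the slow term, with coefficient
          \<open>c\<close>, has been subtracted.\<close>
        have "D * (c + 1) = exp (ln (D * (c + 1)))" using D c by simp
        also have "\<dots> \<le> exp (\<gamma> / 4 * real n - 2 * K)"
        proof -
          have "ln (D * (c + 1)) \<le> \<gamma> / 4 * real n - 2 * K"
            using big ln2 abs_ge_self[of K] abs_ge_self[of "ln (D * (c + 1))"] by linarith
          then show ?thesis by (simp only: exp_le_cancel_iff)
        qed
        finally have "D * (c + 1) * exp (\<gamma> / 2 * real n) \<le> exp (\<gamma> / 4 * real n - 2 * K) * exp (\<gamma> / 2 * real n)"
          by (rule mult_right_mono) simp
        also have "\<dots> = exp (3 * (\<gamma> / 4 * real n) - 2 * K)" by (simp flip: exp_add)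
        finally have "D * (c + 1) * exp (\<gamma> / 2 * real n) * norm v \<le>
          D * (c * exp (\<gamma> / 4 * real n) * norm v + norm (?it n *v v))"
          using 2 by (meson mult_right_mono norm_ge_zero order_trans)
        then have "D * ((c + 1) * exp (\<gamma> / 2 * real n) * norm v) \<le>
          D * (c * exp (\<gamma> / 4 * real n) * norm v + norm (?it n *v v))"
          by (simp only: mult.assoc)
        then have 3: "(c + 1) * exp (\<gamma> / 2 * real n) * norm v \<le> c * exp (\<gamma> / 4 * real n) * norm v + norm (?it n *v v)"
          using D by simp
        have "c * exp (\<gamma> / 4 * real n) * norm v \<le> c * exp (\<gamma> / 2 * real n) * norm v"
          using c \<gamma> by (intro mult_right_mono mult_left_mono) auto
        then show ?thesis using 3 by (simp add: algebra_simps)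
      qed simp
      then show ?thesis using n by auto
    qed
    then show ?thesis using \<gamma> by (intro exI[of _ "\<gamma> / 2"]) auto
  qed
qed

section \<open>Measurability, and expansion at almost every point\<close>

lemma borel_measurable_mat_norm [measurable]:
  "(mat_norm :: real^'p^'p \<Rightarrow> real) \<in> borel_measurable borel"
proof (rule borel_measurableI_greater)
  fix c :: real
  have "open {B :: real^'p^'p. c < mat_norm B}"
  proof (cases "c < 0")
    case True
    then have "{B :: real^'p^'p. c < mat_norm B} = UNIV" using mat_norm_nonneg by (auto intro: less_le_trans)
    then show ?thesis by simp
  next
    case False
    have "c < mat_norm B \<longleftrightarrow> (\<exists>v. c * norm v < norm (B *v v))" for B :: "real^'p^'p"
    proof
      assume "c < mat_norm B"
      then show "\<exists>v. c * norm v < norm (B *v v)"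
        using onorm_le[of "(*v) B" c] unfolding mat_norm_def by (meson not_le)
    next
      assume "\<exists>v. c * norm v < norm (B *v v)"
      then obtain v where "c * norm v < norm (B *v v)" by blast
      also have "\<dots> \<le> mat_norm B * norm v" by (rule mat_norm)
      finally show "c < mat_norm B" by (simp add: mult_less_cancel_right)
    qed
    then have "{B :: real^'p^'p. c < mat_norm B} = (\<Union>v. {B. c * norm v < norm (B *v v)})" by auto
    moreover have "open {B :: real^'p^'p. c * norm v < norm (B *v v)}" for v
    proof (rule open_Collect_less)
      have "continuous_on UNIV (\<lambda>B :: real^'p^'p. \<chi> i. \<Sum>j\<in>UNIV. B $ i $ j * v $ j)"
        by (intro continuous_intros)
      then show "continuous_on UNIV (\<lambda>B :: real^'p^'p. norm (B *v v))"
        unfolding matrix_vector_mult_def by (rule continuous_on_norm)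
    qed simp
    ultimately show ?thesis by auto
  qed
  then show "{B :: real^'p^'p \<in> space borel. c < mat_norm B} \<in> sets borel"
    by (simp add: borel_open)
qed

lemma borel_measurable_matrix_mult [measurable (raw)]:
  fixes f g :: "'a \<Rightarrow> real^'p^'p"
  assumes "f \<in> borel_measurable M" "g \<in> borel_measurable M"
  shows "(\<lambda>x. f x ** g x) \<in> borel_measurable M"
proof (rule borel_measurable_continuous_Pair[OF assms])
  show "continuous_on UNIV (\<lambda>x :: (real^'p^'p) \<times> (real^'p^'p). fst x ** snd x)"
    unfolding matrix_matrix_mult_def by (intro continuous_intros)
qed

context ergodic_system
begin

lemma cocycle_iter_measurable [measurable]:
  fixes A :: "'a \<Rightarrow> real^'p^'p"
  assumes [measurable]: "A \<in> borel_measurable M"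
  shows "cocycle_iter T A n \<in> borel_measurable M"
proof (induction n)
  case 0
  have "cocycle_iter T A 0 = (\<lambda>x. mat 1)" by auto
  then show ?case by simp
next
  case (Suc n)
  note Suc [measurable]
  have "cocycle_iter T A (Suc n) = (\<lambda>x. A ((T ^^ n) x) ** cocycle_iter T A n x)" by auto
  then show ?case by simp
qed

text \<open>Countably many tolerances \<open>e i\<close> and all orbit points are treated before
  \<open>G\<close> is fixed, which lets the quantifier over uncountably many \<open>G\<close> stand
  inside the almost everywhere statement.\<close>

lemma AE_uniform_expansion:
  fixes A :: "'a \<Rightarrow> real^'p^'p"
  assumes A [measurable]: "A \<in> borel_measurable M"
    and inv: "\<And>x. x \<in> space M \<Longrightarrow> invertible (A x)"
    and int: "integrable M (\<lambda>x. ln (max 1 (mat_norm (A x))))"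
  shows "AE x in M. \<forall>G. subspace G \<and> G \<inter> central_stable T A x = {0} \<longrightarrow>
    (\<exists>r>0. \<forall>m. \<exists>n\<ge>m. \<forall>v\<in>G. exp (r * real n) * norm v \<le> norm (cocycle_iter T A n x *v v))"
proof -
  define a where "a = (\<lambda>j n x. ln (vol_growth j (cocycle_iter T A n x)))"
  have [measurable]: "a j n \<in> borel_measurable M" for j n unfolding a_def by measurable
  have vpos: "vol_growth j B > 0" for j and B :: "real^'p^'p" using vol_growth_ge_1[of j B] by linarith
  have nonneg: "a j n x \<ge> 0" for j n x
    using vol_growth_ge_1[of j "cocycle_iter T A n x"] by (simp add: a_def)
  have ln_mult_le: "ln (vol_growth j (B ** C)) \<le> ln (vol_growth j B) + ln (vol_growth j C)" for j and B C :: "real^'p^'p"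
  proof -
    have "ln (vol_growth j (B ** C)) \<le> ln (vol_growth j B * vol_growth j C)"
      using vol_growth_mult[of j B C] vpos[of j "B ** C"] by (intro ln_mono) auto
    then show ?thesis using vpos[of j B] vpos[of j C] by (simp add: ln_mult)
  qed
  have sub: "a j (n + m) x \<le> a j n ((T ^^ m) x) + a j m x" for j n m x
    unfolding a_def cocycle_iter_add by (rule ln_mult_le)
  have mono: "a j n x \<le> a k n x" if "vol_growth j (cocycle_iter T A n x) \<le> vol_growth k (cocycle_iter T A n x)" for j k n x
    using that vpos[of j "cocycle_iter T A n x"] unfolding a_def by (intro ln_mono) auto
  have int1: "integrable M (\<lambda>x. ln (vol_growth j (A x)))" for j
  proof (rule Bochner_Integration.integrable_bound)
    show "integrable M (\<lambda>x. ln (fact CARD('p)) + real CARD('p) * ln (max 1 (mat_norm (A x))))"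
      using int by simp
    show "AE x in M. norm (ln (vol_growth j (A x))) \<le>
        norm (ln (fact CARD('p)) + real CARD('p) * ln (max 1 (mat_norm (A x))))"
    proof (rule AE_I2)
      fix x
      have "ln (vol_growth j (A x)) \<le> ln (fact CARD('p) * max 1 (mat_norm (A x)) ^ CARD('p))"
        using vol_growth_le_norm[of j "A x"] vpos[of j "A x"] by (intro ln_mono) auto
      also have "\<dots> = ln (fact CARD('p)) + real CARD('p) * ln (max 1 (mat_norm (A x)))"
        by (subst ln_mult) (auto simp: ln_realpow)
      finally show "norm (ln (vol_growth j (A x))) \<le>
        norm (ln (fact CARD('p)) + real CARD('p) * ln (max 1 (mat_norm (A x))))"
        using vol_growth_ge_1[of j "A x"] by simp
    qed
  qed measurable
  have a_int: "integrable M (a j n)" for j n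
  proof (induction n)
    case 0
    have "a j 0 = (\<lambda>x. ln (vol_growth j (mat 1 :: real^'p^'p)))" by (auto simp: a_def)
    then show ?case by simp
  next
    case (Suc n)
    show ?case
    proof (rule Bochner_Integration.integrable_bound)
      show "integrable M (\<lambda>x. ln (vol_growth j (A ((T ^^ n) x))) + a j n x)"
        by (intro Bochner_Integration.integrable_add Suc integrable_funpow int1)
      show "AE x in M. norm (a j (Suc n) x) \<le> norm (ln (vol_growth j (A ((T ^^ n) x))) + a j n x)"
      proof (rule AE_I2)
        fix x
        have "a j (Suc n) x \<le> ln (vol_growth j (A ((T ^^ n) x))) + a j n x"
          using ln_mult_le[of j "A ((T ^^ n) x)" "cocycle_iter T A n x"] by (simp add: a_def)
        then show "norm (a j (Suc n) x) \<le> norm (ln (vol_growth j (A ((T ^^ n) x))) + a j n x)"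
          using nonneg[of j "Suc n" x] by simp
      qed
    qed measurable
  qed
  \<comment> \<open>As an infimum (Fekete), \<open>\<Lambda> j\<close> bounds all integrals from
    below, the input of \<open>karlsson_margulis\<close>, and is nearly attained by a single
    \<open>m\<close>, the input of \<open>subadditive_upper_bound\<close>.\<close>
  define \<Lambda> where "\<Lambda> = (\<lambda>j. INF n\<in>{1::nat..}. (\<integral>x. a j n x \<partial>M) / real n)"
  have bdd: "bdd_below ((\<lambda>n. (\<integral>x. a j n x \<partial>M) / real n) ` {1::nat..})" for j
    by (rule bdd_belowI[of _ 0]) (auto intro!: divide_nonneg_nonneg Bochner_Integration.integral_nonneg nonneg)
  have \<Lambda>_le: "\<Lambda> j * real n \<le> (\<integral>x. a j n x \<partial>M)" if "n \<ge> 1" for j n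
  proof -
    have "\<Lambda> j \<le> (\<integral>x. a j n x \<partial>M) / real n" unfolding \<Lambda>_def using that by (intro cINF_lower bdd) auto
    then show ?thesis using that by (simp add: field_simps)
  qed
  have \<Lambda>_less: "\<exists>m\<ge>1. (\<integral>x. a j m x \<partial>M) < c * real m" if "\<Lambda> j < c" for j c
  proof -
    have "\<exists>m\<in>{1::nat..}. (\<integral>x. a j m x \<partial>M) / real m < c"
      using that cINF_less_iff[OF _ bdd, of j c] unfolding \<Lambda>_def by auto
    then obtain m :: nat where "m \<ge> 1" "(\<integral>x. a j m x \<partial>M) / real m < c" by auto
    then show ?thesis by (intro exI[of _ m]) (auto simp: field_simps)
  qed
  have \<Lambda>_mono: "\<Lambda> j \<le> \<Lambda> k" if "\<And>B :: real^'p^'p. vol_growth j B \<le> vol_growth k B" for j k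
    unfolding \<Lambda>_def
  proof (rule cINF_mono)
    fix n :: nat assume n: "n \<in> {1..}"
    show "\<exists>m\<in>{1..}. (\<integral>x. a j m x \<partial>M) / real m \<le> (\<integral>x. a k n x \<partial>M) / real n"
      using n by (intro bexI[of _ n] divide_right_mono integral_mono a_int mono that) auto
  qed (use bdd[of j] in simp_all)
  \<comment> \<open>In terms of the multiplicative ergodic theorem, \<open>q\<close> is the number
    of positive Lyapunov exponents.\<close>
  define q where "q = (LEAST j. \<Lambda> j = \<Lambda> (CARD('p)))"
  have q_eq: "\<Lambda> q = \<Lambda> CARD('p)" unfolding q_def by (rule LeastI) simp
  have q_le: "q \<le> CARD('p)" unfolding q_def by (rule Least_le) simp
  \<comment> \<open>Argued with frames because \<open>Suc q\<close> may exceed the dimension; index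
    sets never have more than \<open>CARD('p)\<close> elements.\<close>
  have \<Lambda>_Suc: "\<Lambda> (Suc q) \<le> \<Lambda> q"
    unfolding q_eq
  proof (rule \<Lambda>_mono, rule vol_growth_le)
    fix B :: "real^'p^'p" and J v w
    assume "(J, v, w) \<in> (unit_frames (Suc q) :: ('p set \<times> ('p \<Rightarrow> real^'p) \<times> _) set)"
    then have "(J, v, w) \<in> unit_frames CARD('p)" by (auto simp: unit_frames_def card_mono)
    then show "\<bar>row_det (override_on w (\<lambda>i. B *v v i) J)\<bar> \<le> vol_growth CARD('p) B" by (rule vol_growth_upper)
  qed
  obtain \<gamma> where \<gamma>: "\<gamma> > 0" "q = 0 \<or> \<Lambda> (q - 1) < \<Lambda> q - \<gamma>"
  proof (cases "q = 0")
    case True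
    then show ?thesis using that[of 1] by simp
  next
    case False
    have "\<Lambda> (q - 1) \<le> \<Lambda> q" by (rule \<Lambda>_mono) (simp add: vol_growth_mono)
    moreover have "\<Lambda> (q - 1) \<noteq> \<Lambda> q"
      using not_less_Least[of "q - 1" "\<lambda>j. \<Lambda> j = \<Lambda> (CARD('p))"] False q_eq unfolding q_def[symmetric] by auto
    ultimately show ?thesis using that[of "(\<Lambda> q - \<Lambda> (q - 1)) / 2"] by (simp add: field_simps)
  qed
  \<comment> \<open>The factor 4 gives \<open>2 * e i \<le> \<gamma>\<close>, the gap required by
    \<open>slow_space_dim\<close>, and \<open>e 0 = \<gamma> / 4\<close>, the loss allowed in
    \<open>uniform_expansion\<close>.\<close>
  define e where "e = (\<lambda>i::nat. \<gamma> / (4 * real (Suc i)))"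
  have e_pos: "e i > 0" for i using \<gamma> by (simp add: e_def)
  have e_le: "2 * e i \<le> \<gamma>" for i using \<gamma> by (simp add: e_def field_simps)
  define good where "good = (\<lambda>i y. \<forall>m. \<exists>n\<ge>m. \<forall>k\<in>{1..n}. (\<Lambda> q - e i) * real k + a q (n - k) ((T ^^ k) y) < a q n y)"
  have F1: "AE x in M. \<exists>K. \<forall>n. a (Suc q) n x \<le> (\<Lambda> q + e i) * real n + K" for i
  proof -
    have "\<Lambda> (Suc q) < \<Lambda> q + e i" using \<Lambda>_Suc e_pos[of i] by linarith
    then obtain m where "m \<ge> 1" "(\<integral>x. a (Suc q) m x \<partial>M) < (\<Lambda> q + e i) * real m" using \<Lambda>_less by blast
    then show ?thesis by (intro subadditive_upper_bound[where m=m] a_int nonneg sub)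
  qed
  have F2: "AE x in M. q = 0 \<or> (\<exists>K. \<forall>n. a (q - 1) n x \<le> (\<Lambda> q - \<gamma>) * real n + K)"
  proof (cases "q = 0")
    case False
    then obtain m where "m \<ge> 1" "(\<integral>x. a (q - 1) m x \<partial>M) < (\<Lambda> q - \<gamma>) * real m" using \<Lambda>_less \<gamma>(2) by blast
    then have "AE x in M. \<exists>K. \<forall>n. a (q - 1) n x \<le> (\<Lambda> q - \<gamma>) * real n + K"
      by (intro subadditive_upper_bound[where m=m] a_int nonneg sub)
    then show ?thesis by eventually_elim blast
  qed simp
  have F3: "AE x in M. \<exists>l. good i ((T ^^ l) x)" for i
  proof -
    \<comment> \<open>Subtracting slightly less than the growth rate leaves integrals that grow at
      rate at least \<open>e i\<close>. So \<open>karlsson_margulis\<close> yields good points of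
      positive measure, and almost every orbit meets them.\<close>
    define a' where "a' = (\<lambda>n x. a q n x - (\<Lambda> q - e i) * real n)"
    define S where "S = {x \<in> space M. \<forall>m. \<exists>n\<ge>m. \<forall>k\<in>{1..n}. a' (n - k) ((T ^^ k) x) < a' n x}"
    have f1: "integrable M (a' n)" for n using a_int unfolding a'_def by simp
    have f2: "a' (Suc n) x \<le> a' n (T x) + (a q 1 x + \<bar>\<Lambda> q - e i\<bar>)" for n x
      using sub[of q n 1 x] abs_ge_minus_self[of "\<Lambda> q - e i"] by (simp add: a'_def algebra_simps)
    have f3: "e i * real n \<le> (\<integral>x. a' n x \<partial>M)" if "n \<ge> 1" for n
      using \<Lambda>_le[OF that, of q] a_int[of q n] by (simp add: a'_def prob_space algebra_simps)
    have f4: "integrable M (\<lambda>x. a q 1 x + \<bar>\<Lambda> q - e i\<bar>)" "a q 1 x + \<bar>\<Lambda> q - e i\<bar> \<ge> 0" for x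
      using a_int nonneg by auto
    have "S \<in> sets M" "measure M S > 0"
      unfolding S_def using karlsson_margulis[OF f1 f4 f2 e_pos f3] by blast+
    then have "AE x in M. \<exists>l. (T ^^ l) x \<in> S" by (intro AE_visits) auto
    then show ?thesis
    proof eventually_elim
      case (elim x)
      then obtain l where l: "(T ^^ l) x \<in> S" by blast
      have "good i ((T ^^ l) x)"
        unfolding good_def
      proof
        fix m
        obtain n where n: "n \<ge> m" "\<And>k. k \<in> {1..n} \<Longrightarrow> a' (n - k) ((T ^^ k) ((T ^^ l) x)) < a' n ((T ^^ l) x)"
          using l unfolding S_def by blast
        have "(\<Lambda> q - e i) * real k + a q (n - k) ((T ^^ k) ((T ^^ l) x)) < a q n ((T ^^ l) x)" if "k \<in> {1..n}" for k
          using n(2)[OF that] that by (simp add: a'_def of_nat_diff algebra_simps)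
        then show "\<exists>n\<ge>m. \<forall>k\<in>{1..n}. (\<Lambda> q - e i) * real k + a q (n - k) ((T ^^ k) ((T ^^ l) x)) < a q n ((T ^^ l) x)"
          using n(1) by blast
      qed
      then show ?case by blast
    qed
  qed
  \<comment> \<open>The upper bounds are wanted at the orbit point that has good times; as it
    depends on \<open>i\<close> and \<open>x\<close>, they are secured along the whole
    orbit.\<close>
  have "AE x in M. \<forall>l. \<forall>i. \<exists>K. \<forall>n. a (Suc q) n ((T ^^ l) x) \<le> (\<Lambda> q + e i) * real n + K"
    unfolding AE_all_countable by (intro allI AE_funpow F1)
  moreover have "AE x in M. \<forall>l. q = 0 \<or> (\<exists>K. \<forall>n. a (q - 1) n ((T ^^ l) x) \<le> (\<Lambda> q - \<gamma>) * real n + K)"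
    unfolding AE_all_countable by (intro allI AE_funpow F2)
  moreover have "AE x in M. \<forall>i. \<exists>l. good i ((T ^^ l) x)"
    unfolding AE_all_countable by (intro allI F3)
  ultimately show ?thesis
    using AE_space
  proof eventually_elim
    case (elim x)
    have invx: "invertible (A ((T ^^ n) x))" for n using inv funpow_space elim(4) by blast
    have invy: "invertible (A ((T ^^ n) ((T ^^ l) x)))" for n l
      using invx[of "n + l"] by (simp add: funpow_add)
    have slow_i: "CARD('p) - q \<le> dim (slow_space T A (4 * e i) x)" for i
    proof -
      obtain l where l: "good i ((T ^^ l) x)" using elim(3) by blast
      define y where "y = (T ^^ l) x"
      obtain K1 where K1: "\<And>n. a (Suc q) n y \<le> (\<Lambda> q + e i) * real n + K1" using elim(1) unfolding y_def by blast
      obtain K2 where K2: "q = 0 \<or> (\<forall>n. a (q - 1) n y \<le> (\<Lambda> q - \<gamma>) * real n + K2)" using elim(2) unfolding y_def by blast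
      have "CARD('p) - q \<le> dim (slow_space T A (4 * e i) y)"
      proof (rule slow_space_dim[where K="max K1 K2" and \<Lambda>="\<Lambda> q"])
        show "invertible (A ((T ^^ n) y))" for n using invy by (simp add: y_def)
        show "\<exists>n\<ge>m. \<forall>k\<in>{1..n}. (\<Lambda> q - e i) * real k + ln (vol_growth q (cocycle_iter T A (n - k) ((T ^^ k) y)))
          < ln (vol_growth q (cocycle_iter T A n y))" for m
          using l unfolding good_def a_def y_def by blast
        show "ln (vol_growth (Suc q) (cocycle_iter T A n y)) \<le> (\<Lambda> q + e i) * real n + max K1 K2" for n
          using K1[of n] by (simp add: a_def)
        show "q = 0 \<or> (\<forall>n. ln (vol_growth (q - 1) (cocycle_iter T A n y)) \<le> (\<Lambda> q - 2 * e i) * real n + max K1 K2)"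
        proof (cases "q = 0")
          case False
          have "a (q - 1) n y \<le> (\<Lambda> q - 2 * e i) * real n + max K1 K2" for n
          proof -
            have "(\<Lambda> q - \<gamma>) * real n \<le> (\<Lambda> q - 2 * e i) * real n" using e_le[of i] by (intro mult_right_mono) auto
            moreover have "a (q - 1) n y \<le> (\<Lambda> q - \<gamma>) * real n + K2" using K2 False by blast
            ultimately show ?thesis by linarith
          qed
          then show ?thesis by (simp add: a_def)
        qed simp
      qed (use q_le e_pos in auto)
      also have "\<dots> \<le> dim (slow_space T A (4 * e i) x)"
        unfolding y_def by (rule slow_space_pullback) (use invx e_pos[of i] in auto)
      finally show ?thesis .
    qed
    have slow: "CARD('p) - q \<le> dim (slow_space T A d x)" if d: "d > 0" for d
    proof -
      obtain i :: nat where i: "\<gamma> / d \<le> real i" using real_arch_simple by blast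
      have "4 * e i \<le> d"
      proof -
        have "\<gamma> \<le> d * real i" using i d by (simp add: field_simps)
        also have "\<dots> \<le> d * real (Suc i)" using d by simp
        finally show ?thesis by (simp add: e_def field_simps)
      qed
      then show ?thesis using slow_i[of i] dim_subset[OF slow_space_mono[of "4 * e i" d T A x]] by linarith
    qed
    obtain K2 where K2: "q = 0 \<or> (\<forall>n. a (q - 1) n x \<le> (\<Lambda> q - \<gamma>) * real n + K2)"
      using elim(2)[rule_format, of 0] by auto
    obtain l where l: "good 0 ((T ^^ l) x)" using elim(3) by blast
    have "invertible (cocycle_iter T A l x)" by (rule invertible_cocycle_iter) (rule invx)
    \<comment> \<open>Growth is transferred from \<open>(T ^^ l) x\<close> back to \<open>x\<close>:
      the iterate over \<open>(T ^^ l) x\<close> is \<open>cocycle_iter T A (n + l) x ** D\<close>,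
      and the fixed factor \<open>D\<close> costs only a constant.\<close>
    then obtain D where D: "cocycle_iter T A l x ** D = mat 1" by (auto simp: invertible_def)
    define K3 where "K3 = ln (vol_growth q D) + (\<Lambda> q - \<gamma> / 4) * real l"
    have growth: "\<exists>n\<ge>m. (\<Lambda> q - \<gamma> / 4) * real n - K3 \<le> a q n x" for m
    proof -
      obtain n where n: "n \<ge> max 1 m" "\<And>k. k \<in> {1..n} \<Longrightarrow> (\<Lambda> q - e 0) * real k + a q (n - k) ((T ^^ k) ((T ^^ l) x)) < a q n ((T ^^ l) x)"
        using l unfolding good_def by blast
      have "(\<Lambda> q - \<gamma> / 4) * real n \<le> a q n ((T ^^ l) x)"
        using n(2)[of n] n(1) nonneg[of q 0 "(T ^^ n) ((T ^^ l) x)"] by (simp add: e_def)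
      also have "\<dots> = ln (vol_growth q (cocycle_iter T A (n + l) x ** D))"
        unfolding cocycle_iter_add a_def using D by (simp flip: matrix_mul_assoc)
      also have "\<dots> \<le> a q (n + l) x + ln (vol_growth q D)"
        unfolding a_def by (rule ln_mult_le)
      finally have "(\<Lambda> q - \<gamma> / 4) * real (n + l) - K3 \<le> a q (n + l) x"
        by (simp add: K3_def algebra_simps add_divide_distrib)
      then show ?thesis using n(1) by (intro exI[of _ "n + l"]) auto
    qed
    show ?case
    proof (intro allI impI)
      fix G assume G: "subspace G \<and> G \<inter> central_stable T A x = {0}"
      show "\<exists>r>0. \<forall>m. \<exists>n\<ge>m. \<forall>v\<in>G. exp (r * real n) * norm v \<le> norm (cocycle_iter T A n x *v v)"
      proof (rule uniform_expansion[where K="max K2 K3" and \<Lambda>="\<Lambda> q" and \<gamma>=\<gamma> and q=q])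
        show "q = 0 \<or> (\<forall>n. ln (vol_growth (q - 1) (cocycle_iter T A n x)) \<le> (\<Lambda> q - \<gamma>) * real n + max K2 K3)"
        proof (cases "q = 0")
          case False
          have "a (q - 1) n x \<le> (\<Lambda> q - \<gamma>) * real n + max K2 K3" for n
          proof -
            have "a (q - 1) n x \<le> (\<Lambda> q - \<gamma>) * real n + K2" using K2 False by blast
            then show ?thesis by linarith
          qed
          then show ?thesis by (simp add: a_def)
        qed simp
        show "\<exists>n\<ge>m. (\<Lambda> q - \<gamma> / 4) * real n - max K2 K3 \<le> ln (vol_growth q (cocycle_iter T A n x))" for m
        proof -
          obtain n where "n \<ge> m" "(\<Lambda> q - \<gamma> / 4) * real n - K3 \<le> a q n x" using growth by blast
          then show ?thesis unfolding a_def by (intro exI[of _ n]) auto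
        qed
      qed (use q_le \<gamma> slow G in auto)
    qed
  qed
qed

end

section \<open>Covers by integer points\<close>

text \<open>Nullity for the \<open>s\<close>-dimensional Hausdorff measure with mesh
  \<open>\<delta>\<close> and total \<open>\<eta>\<close> made explicit; countable unions are then
  handled by splitting \<open>\<eta>\<close> geometrically.\<close>

definition fine_covers :: "real \<Rightarrow> 'b::metric_space set \<Rightarrow> bool" where
  "fine_covers s S \<longleftrightarrow> (\<forall>\<delta>>0. \<forall>\<eta>>0. \<exists>U :: nat \<Rightarrow> 'b set. S \<subseteq> (\<Union>i. U i) \<and>
     (\<forall>i. bounded (U i) \<and> diameter (U i) \<le> \<delta>) \<and> (\<Sum>i. diam_pow s (U i)) \<le> ennreal \<eta>)"

lemma hausdorff_measure_eq_0I:
  assumes "fine_covers s S"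
  shows "hausdorff_measure s S = 0"
proof -
  have "hausdorff_pre s \<delta> S \<le> 0" if pos: "\<delta> > 0" for \<delta>
  proof (rule ennreal_le_epsilon)
    fix \<eta> :: real assume "\<eta> > 0"
    then obtain U :: "nat \<Rightarrow> 'a set" where "S \<subseteq> (\<Union>i. U i)" "\<forall>i. bounded (U i) \<and> diameter (U i) \<le> \<delta>"
      "(\<Sum>i. diam_pow s (U i)) \<le> ennreal \<eta>"
      using assms pos unfolding fine_covers_def by blast
    then show "hausdorff_pre s \<delta> S \<le> 0 + ennreal \<eta>"
      unfolding hausdorff_pre_def by (intro INF_lower2[of U]) auto
  qed
  then show ?thesis unfolding hausdorff_measure_def by (intro antisym SUP_least) auto
qed

lemma fine_covers_subset:
  fixes R S :: "'b::metric_space set"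
  assumes "fine_covers s S" "R \<subseteq> S"
  shows "fine_covers s R"
  unfolding fine_covers_def
proof (intro allI impI)
  fix \<delta> \<eta> :: real assume "\<delta> > 0" "\<eta> > 0"
  then obtain U :: "nat \<Rightarrow> 'b set" where "S \<subseteq> (\<Union>i. U i)" "\<forall>i. bounded (U i) \<and> diameter (U i) \<le> \<delta>"
    "(\<Sum>i. diam_pow s (U i)) \<le> ennreal \<eta>"
    using assms(1) unfolding fine_covers_def by blast
  then show "\<exists>U :: nat \<Rightarrow> 'b set. R \<subseteq> (\<Union>i. U i) \<and> (\<forall>i. bounded (U i) \<and> diameter (U i) \<le> \<delta>) \<and>
      (\<Sum>i. diam_pow s (U i)) \<le> ennreal \<eta>"
    using assms(2) by (intro exI[of _ U]) auto
qed

lemma fine_covers_UN: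
  assumes "\<And>j::nat. fine_covers s (S j)"
  shows "fine_covers s (\<Union>j. S j)"
  unfolding fine_covers_def
proof (intro allI impI)
  fix \<delta> \<eta> :: real assume pos: "\<delta> > 0" "\<eta> > 0"
  have "\<exists>U :: nat \<Rightarrow> 'a set. S j \<subseteq> (\<Union>i. U i) \<and> (\<forall>i. bounded (U i) \<and> diameter (U i) \<le> \<delta>) \<and>
      (\<Sum>i. diam_pow s (U i)) \<le> ennreal (\<eta> * (1/2) ^ Suc j)" for j
  proof -
    have "\<eta> * (1/2) ^ Suc j > 0" using pos by simp
    then show ?thesis using assms[of j] pos(1) unfolding fine_covers_def by blast
  qed
  then obtain U :: "nat \<Rightarrow> nat \<Rightarrow> 'a set" where U: "\<And>j. S j \<subseteq> (\<Union>i. U j i)"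
    "\<And>j i. bounded (U j i) \<and> diameter (U j i) \<le> \<delta>"
    "\<And>j. (\<Sum>i. diam_pow s (U j i)) \<le> ennreal (\<eta> * (1/2) ^ Suc j)" by metis
  define V where "V = (\<lambda>k. U (fst (prod_decode k)) (snd (prod_decode k)))"
  have "(\<Union>j. S j) \<subseteq> (\<Union>k. V k)"
  proof
    fix w assume "w \<in> (\<Union>j. S j)"
    then obtain j i where "w \<in> U j i" using U(1) by blast
    then have "w \<in> V (prod_encode (j, i))" by (simp add: V_def)
    then show "w \<in> (\<Union>k. V k)" by blast
  qed
  moreover have "(\<Sum>k. diam_pow s (V k)) \<le> ennreal \<eta>"
  proof -
    have "(\<Sum>k. diam_pow s (V k)) = (\<Sum>j. \<Sum>i. diam_pow s (U j i))"
      unfolding V_def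
      by (rule suminf_ennreal_2dimen[of "\<lambda>j. \<Sum>i. diam_pow s (U j i)" "\<lambda>z. diam_pow s (U (fst z) (snd z))"]) simp
    also have "\<dots> \<le> (\<Sum>j. ennreal (\<eta> * (1/2) ^ Suc j))" by (intro suminf_le U) auto
    also have "\<dots> = ennreal (\<eta> * 1)"
      using pos by (intro suminf_ennreal_eq sums_mult power_half_series) auto
    finally show ?thesis by simp
  qed
  ultimately show "\<exists>U :: nat \<Rightarrow> 'a set. (\<Union>j. S j) \<subseteq> (\<Union>i. U i) \<and>
      (\<forall>i. bounded (U i) \<and> diameter (U i) \<le> \<delta>) \<and> (\<Sum>i. diam_pow s (U i)) \<le> ennreal \<eta>"
    using U(2) by (intro exI[of _ V]) (auto simp: V_def)
qed

text \<open>Finite covers by sets of a common diameter bound are padded to sequences with empty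
  sets, which contribute 0 by the convention in \<open>diam_pow\<close>.\<close>

lemma fine_coversI:
  fixes S :: "'b::metric_space set"
  assumes s: "s > 0"
    and cover: "\<And>\<delta> \<eta>. \<delta> > 0 \<Longrightarrow> \<eta> > 0 \<Longrightarrow> \<exists>(Z :: 'c set) V d. finite Z \<and> S \<subseteq> (\<Union>z\<in>Z. V z) \<and>
      (\<forall>z\<in>Z. \<forall>u\<in>V z. \<forall>w\<in>V z. dist u w \<le> d) \<and> 0 \<le> d \<and> d \<le> \<delta> \<and> real (card Z) * d powr s \<le> \<eta>"
  shows "fine_covers s S"
  unfolding fine_covers_def
proof (intro allI impI)
  fix \<delta> \<eta> :: real assume pos: "\<delta> > 0" "\<eta> > 0"
  obtain Z :: "'c set" and V d where fin: "finite Z" and S: "S \<subseteq> (\<Union>z\<in>Z. V z)"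
    and V: "\<And>z u w. z \<in> Z \<Longrightarrow> u \<in> V z \<Longrightarrow> w \<in> V z \<Longrightarrow> dist u w \<le> d"
    and d: "0 \<le> d" "d \<le> \<delta>" "real (card Z) * d powr s \<le> \<eta>"
    using cover[OF pos] by metis
  obtain h where h: "bij_betw h {0..<card Z} Z" using ex_bij_betw_nat_finite[OF fin] by blast
  define U where "U = (\<lambda>i. if i < card Z then V (h i) else {})"
  have hZ: "i < card Z \<Longrightarrow> h i \<in> Z" for i using h by (auto simp: bij_betw_def)
  have dU: "dist u w \<le> d" if "u \<in> U i" "w \<in> U i" for u w i
    using that V hZ by (auto simp: U_def split: if_splits)
  have bdd: "bounded (U i)" for i
  proof (cases "U i = {}")
    case False
    then obtain u where "u \<in> U i" by blast
    then have "\<forall>w\<in>U i. dist u w \<le> d" using dU by blast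
    then show ?thesis unfolding bounded_def by blast
  qed simp
  have diam: "diameter (U i) \<le> d" for i
    unfolding diameter_def using dU d(1) by (auto intro!: cSUP_least)
  have "S \<subseteq> (\<Union>i. U i)"
  proof
    fix w assume "w \<in> S"
    then obtain z where z: "z \<in> Z" "w \<in> V z" using S by blast
    then have "z \<in> h ` {0..<card Z}" using h by (simp add: bij_betw_def)
    then obtain i where "i < card Z" "h i = z" by auto
    then show "w \<in> (\<Union>i. U i)" using z(2) by (auto simp: U_def)
  qed
  moreover have "(\<Sum>i. diam_pow s (U i)) \<le> ennreal \<eta>"
  proof -
    have "diam_pow s (U i) \<le> ennreal (d powr s)" for i
      using s diam[of i] diameter_ge_0[OF bdd[of i]]
      by (auto simp: diam_pow_def intro!: ennreal_leI powr_mono2)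
    moreover have "(\<Sum>i. diam_pow s (U i)) = (\<Sum>i<card Z. diam_pow s (U i))"
      by (rule suminf_finite) (auto simp: U_def diam_pow_def)
    ultimately have "(\<Sum>i. diam_pow s (U i)) \<le> (\<Sum>i<card Z. ennreal (d powr s))"
      by (simp only: sum_mono)
    also have "\<dots> = ennreal (real (card Z) * d powr s)"
      by (subst sum_ennreal) auto
    also have "\<dots> \<le> ennreal \<eta>" using d(3) by (rule ennreal_leI)
    finally show ?thesis .
  qed
  ultimately show "\<exists>U :: nat \<Rightarrow> 'b set. S \<subseteq> (\<Union>i. U i) \<and>
      (\<forall>i. bounded (U i) \<and> diameter (U i) \<le> \<delta>) \<and> (\<Sum>i. diam_pow s (U i)) \<le> ennreal \<eta>"
    using bdd diam d(2) by (intro exI[of _ U]) (meson order_trans)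
qed

section \<open>Integer points near an orbit\<close>

lemma lattice_ball_card:
  fixes y :: "real^'p"
  assumes "\<rho> \<ge> 0"
  shows "finite {z \<in> int_lattice. dist z y < \<rho>}"
    and "real (card {z \<in> int_lattice. dist z y < \<rho>}) \<le> (2 * \<rho> + 1) ^ CARD('p)"
proof -
  define F where "F = (\<lambda>i. {\<lceil>y $ i - \<rho>\<rceil>..\<lfloor>y $ i + \<rho>\<rfloor>})"
  define g :: "('p \<Rightarrow> int) \<Rightarrow> real^'p" where "g = (\<lambda>f. \<chi> i. of_int (f i))"
  have sub: "{z \<in> int_lattice. dist z y < \<rho>} \<subseteq> g ` PiE UNIV F"
  proof
    fix z assume "z \<in> {z \<in> int_lattice. dist z y < \<rho>}"
    then have z: "\<And>i. z $ i \<in> \<int>" "dist z y < \<rho>" by (auto simp: int_lattice_def)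
    have "\<bar>z $ i - y $ i\<bar> < \<rho>" for i
      using component_le_norm_cart[of "z - y" i] z(2) by (simp add: dist_norm)
    then have "\<lfloor>z $ i\<rfloor> \<in> F i" for i
      using z(1)[of i] by (auto simp: F_def ceiling_le_iff le_floor_iff elim!: Ints_cases) (smt (verit))+
    moreover have "z = g (\<lambda>i. \<lfloor>z $ i\<rfloor>)"
      using z(1) by (simp add: g_def vec_eq_iff of_int_floor)
    ultimately show "z \<in> g ` PiE UNIV F" by (intro image_eqI) auto
  qed
  have fin: "finite (PiE UNIV F)" by (intro finite_PiE) (auto simp: F_def)
  then show "finite {z \<in> int_lattice. dist z y < \<rho>}" using sub finite_subset by blast
  have "card {z \<in> int_lattice. dist z y < \<rho>} \<le> card (PiE UNIV F)"
    using card_mono[OF _ sub] card_image_le[OF fin, of g] fin by (meson finite_imageI order_trans)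
  also have "\<dots> = (\<Prod>i\<in>UNIV. card (F i))" by (simp add: card_PiE)
  finally have "real (card {z \<in> int_lattice. dist z y < \<rho>}) \<le> (\<Prod>i\<in>UNIV. real (card (F i)))"
    by (simp flip: of_nat_prod)
  also have "\<dots> \<le> (\<Prod>i\<in>(UNIV::'p set). 2 * \<rho> + 1)"
  proof (rule prod_mono, intro conjI)
    fix i
    show "real (card (F i)) \<le> 2 * \<rho> + 1"
    proof (cases "\<lceil>y $ i - \<rho>\<rceil> \<le> \<lfloor>y $ i + \<rho>\<rfloor>")
      case True
      then have "real (card (F i)) = of_int (\<lfloor>y $ i + \<rho>\<rfloor> + 1 - \<lceil>y $ i - \<rho>\<rceil>)" by (simp add: F_def)
      also have "\<dots> \<le> 2 * \<rho> + 1"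
        using of_int_floor_le[of "y $ i + \<rho>"] le_of_int_ceiling[of "y $ i - \<rho>"]
        unfolding of_int_diff of_int_add of_int_1 by linarith
      finally show ?thesis .
    qed (use assms in \<open>simp add: F_def\<close>)
  qed simp
  finally show "real (card {z \<in> int_lattice. dist z y < \<rho>}) \<le> (2 * \<rho> + 1) ^ CARD('p)" by simp
qed

lemma int_lattice_dist:
  fixes y z :: "real^'p"
  assumes "y \<in> int_lattice" "z \<in> int_lattice" "dist y z < 1"
  shows "y = z"
proof -
  have "y $ i = z $ i" for i
  proof -
    have "\<bar>y $ i - z $ i\<bar> < 1"
      using component_le_norm_cart[of "y - z" i] assms(3) by (simp add: dist_norm)
    moreover have "y $ i - z $ i \<in> \<int>" using assms by (auto simp: int_lattice_def)
    ultimately have "y $ i - z $ i = 0" using Ints_nonzero_abs_less1 by blast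
    then show ?thesis by simp
  qed
  then show ?thesis by (simp add: vec_eq_iff)
qed

text \<open>The exponential of this function bounds the number of integer points that can follow a given
  one when the errors stay below \<open>1 / (2 (m + 1))\<close>.\<close>

definition branching :: "real \<Rightarrow> real^'p^'p \<Rightarrow> real" where
  "branching m B = (if mat_norm B > m then 2 * real CARD('p) * ln (mat_norm B) else 0)"

lemma branching_nonneg:
  assumes "m \<ge> 2"
  shows "branching m B \<ge> 0"
proof (cases "mat_norm B > m")
  case True
  then have "ln (mat_norm B) \<ge> 0" using assms by (intro ln_ge_zero) linarith
  then show ?thesis by (simp add: branching_def)
qed (simp add: branching_def)

text \<open>The radius \<open>\<rho>\<close> collects an error \<open>1 / (2 * (m + 1))\<close> at
  the new time and \<open>mat_norm B\<close> times the same error carried over. For norm at most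
  \<open>m\<close> the open ball has diameter at most 1 and holds at most one integer point. For
  larger norm, \<open>2 * \<rho> + 1\<close> is at most the square of the norm, hence the factor 2
  in \<open>branching\<close>.\<close>

lemma branching_card:
  fixes B :: "real^'p^'p" and y :: "real^'p"
  assumes m: "m \<ge> 2"
  defines "\<rho> \<equiv> (mat_norm B + 1) / (2 * (m + 1))"
  shows "real (card {z \<in> int_lattice. dist z y < \<rho>}) \<le> exp (branching m B)"
proof (cases "mat_norm B > m")
  case True
  have \<rho>: "\<rho> \<ge> 0" using mat_norm_nonneg[of B] m by (simp add: \<rho>_def)
  have "2 * \<rho> + 1 = (mat_norm B + 1) / (m + 1) + 1" using m by (simp add: \<rho>_def field_simps)
  also have "\<dots> \<le> (mat_norm B + 1) / 1 + 1"
    using m mat_norm_nonneg[of B] by (intro add_right_mono divide_left_mono) auto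
  also have "\<dots> \<le> mat_norm B * 2" using True m by simp
  also have "\<dots> \<le> mat_norm B * mat_norm B" using True m by (intro mult_left_mono) auto
  finally have le: "2 * \<rho> + 1 \<le> (mat_norm B)\<^sup>2" by (simp add: power2_eq_square)
  have "real (card {z \<in> int_lattice. dist z y < \<rho>}) \<le> (2 * \<rho> + 1) ^ CARD('p)"
    by (rule lattice_ball_card(2)[OF \<rho>])
  also have "\<dots> \<le> ((mat_norm B)\<^sup>2) ^ CARD('p)" using le \<rho> by (intro power_mono) auto
  also have "\<dots> = exp (ln (mat_norm B)) ^ (2 * CARD('p))" using True m by (simp add: power_mult)
  also have "\<dots> = exp (branching m B)" using True by (simp add: branching_def flip: exp_of_nat_mult)
  finally show ?thesis .
next
  case False
  have "2 * \<rho> \<le> 1" using False m by (simp add: \<rho>_def field_simps)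
  have "u = w" if "u \<in> {z \<in> int_lattice. dist z y < \<rho>}" "w \<in> {z \<in> int_lattice. dist z y < \<rho>}" for u w
  proof (rule int_lattice_dist)
    have "dist u w \<le> dist u y + dist w y" by (rule dist_triangle2)
    then show "dist u w < 1" using that \<open>2 * \<rho> \<le> 1\<close> by auto
  qed (use that in auto)
  then have "card {z \<in> int_lattice. dist z y < \<rho>} \<le> Suc 0"
    using mat_norm_nonneg[of B] m by (subst card_le_Suc0_iff_eq) (auto simp: \<rho>_def lattice_ball_card(1))
  then show ?thesis using False by (simp add: branching_def)
qed

text \<open>Each integer point near the orbit lies within the radius of
  \<open>branching_card\<close> of the image of its predecessor, so the counts multiply. The
  constant is the number of integer points available at time \<open>n0\<close>, finite thanks to
  \<open>R\<close> and independent of \<open>k\<close>.\<close>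

lemma reachable_integer_points:
  fixes T :: "'a \<Rightarrow> 'a" and A :: "'a \<Rightarrow> real^'p^'p" and n0 :: nat and x :: 'a and R :: real
  assumes m: "m \<ge> 2"
  defines "\<delta> \<equiv> 1 / (2 * (m + 1))"
  defines "S \<equiv> {w. norm (cocycle_iter T A n0 x *v w) \<le> R \<and> (\<forall>n\<ge>n0. \<exists>z\<in>int_lattice. dist (cocycle_iter T A n x *v w) z < \<delta>)}"
  shows "\<exists>C\<ge>0. \<forall>k. \<exists>Z. finite Z \<and> Z \<subseteq> int_lattice \<and>
    real (card Z) \<le> C * exp (\<Sum>n\<in>{n0..<n0+k}. branching m (A ((T ^^ n) x))) \<and>
    (\<forall>w\<in>S. \<exists>z\<in>Z. dist (cocycle_iter T A (n0 + k) x *v w) z < \<delta>)"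
proof -
  have \<delta>: "\<delta> > 0" using m by (simp add: \<delta>_def)
  define Z0 :: "(real^'p) set" where "Z0 = {z \<in> int_lattice. dist z 0 < \<bar>R\<bar> + \<delta>}"
  have main: "\<exists>Z. finite Z \<and> Z \<subseteq> int_lattice \<and>
    real (card Z) \<le> real (card Z0) * exp (\<Sum>n\<in>{n0..<n0+k}. branching m (A ((T ^^ n) x))) \<and>
    (\<forall>w\<in>S. \<exists>z\<in>Z. dist (cocycle_iter T A (n0 + k) x *v w) z < \<delta>)" for k
  proof (induction k)
    case 0
    have "\<exists>z\<in>Z0. dist (cocycle_iter T A n0 x *v w) z < \<delta>" if w: "w \<in> S" for w
    proof -
      obtain z where z: "z \<in> int_lattice" "dist (cocycle_iter T A n0 x *v w) z < \<delta>"
        using w unfolding S_def by blast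
      have "dist z 0 \<le> dist z (cocycle_iter T A n0 x *v w) + dist (cocycle_iter T A n0 x *v w) 0" by (rule dist_triangle)
      also have "\<dots> < \<delta> + \<bar>R\<bar>" using z(2) w by (auto simp: S_def dist_commute)
      finally have "z \<in> Z0" using z(1) by (simp add: Z0_def)
      then show ?thesis using z(2) by blast
    qed
    moreover have "finite Z0" unfolding Z0_def using \<delta> by (intro lattice_ball_card) auto
    ultimately show ?case by (intro exI[of _ Z0]) (auto simp: Z0_def)
  next
    case (Suc k)
    define B where "B = A ((T ^^ (n0 + k)) x)"
    define \<rho> where "\<rho> = (mat_norm B + 1) / (2 * (m + 1))"
    have \<rho>: "\<rho> \<ge> 0" using mat_norm_nonneg[of B] m by (simp add: \<rho>_def)
    obtain Z where Z: "finite Z" "Z \<subseteq> int_lattice"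
      "real (card Z) \<le> real (card Z0) * exp (\<Sum>n\<in>{n0..<n0+k}. branching m (A ((T ^^ n) x)))"
      "\<And>w. w \<in> S \<Longrightarrow> \<exists>z\<in>Z. dist (cocycle_iter T A (n0 + k) x *v w) z < \<delta>"
      using Suc by blast
    define N where "N = (\<lambda>z. {z' \<in> int_lattice. dist z' (B *v z) < \<rho>})"
    have finN: "finite (N z)" for z unfolding N_def by (rule lattice_ball_card(1)[OF \<rho>])
    have "real (card (\<Union>z\<in>Z. N z)) \<le> (\<Sum>z\<in>Z. real (card (N z)))"
      using card_UN_le[OF Z(1), of N] by (simp flip: of_nat_sum)
    also have "\<dots> \<le> (\<Sum>z\<in>Z. exp (branching m B))"
      unfolding N_def \<rho>_def by (intro sum_mono branching_card m)
    also have "\<dots> = real (card Z) * exp (branching m B)" by simp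
    also have "\<dots> \<le> real (card Z0) * exp (\<Sum>n\<in>{n0..<n0+k}. branching m (A ((T ^^ n) x))) * exp (branching m B)"
      using Z(3) by (intro mult_right_mono) auto
    also have "\<dots> = real (card Z0) * exp (\<Sum>n\<in>{n0..<n0+Suc k}. branching m (A ((T ^^ n) x)))"
      by (simp add: B_def exp_add)
    finally have card: "real (card (\<Union>z\<in>Z. N z)) \<le>
      real (card Z0) * exp (\<Sum>n\<in>{n0..<n0+Suc k}. branching m (A ((T ^^ n) x)))" .
    have "\<exists>z\<in>(\<Union>z\<in>Z. N z). dist (cocycle_iter T A (n0 + Suc k) x *v w) z < \<delta>" if w: "w \<in> S" for w
    proof -
      let ?u = "cocycle_iter T A (n0 + k) x *v w"
      obtain z where z: "z \<in> Z" "dist ?u z < \<delta>" using Z(4)[OF w] by blast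
      have next_it: "cocycle_iter T A (n0 + Suc k) x *v w = B *v ?u"
        by (simp add: B_def matrix_vector_mul_assoc)
      have "\<exists>z'\<in>int_lattice. dist (cocycle_iter T A (n0 + Suc k) x *v w) z' < \<delta>"
        using w unfolding S_def by (simp del: cocycle_iter.simps add_Suc_right)
      then obtain z' where z': "z' \<in> int_lattice" "dist (B *v ?u) z' < \<delta>"
        unfolding next_it by blast
      have "dist z' (B *v z) \<le> dist z' (B *v ?u) + dist (B *v ?u) (B *v z)" by (rule dist_triangle)
      also have "dist (B *v ?u) (B *v z) \<le> mat_norm B * dist ?u z"
        using mat_norm[of B "?u - z"] by (simp add: dist_norm matrix_vector_mult_diff_distrib)
      also have "\<dots> \<le> mat_norm B * \<delta>" using z(2) mat_norm_nonneg by (intro mult_left_mono) auto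
      finally have "dist z' (B *v z) < \<delta> + mat_norm B * \<delta>" using z'(2) by (simp add: dist_commute)
      also have "\<dots> = \<rho>" using m by (simp add: \<delta>_def \<rho>_def field_simps)
      finally have "z' \<in> N z" using z'(1) by (simp add: N_def)
      then show ?thesis using z(1) z'(2) unfolding next_it by blast
    qed
    then show ?case
      using card Z(1) finN by (intro exI[of _ "\<Union>z\<in>Z. N z"]) (auto simp: N_def simp del: cocycle_iter.simps)
  qed
  show ?thesis by (intro exI[of _ "real (card Z0)"] conjI allI, simp, rule main)
qed

text \<open>Points of \<open>G\<close> close to the same integer point at an expanding time
  \<open>n\<close> have images less than \<open>2 * \<delta> \<le> 1\<close> apart, hence are
  themselves within \<open>exp (- (r * real n))\<close>. Their classes number at most a multiple of
  \<open>exp (c * real n)\<close>, so the weighted count decays at rate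
  \<open>s * r - c\<close>.\<close>

lemma fine_covers_weak_stable:
  fixes A :: "'a \<Rightarrow> real^'p^'p"
  assumes s: "s > 0" and r: "r > 0" and G0: "subspace G0" and m: "m \<ge> 2"
    and expand: "\<And>l. \<exists>n\<ge>l. \<forall>v\<in>G0. exp (r * real n) * norm v \<le> norm (cocycle_iter T A n x *v v)"
    and few: "\<And>n. (\<Sum>i<n. branching m (A ((T ^^ i) x))) \<le> c * real n + K" and c: "c < s * r"
  shows "fine_covers s (((\<lambda>g. a + g) ` G0) \<inter> weak_stable T A x)"
proof -
  let ?it = "\<lambda>n. cocycle_iter T A n x"
  define \<delta> where "\<delta> = 1 / (2 * (m + 1))"
  have \<delta>: "\<delta> > 0" "2 * \<delta> \<le> 1" using m by (auto simp: \<delta>_def field_simps)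
  define G where "G = (\<lambda>g. a + g) ` G0"
  have Gdiff: "u - w \<in> G0" if "u \<in> G" "w \<in> G" for u w
    using that subspace_diff[OF G0] by (auto simp: G_def)
  define S where "S = (\<lambda>n0 R. {w. norm (?it n0 *v w) \<le> real R \<and> (\<forall>n\<ge>n0. \<exists>z\<in>int_lattice. dist (?it n *v w) z < \<delta>)})"
  have S_fine: "fine_covers s (G \<inter> S n0 R)" for n0 R
  proof (rule fine_coversI[OF s, where 'c="real^'p"])
    fix \<epsilon> \<eta> :: real assume pos: "\<epsilon> > 0" "\<eta> > 0"
    have "\<exists>C\<ge>0. \<forall>k. \<exists>Z. finite Z \<and> Z \<subseteq> int_lattice \<and>
      real (card Z) \<le> C * exp (\<Sum>n\<in>{n0..<n0+k}. branching m (A ((T ^^ n) x))) \<and>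
      (\<forall>w\<in>S n0 R. \<exists>z\<in>Z. dist (?it (n0 + k) *v w) z < \<delta>)"
      unfolding S_def \<delta>_def
      by (rule reachable_integer_points[OF m])
    then obtain C where C: "C \<ge> 0" "\<And>k. \<exists>Z. finite Z \<and> Z \<subseteq> int_lattice \<and>
      real (card Z) \<le> C * exp (\<Sum>n\<in>{n0..<n0+k}. branching m (A ((T ^^ n) x))) \<and>
      (\<forall>w\<in>S n0 R. \<exists>z\<in>Z. dist (?it (n0 + k) *v w) z < \<delta>)" by blast
    \<comment> \<open>\<open>l1\<close> brings the diameter below \<open>\<epsilon>\<close> and
      \<open>l2\<close> the weighted count below \<open>\<eta>\<close>; \<open>C + 1\<close> stands
      in for \<open>C\<close> so that its logarithm makes sense.\<close>
    obtain l1 :: nat where l1: "- ln \<epsilon> / r \<le> real l1" using real_arch_simple by blast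
    obtain l2 :: nat where l2: "(ln ((C + 1) * exp K) - ln \<eta>) / (s * r - c) \<le> real l2" using real_arch_simple by blast
    obtain n where n: "n \<ge> max n0 (max l1 l2)" and
      ex: "\<And>v. v \<in> G0 \<Longrightarrow> exp (r * real n) * norm v \<le> norm (?it n *v v)" using expand by blast
    obtain k where k: "n = n0 + k" using n le_Suc_ex by (metis max.bounded_iff)
    obtain Z where Z: "finite Z" "real (card Z) \<le> C * exp (\<Sum>n\<in>{n0..<n0+k}. branching m (A ((T ^^ n) x)))"
      "\<And>w. w \<in> S n0 R \<Longrightarrow> \<exists>z\<in>Z. dist (?it n *v w) z < \<delta>" using C(2)[of k] unfolding k by blast
    define V where "V = (\<lambda>z. {w \<in> G. dist (?it n *v w) z < \<delta>})"
    define d where "d = exp (- (r * real n))"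
    have "d \<le> \<epsilon>"
    proof -
      have "- ln \<epsilon> / r \<le> real n" using l1 n by (meson max.bounded_iff of_nat_le_iff order_trans)
      then have "- (r * real n) \<le> ln \<epsilon>" using r by (simp add: field_simps)
      then have "exp (- (r * real n)) \<le> exp (ln \<epsilon>)" by (simp only: exp_le_cancel_iff)
      then show ?thesis using pos by (simp add: d_def)
    qed
    moreover have "dist u w \<le> d" if "u \<in> V z" "w \<in> V z" for u w z
    proof -
      have "exp (r * real n) * norm (u - w) \<le> norm (?it n *v (u - w))"
        using that by (intro ex Gdiff) (auto simp: V_def)
      also have "\<dots> = dist (?it n *v u) (?it n *v w)" by (simp add: dist_norm matrix_vector_mult_diff_distrib)
      also have "\<dots> \<le> dist (?it n *v u) z + dist (?it n *v w) z" by (rule dist_triangle2)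
      also have "\<dots> \<le> 1" using that \<delta> by (auto simp: V_def)
      finally show ?thesis by (simp add: d_def dist_norm exp_minus field_simps)
    qed
    moreover have "G \<inter> S n0 R \<subseteq> (\<Union>z\<in>Z. V z)" using Z(3) by (auto simp: V_def)
    moreover have "real (card Z) * d powr s \<le> \<eta>"
    proof -
      have "(\<Sum>n\<in>{n0..<n0+k}. branching m (A ((T ^^ n) x))) \<le> (\<Sum>i<n. branching m (A ((T ^^ i) x)))"
        using m by (intro sum_mono2) (auto simp: k branching_nonneg)
      then have sum_le: "(\<Sum>n\<in>{n0..<n0+k}. branching m (A ((T ^^ n) x))) \<le> c * real n + K" using few[of n] by linarith
      have "real (card Z) \<le> C * exp (c * real n + K)"
        using Z(2) sum_le C(1) by (meson exp_le_cancel_iff mult_left_mono order_trans)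
      also have "\<dots> \<le> (C + 1) * exp (c * real n + K)" by (intro mult_right_mono) auto
      finally have "real (card Z) * d powr s \<le> (C + 1) * exp (c * real n + K) * d powr s"
        by (intro mult_right_mono) auto
      also have "\<dots> = (C + 1) * exp (c * real n + K) * exp (- (s * r * real n))" by (simp add: d_def powr_def)
      also have "\<dots> = ((C + 1) * exp K) * exp (- ((s * r - c) * real n))"
      proof -
        have "exp (c * real n + K) * exp (- (s * r * real n)) = exp K * exp (- ((s * r - c) * real n))"
          unfolding exp_add[symmetric] by (simp add: algebra_simps)
        then show ?thesis by (simp only: mult.assoc)
      qed
      also have "\<dots> \<le> \<eta>"
      proof -
        have CK: "(C + 1) * exp K > 0" using C(1) by simp
        have "(ln ((C + 1) * exp K) - ln \<eta>) / (s * r - c) \<le> real n"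
          using l2 n by (meson max.bounded_iff of_nat_le_iff order_trans)
        then have "ln ((C + 1) * exp K) - (s * r - c) * real n \<le> ln \<eta>" using c by (simp add: field_simps)
        then have "exp (ln ((C + 1) * exp K) - (s * r - c) * real n) \<le> exp (ln \<eta>)" by (simp only: exp_le_cancel_iff)
        moreover have "exp (ln ((C + 1) * exp K) - (s * r - c) * real n) =
            ((C + 1) * exp K) * exp (- ((s * r - c) * real n))"
          using CK by (simp only: diff_conv_add_uminus exp_add exp_ln)
        ultimately show ?thesis using pos by simp
      qed
      finally show ?thesis .
    qed
    moreover have "0 \<le> d" by (simp add: d_def)
    ultimately show "\<exists>Z (V :: real^'p \<Rightarrow> (real^'p) set) d. finite Z \<and> G \<inter> S n0 R \<subseteq> (\<Union>z\<in>Z. V z) \<and>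
      (\<forall>z\<in>Z. \<forall>u\<in>V z. \<forall>w\<in>V z. dist u w \<le> d) \<and> 0 \<le> d \<and> d \<le> \<epsilon> \<and> real (card Z) * d powr s \<le> \<eta>"
      using Z(1) by (intro exI[of _ Z] exI[of _ V] exI[of _ d]) auto
  qed
  \<comment> \<open>Convergence to 0 is relaxed to errors below \<open>\<delta>\<close> from some
    time on; natural \<open>n0\<close> and \<open>R\<close> make the union countable.\<close>
  have "G \<inter> weak_stable T A x \<subseteq> (\<Union>n0. \<Union>R. G \<inter> S n0 R)"
  proof
    fix w assume w: "w \<in> G \<inter> weak_stable T A x"
    then have "(\<lambda>n. infdist (?it n *v w) int_lattice) \<longlonglongrightarrow> 0" by (simp add: weak_stable_def)
    then have "\<forall>\<^sub>F n in sequentially. infdist (?it n *v w) int_lattice < \<delta>"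
      using \<delta>(1) by (rule order_tendstoD(2))
    then obtain n0 where n0: "\<And>n. n \<ge> n0 \<Longrightarrow> infdist (?it n *v w) int_lattice < \<delta>"
      by (auto simp: eventually_sequentially)
    have "(0 :: real^'p) \<in> int_lattice" by (simp add: int_lattice_def)
    then have ne: "int_lattice \<noteq> ({} :: (real^'p) set)" by blast
    have "\<exists>z\<in>int_lattice. dist (?it n *v w) z < \<delta>" if "n \<ge> n0" for n
      using n0[OF that] ne unfolding infdist_notempty[OF ne]
      by (subst (asm) cINF_less_iff) auto
    moreover obtain R :: nat where "norm (?it n0 *v w) \<le> real R" using real_arch_simple by blast
    ultimately have "w \<in> S n0 R" by (simp add: S_def)
    then show "w \<in> (\<Union>n0. \<Union>R. G \<inter> S n0 R)" using w by blast
  qed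
  then show ?thesis
    unfolding G_def[symmetric] by (intro fine_covers_subset[OF fine_covers_UN[OF fine_covers_UN[OF S_fine]]])
qed

section \<open>Vanishing of the Hausdorff dimension\<close>

lemma hausdorff_dim_eq_0I:
  assumes "\<And>s. s > 0 \<Longrightarrow> hausdorff_measure s S = 0"
  shows "hausdorff_dim S = 0"
proof (rule antisym)
  show "hausdorff_dim S \<le> 0"
  proof (rule ereal_le_epsilon2)
    fix s :: real assume "s > 0"
    then show "hausdorff_dim S \<le> 0 + ereal s"
      unfolding hausdorff_dim_def using assms by (auto intro!: Inf_lower)
  qed
  show "0 \<le> hausdorff_dim S"
    unfolding hausdorff_dim_def by (rule Inf_greatest) auto
qed

theorem theoremA1:
  fixes M :: "'a measure" and T :: "'a \<Rightarrow> 'a" and A :: "'a \<Rightarrow> real^'p^'p"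
  assumes "measurable_cocycle M T A"
  shows "AE x in M. \<forall>(G0 :: (real^'p) set) (a :: real^'p).
            subspace G0 \<and> G0 \<inter> central_stable T A x = {0} \<longrightarrow>
            hausdorff_dim (((\<lambda>g. a + g) ` G0) \<inter> weak_stable T A x) = 0"
proof -
  interpret prob_space M using assms by (simp add: measurable_cocycle_def)
  interpret ergodic_system M T
    by unfold_locales (use assms in \<open>auto simp: measurable_cocycle_def\<close>)
  have A [measurable]: "A \<in> borel_measurable M" and inv: "\<And>x. x \<in> space M \<Longrightarrow> invertible (A x)"
    and fin: "(\<integral>\<^sup>+ x. ennreal (ln (mat_norm (A x))) \<partial>M) < \<infinity>"
    using assms by (auto simp: measurable_cocycle_def)
  \<comment> \<open>Holds at norm 0 as well, since \<open>ln 0 = 0\<close>. The conversion to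
    \<open>ennreal\<close> in \<open>measurable_cocycle\<close> cuts off negative values, so the
    integral there is that of this positive part.\<close>
  have pos_part: "ln (max 1 (mat_norm B)) = max 0 (ln (mat_norm B))" for B :: "real^'p^'p"
    using mat_norm_nonneg[of B] by (cases "mat_norm B = 0") (auto simp: max_def)
  have int: "integrable M (\<lambda>x. ln (max 1 (mat_norm (A x))))"
  proof (rule integrableI_nonneg)
    have "(\<integral>\<^sup>+ x. ennreal (ln (max 1 (mat_norm (A x)))) \<partial>M) = (\<integral>\<^sup>+ x. ennreal (ln (mat_norm (A x))) \<partial>M)"
      unfolding pos_part by (intro nn_integral_cong) (auto simp: max_def ennreal_neg)
    then show "(\<integral>\<^sup>+ x. ennreal (ln (max 1 (mat_norm (A x)))) \<partial>M) < \<infinity>" using fin by simp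
  qed auto
  \<comment> \<open>Thresholds start at 2, as \<open>branching_card\<close> demands. By dominated
    convergence, raising them makes the mean branching arbitrarily small.\<close>
  define g where "g = (\<lambda>(k::nat) x. branching (real k + 2) (A x))"
  have [measurable]: "g k \<in> borel_measurable M" for k unfolding g_def branching_def by measurable
  have g_le: "norm (g k x) \<le> 2 * real CARD('p) * ln (max 1 (mat_norm (A x)))" for k x
    unfolding pos_part by (auto simp: g_def branching_def)
  have g_int: "integrable M (g k)" for k
    by (rule Bochner_Integration.integrable_bound[where f="\<lambda>x. 2 * real CARD('p) * ln (max 1 (mat_norm (A x)))"])
      (use int g_le in \<open>auto intro!: AE_I2 order_trans[OF g_le]\<close>)
  have "(\<lambda>k. \<integral>x. g k x \<partial>M) \<longlonglongrightarrow> (\<integral>x. 0 \<partial>M)"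
  proof (rule integral_dominated_convergence[where w="\<lambda>x. 2 * real CARD('p) * ln (max 1 (mat_norm (A x)))"])
    show "AE x in M. (\<lambda>k. g k x) \<longlonglongrightarrow> 0"
    proof (intro AE_I2 tendsto_eventually)
      fix x
      obtain l :: nat where "mat_norm (A x) \<le> real l" using real_arch_simple by blast
      then show "\<forall>\<^sub>F k in sequentially. g k x = 0"
        unfolding eventually_sequentially by (intro exI[of _ l]) (auto simp: g_def branching_def)
    qed
    show "AE x in M. norm (g k x) \<le> 2 * real CARD('p) * ln (max 1 (mat_norm (A x)))" for k
      by (intro AE_I2 g_le)
  qed (use int in auto)
  \<comment> \<open>The added \<open>1 / real (Suc k)\<close> provides the strict inequality in
    \<open>birkhoff_upper_bound\<close>.\<close>
  then have g_lim: "(\<lambda>k. (\<integral>x. g k x \<partial>M) + 1 / real (Suc k)) \<longlonglongrightarrow> 0"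
    using tendsto_add[OF _ lim_inverse_n'] LIMSEQ_Suc[OF lim_inverse_n'] tendsto_add by fastforce
  have "AE x in M. \<forall>k. \<exists>K. \<forall>n. birkhoff (g k) n x \<le> ((\<integral>x. g k x \<partial>M) + 1 / real (Suc k)) * real n + K"
    unfolding AE_all_countable by (intro allI birkhoff_upper_bound g_int) simp
  moreover have "AE x in M. \<forall>G. subspace G \<and> G \<inter> central_stable T A x = {0} \<longrightarrow>
    (\<exists>r>0. \<forall>m. \<exists>n\<ge>m. \<forall>v\<in>G. exp (r * real n) * norm v \<le> norm (cocycle_iter T A n x *v v))"
    by (rule AE_uniform_expansion[OF A inv int])
  ultimately show ?thesis
  proof eventually_elim
    case (elim x)
    show ?case
    proof (intro allI impI hausdorff_dim_eq_0I hausdorff_measure_eq_0I)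
      fix G0 :: "(real^'p) set" and a :: "real^'p" and s :: real
      assume G0: "subspace G0 \<and> G0 \<inter> central_stable T A x = {0}" and s: "s > 0"
      from elim(2)[THEN spec, THEN mp, OF G0] obtain r where r: "r > 0"
        "\<And>m. \<exists>n\<ge>m. \<forall>v\<in>G0. exp (r * real n) * norm v \<le> norm (cocycle_iter T A n x *v v)"
        by auto
      \<comment> \<open>The threshold is chosen only once \<open>r\<close> and \<open>s\<close> are
        known; the Birkhoff bounds hold at \<open>x\<close> for all \<open>k\<close> simultaneously,
        so no new exceptional set arises.\<close>
      have "s * r > 0" using s r by simp
      from order_tendstoD(2)[OF g_lim this]
      obtain k where k: "(\<integral>x. g k x \<partial>M) + 1 / real (Suc k) < s * r"
        by (auto simp: eventually_sequentially)
      obtain K where K: "\<And>n. birkhoff (g k) n x \<le> ((\<integral>x. g k x \<partial>M) + 1 / real (Suc k)) * real n + K"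
        using elim(1) by blast
      show "fine_covers s (((\<lambda>g. a + g) ` G0) \<inter> weak_stable T A x)"
        by (rule fine_covers_weak_stable[OF s r(1) _ _ r(2) _ k, where K=K and m="real k + 2"])
          (use G0 K in \<open>auto simp: birkhoff_def g_def\<close>)
    qed
  qed
qed

end
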